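(* Let $d = 1$ and $N = 3$ and consider the modified process described in the context. Let $\mathcal{X}_3(0)$ consist of $3$ distinct points in $[0,1]$. Write $\mu := \mu_2(\mathcal{X}_3'(0))$ and $D := D_2(\mathcal{X}_3'(0))$. There exists a random $\xi_3 = \xi_3(\mathcal{X}_3(0)) \in \mathbb{R}$ such that $\mathcal{X}_3'(t) \to (\xi_3,\xi_3)$ almost surely as $t \to \infty$. The distribution of $\xi_3$ can be characterized via $$\xi_3 \stackrel{d}{=} \mu + D L,$$ where $L$ is independent of $(\mu,D)$, $L \stackrel{d}{=} -L$, and the distribution of $L$ is determined by the distributional solution to the fixed-point equation $$L \stackrel{d}{=} \begin{cases} -\frac{1+U}{2} + U L & \text{with probability } \frac13,\\ -\frac{2-U}{4} + \frac{U}{2} L & \text{with probability } \frac16,\\ \phantom{-}\frac{2-U}{4} + \frac{U}{2} L & \text{with probability } \frac16,\\ \phantom{-}\frac{1+U}{2} + U L & \text{with probability } \frac13,\end{cases}$$ where $\mathbb{E}[|L|^k] < \infty$ for all $k$, and $U$ is uniform on $[0,1]$. Writing $\theta_k := \mathbb{E}[L^k]$, we have $\theta_k = 0$ for odd $k$, and $\theta_2 = \frac{7}{12}$, $\theta_4 = \frac{375}{368}$, $\theta_6 = \frac{76693}{22080}$. In particular, $$\mathbb{E}[\xi_3] = \mathbb{E}[\mu], \quad \mathbb{E}[\xi_3^2] = \mathbb{E}[\mu^2] + \tfrac{7}{12}\mathbb{E}[D^2], \quad \mathbb{E}[\xi_3^3] = \mathbb{E}[\mu^3] + \tfrac74 \mathbb{E}[\mu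 D^2].$$ In the case where $\mathcal{X}_3(0)$ contains $3$ independent uniform random points on $[0,1]$, $\mathbb{E}[\xi_3^k] = \frac12, \frac13, \frac14$ for $k = 1,2,3$ respectively. If the initial points are $\frac14, \frac12, \frac34$, then $\mathbb{E}[\xi_3^k] = \frac12, \frac{29}{96}, \frac{13}{64}, \frac{873}{5888}$ for $k = 1,2,3,4$ respectively.
   Context: For $n$ points $\mathcal{X}_n = (x_1,\ldots,x_n)$ in $\mathbb{R}$ let $\mu_n(\mathcal{X}_n) = n^{-1}\sum_{i=1}^n x_i$ and $D_n(\mathcal{X}_n) = \max_{i,j}|x_i - x_j|$. Let $\operatorname{ord}(\mathcal{X}_n) = (x_{(1)},\ldots,x_{(n)})$ be the points re-ordered so that $|x_{(1)} - \mu_n(\mathcal{X}_n)| \le \cdots \le |x_{(n)} - \mu_n(\mathcal{X}_n)|$, any ties being broken (uniformly) at random. The core is $\mathcal{X}_n' := (x_{(1)},\ldots,x_{(n-1)})$. Modified process ($N=3$, $d=1$): start from the ordered vector $\mathcal{X}_3(0)$ of three distinct (possibly random) points of $[0,1]$. Given $\mathcal{X}_3(t) = (X_{(1)}(t),X_{(2)}(t),X_{(3)}(t))$, with core $\mathcal{X}_3'(t) = (X_{(1)}(t),X_{(2)}(t))$ and $D(t) := |X_{(1)}(t) - X_{(2)}(t)|$, let $U_{t+1}$ be (conditionally on the past) uniformly distributed on the interval $[\min \mathcal{X}_3'(t) - D(t),\ \max \mathcal{X}_3'(t) + D(t)]$ (which need not be contained in $[0,1]$), and set $\mathcal{X}_3(t+1)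 = \operatorname{ord}(X_{(1)}(t),X_{(2)}(t),U_{t+1})$. The symbol $\stackrel{d}{=}$ denotes equality in distribution. In the fixed-point equation, on the right-hand side $U$ and $L$ are independent, and the case is selected, independently of $(U,L)$, with the stated probabilities. *)

theory Defs
  imports "HOL-Probability.Probability"
begin

definition mean_pts :: "real ^ 'n \<Rightarrow> real" where
  "mean_pts x = (\<Sum>i\<in>UNIV. x $ i) / real CARD('n)"

definition diam_pts :: "real ^ 'n \<Rightarrow> real" where
  "diam_pts x = Max ((\<lambda>(i, j). \<bar>x $ i - x $ j\<bar>) ` UNIV)"

definition admissible_orders :: "real ^ 3 \<Rightarrow> (3 \<Rightarrow> 3) set" where
  "admissible_orders x = {\<pi>. \<pi> permutes UNIV \<and>
     \<bar>x $ \<pi> 1 - mean_pts x\<bar> \<le> \<bar>x $ \<pi> 2 - mean_pts x\<bar> \<and>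
     \<bar>x $ \<pi> 2 - mean_pts x\<bar> \<le> \<bar>x $ \<pi> 3 - mean_pts x\<bar>}"

text \<open>The law of \<open>ord x\<close> for a given configuration: because ties are broken uniformly at random,
  \<open>ord x\<close> is itself random, with all admissible orderings equally likely.\<close>

definition ord_pmf :: "real ^ 3 \<Rightarrow> (real ^ 3) pmf" where
  "ord_pmf x = map_pmf (\<lambda>\<pi>. \<chi> i. x $ \<pi> i) (pmf_of_set (admissible_orders x))"

definition core :: "real ^ 3 \<Rightarrow> real ^ 2" where
  "core x = vector [x $ 1, x $ 2]"

text \<open>\<open>\<kappa>\<close> is a version of the conditional distribution under \<open>M\<close> of \<open>Y\<close> given
  the sub-\<open>\<sigma>\<close>-algebra \<open>G\<close>.\<close>

definition has_cond_law ::
  "'a measure \<Rightarrow> 'a measure \<Rightarrow> ('a \<Rightarrow> 'b::topological_space) \<Rightarrow> ('a \<Rightarrow> 'b measure) \<Rightarrow> bool" where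
  "has_cond_law M G Y \<kappa> \<longleftrightarrow> Y \<in> borel_measurable M \<and>
     (\<forall>B\<in>sets borel.
        AE \<omega> in M. real_cond_exp M G (\<lambda>\<omega>. indicator B (Y \<omega>)) \<omega> = measure (\<kappa> \<omega>) B)"

text \<open>\<open>P\<close> is the vector of the three (possibly random) initial points before ordering, \<open>X t\<close> is the
  ordered configuration at time \<open>t\<close>, \<open>U (Suc t)\<close> is the new point drawn at that step (\<open>U 0\<close> is
  unused). The past at time \<open>t\<close> is \<open>F t\<close>, where \<open>F\<close> may be any filtration to which \<open>X\<close> is adapted.
  In the last assumption, the \<open>\<sigma>\<close>-algebra is the one generated by the past together with the
  new point.\<close>

locale modified_process = prob_space M + filtration "space M" F
  for M :: "'a measure" and F :: "nat \<Rightarrow> 'a measure" +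
  fixes P :: "'a \<Rightarrow> real ^ 3" and X :: "nat \<Rightarrow> 'a \<Rightarrow> real ^ 3" and U :: "nat \<Rightarrow> 'a \<Rightarrow> real"
  assumes F_subalgebra: "\<And>t. subalgebra M (F t)"
    and X_adapted: "\<And>t. X t \<in> borel_measurable (F t)"
    and P_measurable: "P \<in> borel_measurable M"
    and P_unit: "AE \<omega> in M. \<forall>i. P \<omega> $ i \<in> {0..1}"
    and P_distinct: "AE \<omega> in M. inj (\<lambda>i. P \<omega> $ i)"
    and X_init: "has_cond_law M (vimage_algebra (space M) P borel) (X 0)
                   (\<lambda>\<omega>. measure_pmf (ord_pmf (P \<omega>)))"
    and U_step: "\<And>t. has_cond_law M (F t) (U (Suc t))
                   (\<lambda>\<omega>. let a = X t \<omega> $ 1; b = X t \<omega> $ 2; d = \<bar>a - b\<bar>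
                        in uniform_measure lborel {min a b - d .. max a b + d})"
    and X_step: "\<And>t. has_cond_law M
                   (sigma (space M) (sets (F t) \<union> sets (vimage_algebra (space M) (U (Suc t)) borel)))
                   (X (Suc t))
                   (\<lambda>\<omega>. measure_pmf (ord_pmf (vector [X t \<omega> $ 1, X t \<omega> $ 2, U (Suc t) \<omega>])))"

fun branch :: "nat \<Rightarrow> real \<Rightarrow> real \<Rightarrow> real" where
  "branch 0 u l = - (1 + u) / 2 + u * l"
| "branch (Suc 0) u l = - (2 - u) / 4 + u / 2 * l"
| "branch (Suc (Suc 0)) u l = (2 - u) / 4 + u / 2 * l"
| "branch _ u l = (1 + u) / 2 + u * l"

definition branch_pmf :: "nat pmf" where
  "branch_pmf = pmf_of_list [(0, 1/3), (1, 1/6), (2, 1/6), (3, 1/3)]"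

text \<open>\<open>L\<close> is a probability law on the reals that solves the distributional fixed-point equation; the
  product measure expresses the independence of the uniform variable, of the variable with law \<open>L\<close>
  and of the choice of the case.\<close>

definition fixed_point_law :: "real measure \<Rightarrow> bool" where
  "fixed_point_law L \<longleftrightarrow> prob_space L \<and> sets L = sets borel \<and>
     L = distr (uniform_measure lborel {0..1} \<Otimes>\<^sub>M L \<Otimes>\<^sub>M measure_pmf branch_pmf) borel
           (\<lambda>(u, l, c). branch c u l)"

end

theory Submission
  imports Defs
begin

text \<open>
  The core is always a closest pair, so in the frame of the old core (midpoint \<open>0\<close>, width \<open>1\<close>) the new
  midpoint and width are a random shift \<open>B\<close> and a random scale \<open>A\<close>, independent of the past: midpoint
  and width \<open>(m, d)\<close> become \<open>(m + d B, d A)\<close>, where \<open>l \<mapsto> B + A l\<close> is the random affine map of the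
  fixed-point equation. As \<open>E A \<le> 1/2\<close>, the widths are summable and the midpoints converge. If \<open>L\<close>
  solves the fixed-point equation and is independent of the process, then \<open>m\<^sub>t + d\<^sub>t L\<close> has the same law
  for all \<open>t\<close>; letting \<open>t \<rightarrow> \<infinity>\<close> identifies the law of the limit.

  The solution \<open>L\<close> is the limit of the backward iteration of the affine maps. For uniqueness, the
  modulus \<open>\<Delta>\<close> of the difference of two characteristic functions satisfies \<open>\<Delta>(t) \<le> E \<Delta>(A t)\<close>; where
  \<open>\<Delta>\<close> attains its maximum over a compact interval this forces \<open>\<Delta>(A t) = \<Delta>(t)\<close> almost surely, and
  since \<open>A\<close> is arbitrarily small with positive probability, the maximum is \<open>\<Delta>(0) = 0\<close>.
\<close>

section \<open>The fixed-point equation: uniqueness\<close>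

text \<open>The four cases: the interval for the new point has length \<open>3 d\<close>, namely two
  outer pieces of length \<open>d\<close> and a middle gap of length \<open>d\<close> that is halved
  by the midpoint; hence the weights 1/3, 1/6, 1/6, 1/3. On each piece the closest pair consists of
  the new point and the core point bordering that piece. In the frame of the old core its width is
  \<open>u\<close> or \<open>u / 2\<close>, and its midpoint lies half of that away from
  \<open>-1/2\<close> or \<open>1/2\<close>. The process is known only through conditional laws with
  respect to an unspecified filtration, without a given sequence of independent draws on its
  probability space. All information on the dynamics is therefore drawn from one identity for the
  joint law of two consecutive pairs (midpoint, width), and \<open>L\<close> is adjoined by passing
  to a product space. Almost sure statements follow by integrating the indicator of their failure.
  Uniqueness has to cover solutions without moments, hence the characteristic functions. The
  constructed solution has an exponential moment, so that the fixed-point equation yields linear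
  equations for its moments.\<close>

abbreviation U01 :: "real measure" where
  "U01 \<equiv> uniform_measure lborel {0..1}"

lemma prob_space_U01: "prob_space U01"
  by (rule prob_space_uniform_measure) auto

interpretation U01: prob_space U01
  by (rule prob_space_U01)

lemma AE_U01_mem: "AE u in U01. 0 \<le> u \<and> u \<le> 1"
  by (rule AE_uniform_measureI) auto

lemma nn_integral_U01:
  assumes "f \<in> borel_measurable borel"
  shows "(\<integral>\<^sup>+u. f u \<partial>U01) = (\<integral>\<^sup>+u. f u * indicator {0..1} u \<partial>lborel)"
  using assms by (subst nn_integral_uniform_measure) (auto simp: divide_ennreal_def)

lemma density_U01: "U01 = density lborel (indicator {0..1})"
  by (simp add: uniform_measure_def divide_ennreal_def)

lemma has_bochner_integral_U01_FTC:
  fixes f F :: "real \<Rightarrow> real"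
  assumes F: "\<And>u. (F has_real_derivative f u) (at u)" and f: "continuous_on UNIV f"
  shows "has_bochner_integral U01 f (F 1 - F 0)"
proof -
  have "has_bochner_integral lborel (\<lambda>x. f x * indicator {0..1} x) (F 1 - F 0)"
    using f by (intro has_bochner_integral_FTC_Icc_real F)
      (auto simp: continuous_on_eq_continuous_at)
  then have "has_bochner_integral lborel (\<lambda>x. indicat_real {0..1} x *\<^sub>R f x) (F 1 - F 0)"
    by (simp add: mult.commute)
  then have "has_bochner_integral (density lborel (\<lambda>x. ennreal (indicat_real {0..1} x))) f (F 1 - F 0)"
    using f by (intro has_bochner_integral_density)
      (auto intro: borel_measurable_continuous_onI)
  then show ?thesis
    by (simp add: density_U01 ennreal_indicator)
qed

lemma nn_integral_U01_id: "(\<integral>\<^sup>+u. ennreal u \<partial>U01) = ennreal (1/2)"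
proof -
  have "(\<integral>\<^sup>+u. ennreal u \<partial>U01) = (\<integral>\<^sup>+u. ennreal u * indicator {0..1} u \<partial>lborel)"
    by (simp add: nn_integral_U01)
  also have "\<dots> = ennreal (1\<^sup>2 / 2 - 0\<^sup>2 / 2)"
    by (rule nn_integral_FTC_Icc) (auto intro!: derivative_eq_intros)
  finally show ?thesis by simp
qed

lemma pmf_of_list_wf_branch: "pmf_of_list_wf [(0::nat, 1/3 :: real), (Suc 0, 1/6), (2, 1/6), (3, 1/3)]"
  by (auto simp: pmf_of_list_wf_def)

lemma pmf_branch [simp]:
  "pmf branch_pmf 0 = 1/3" "pmf branch_pmf (Suc 0) = 1/6"
  "pmf branch_pmf 2 = 1/6" "pmf branch_pmf 3 = 1/3"
  by (simp_all add: branch_pmf_def pmf_pmf_of_list[OF pmf_of_list_wf_branch])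

lemma set_branch_pmf: "set_pmf branch_pmf \<subseteq> {0, Suc 0, 2, 3}"
  using set_pmf_of_list[OF pmf_of_list_wf_branch] by (auto simp: branch_pmf_def)

lemma nn_integral_branch_pmf:
  "(\<integral>\<^sup>+c. h c \<partial>measure_pmf branch_pmf) =
     ennreal (1/3) * h 0 + ennreal (1/6) * h 1 + ennreal (1/6) * h 2 + ennreal (1/3) * h 3"
  using set_branch_pmf
  by (subst nn_integral_measure_pmf_support[where A = "{0, Suc 0, 2, 3}"])
    (auto simp: algebra_simps)

lemma integral_branch_pmf:
  fixes h :: "nat \<Rightarrow> 'b::{banach, second_countable_topology}"
  shows "(\<integral>c. h c \<partial>measure_pmf branch_pmf) =
     (1/3) *\<^sub>R h 0 + (1/6) *\<^sub>R h 1 + (1/6) *\<^sub>R h 2 + (1/3) *\<^sub>R h 3"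
  using set_branch_pmf
  by (subst integral_measure_pmf[where A = "{0, Suc 0, 2, 3}"])
    (auto simp: algebra_simps)

section \<open>Affine form of the cases and the law of one draw\<close>

text \<open>The \<open>B\<close> of the overview: the midpoint of the new core when the old core is
  \<open>-1/2\<close>, \<open>1/2\<close>. The companion \<open>scale_coeff\<close> is
  \<open>A\<close>, the width of the new core in that frame.\<close>

definition shift_coeff :: "nat \<Rightarrow> real \<Rightarrow> real" where
  "shift_coeff c u = (if c = 0 then - (1 + u) / 2 else if c = 1 then - (2 - u) / 4
     else if c = 2 then (2 - u) / 4 else (1 + u) / 2)"

definition scale_coeff :: "nat \<Rightarrow> real \<Rightarrow> real" where
  "scale_coeff c u = (if c = 1 \<or> c = 2 then u / 2 else u)"

lemma branch_affine: "branch c u l = shift_coeff c u + scale_coeff c u * l"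
  by (cases "(c, u, l)" rule: branch.cases) (auto simp: shift_coeff_def scale_coeff_def)

lemma measurable_shift_coeff [measurable (raw)]:
  assumes [measurable]: "c \<in> measurable M (count_space UNIV)" "u \<in> borel_measurable M"
  shows "(\<lambda>x. shift_coeff (c x) (u x)) \<in> borel_measurable M"
  unfolding shift_coeff_def by measurable

lemma measurable_scale_coeff [measurable (raw)]:
  assumes [measurable]: "c \<in> measurable M (count_space UNIV)" "u \<in> borel_measurable M"
  shows "(\<lambda>x. scale_coeff (c x) (u x)) \<in> borel_measurable M"
  unfolding scale_coeff_def by measurable

lemma shift_coeff_bound: "0 \<le> u \<Longrightarrow> u \<le> 1 \<Longrightarrow> \<bar>shift_coeff c u\<bar> \<le> 1"
  by (auto simp: shift_coeff_def)

lemma scale_coeff_bounds: "0 \<le> u \<Longrightarrow> 0 \<le> scale_coeff c u \<and> scale_coeff c u \<le> u"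
  by (auto simp: scale_coeff_def)

text \<open>The randomness of one step, kept apart from the variable with law \<open>L\<close>, so
  that independent copies of it can be iterated.\<close>

definition draw_law :: "(real \<times> nat) measure" where
  "draw_law = U01 \<Otimes>\<^sub>M measure_pmf branch_pmf"

lemma prob_space_draw_law: "prob_space draw_law"
proof -
  interpret pair_prob_space U01 "measure_pmf branch_pmf" ..
  show ?thesis unfolding draw_law_def by (rule prob_space_axioms)
qed

interpretation draw_law: prob_space draw_law
  by (rule prob_space_draw_law)

lemma sets_draw_law [measurable_cong]: "sets draw_law = sets (borel \<Otimes>\<^sub>M count_space UNIV)"
  unfolding draw_law_def by (intro sets_pair_measure_cong) auto

lemma space_draw_law [simp]: "space draw_law = UNIV"
  by (simp add: draw_law_def space_pair_measure)

lemma nn_integral_draw_law: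
  assumes [measurable]: "f \<in> borel_measurable (borel \<Otimes>\<^sub>M count_space UNIV)"
  shows "(\<integral>\<^sup>+x. f x \<partial>draw_law) = (\<integral>\<^sup>+u. \<integral>\<^sup>+c. f (u, c) \<partial>measure_pmf branch_pmf \<partial>U01)"
  unfolding draw_law_def
  by (subst measure_pmf.nn_integral_fst[symmetric]) auto

lemma nn_integral_draw_law_fst:
  assumes [measurable]: "f \<in> borel_measurable borel"
  shows "(\<integral>\<^sup>+x. f (fst x) \<partial>draw_law) = (\<integral>\<^sup>+u. f u \<partial>U01)"
  by (subst nn_integral_draw_law) auto

lemma AE_draw_law_fst:
  assumes [measurable]: "Measurable.pred borel P"
  shows "(AE x in draw_law. P (fst x)) \<longleftrightarrow> (AE u in U01. P u)"
proof -
  have [measurable]: "Measurable.pred draw_law (\<lambda>x. P (fst x))" by measurable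
  have "(AE x in draw_law. P (fst x)) \<longleftrightarrow> (\<integral>\<^sup>+x. indicator {x. \<not> P (fst x)} x \<partial>draw_law) = 0"
    by (rule AE_iff_nn_integral) measurable
  also have "indicator {x. \<not> P (fst x)} = (\<lambda>x. indicator {u. \<not> P u} (fst x) :: ennreal)"
    by (auto simp: indicator_def)
  finally have "(AE x in draw_law. P (fst x)) \<longleftrightarrow> (\<integral>\<^sup>+x. indicator {u. \<not> P u} (fst x) \<partial>draw_law) = 0" .
  also have "\<dots> \<longleftrightarrow> (\<integral>\<^sup>+u. indicator {u. \<not> P u} u \<partial>U01) = 0"
    by (subst nn_integral_draw_law_fst) auto
  also have "\<dots> \<longleftrightarrow> (AE u in U01. P u)"
    by (rule AE_iff_nn_integral[symmetric]) measurable
  finally show ?thesis .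
qed

lemma AE_draw_law_mem: "AE x in draw_law. 0 \<le> fst x \<and> fst x \<le> 1"
  using AE_U01_mem by (subst AE_draw_law_fst) auto

lemma measurable_branch [measurable (raw)]:
  assumes [measurable]: "c \<in> measurable M (count_space UNIV)" "u \<in> borel_measurable M" "l \<in> borel_measurable M"
  shows "(\<lambda>x. branch (c x) (u x) (l x)) \<in> borel_measurable M"
  unfolding branch_affine by measurable

section \<open>The fixed-point equation as an identity of integrals\<close>

text \<open>In the definition of the fixed-point equation the factor \<open>L\<close> stands between
  the uniform variable and the case. Tonelli moves it innermost, which separates the draw from the
  solution.\<close>

lemma nn_integral_branch_triple:
  assumes "prob_space L" and sets [measurable_cong]: "sets L = sets borel"
    and [measurable]: "f \<in> borel_measurable borel"
  shows "(\<integral>\<^sup>+l. f l \<partial>distr (U01 \<Otimes>\<^sub>M L \<Otimes>\<^sub>M measure_pmf branch_pmf) borel (\<lambda>(u, l, c). branch c u l)) =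
    (\<integral>\<^sup>+x. \<integral>\<^sup>+l. f (branch (snd x) (fst x) l) \<partial>L \<partial>draw_law)"
proof -
  interpret L: prob_space L by fact
  interpret LC: pair_prob_space L "measure_pmf branch_pmf" ..
  have "(\<integral>\<^sup>+l. f l \<partial>distr (U01 \<Otimes>\<^sub>M L \<Otimes>\<^sub>M measure_pmf branch_pmf) borel (\<lambda>(u, l, c). branch c u l)) =
    (\<integral>\<^sup>+z. f (branch (snd (snd z)) (fst z) (fst (snd z))) \<partial>(U01 \<Otimes>\<^sub>M L \<Otimes>\<^sub>M measure_pmf branch_pmf))"
    by (subst nn_integral_distr) (auto simp: split_beta')
  also have "\<dots> = (\<integral>\<^sup>+u. \<integral>\<^sup>+y. f (branch (snd y) u (fst y)) \<partial>(L \<Otimes>\<^sub>M measure_pmf branch_pmf) \<partial>U01)"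
    by (subst LC.nn_integral_fst[symmetric]) auto
  also have "\<dots> = (\<integral>\<^sup>+u. \<integral>\<^sup>+c. \<integral>\<^sup>+l. f (branch c u l) \<partial>L \<partial>measure_pmf branch_pmf \<partial>U01)"
    by (intro nn_integral_cong, subst LC.nn_integral_snd[symmetric]) (auto simp: split_beta')
  also have "\<dots> = (\<integral>\<^sup>+x. \<integral>\<^sup>+l. f (branch (snd x) (fst x) l) \<partial>L \<partial>draw_law)"
    by (subst nn_integral_draw_law) (auto)
  finally show ?thesis .
qed

lemma fixed_point_law_nn_integral:
  assumes "fixed_point_law L" "f \<in> borel_measurable borel"
  shows "(\<integral>\<^sup>+l. f l \<partial>L) = (\<integral>\<^sup>+x. \<integral>\<^sup>+l. f (branch (snd x) (fst x) l) \<partial>L \<partial>draw_law)"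
proof -
  have L: "prob_space L" "sets L = sets borel"
    and eq: "L = distr (U01 \<Otimes>\<^sub>M L \<Otimes>\<^sub>M measure_pmf branch_pmf) borel (\<lambda>(u, l, c). branch c u l)"
    using assms(1) unfolding fixed_point_law_def by auto
  show ?thesis
    by (subst eq) (rule nn_integral_branch_triple[OF L assms(2)])
qed

lemma fixed_point_lawI:
  assumes L: "prob_space L" "sets L = sets borel"
    and eq: "\<And>f. f \<in> borel_measurable borel \<Longrightarrow>
      (\<integral>\<^sup>+l. f l \<partial>L) = (\<integral>\<^sup>+x. \<integral>\<^sup>+l. f (branch (snd x) (fst x) l) \<partial>L \<partial>draw_law)"
  shows "fixed_point_law L"
  unfolding fixed_point_law_def
proof (intro conjI L measure_eqI)
  fix A assume A: "A \<in> sets L"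
  let ?D = "distr (U01 \<Otimes>\<^sub>M L \<Otimes>\<^sub>M measure_pmf branch_pmf) borel (\<lambda>(u, l, c). branch c u l)"
  have "emeasure L A = (\<integral>\<^sup>+l. indicator A l \<partial>L)"
    using A by simp
  also have "\<dots> = (\<integral>\<^sup>+l. indicator A l \<partial>?D)"
    using A L by (subst nn_integral_branch_triple[OF L], simp, subst eq) simp_all
  finally show "emeasure L A = emeasure ?D A"
    using A L by simp
qed (use L in simp)

text \<open>The same equation as an equality of measures, as needed for real and complex integrands,
  which the nonnegative integral does not reach.\<close>

lemma fixed_point_law_distr:
  assumes "fixed_point_law L"
  shows "L = distr (draw_law \<Otimes>\<^sub>M L) borel (\<lambda>(x, l). branch (snd x) (fst x) l)"
proof (rule measure_eqI)
  have L: "prob_space L" and sets [measurable_cong]: "sets L = sets borel"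
    using assms unfolding fixed_point_law_def by auto
  interpret L: prob_space L by fact
  show "sets L = sets (distr (draw_law \<Otimes>\<^sub>M L) borel (\<lambda>(x, l). branch (snd x) (fst x) l))"
    by (simp add: sets)
  fix A assume A: "A \<in> sets L"
  have [measurable]: "A \<in> sets borel" using A sets by simp
  have "emeasure L A = (\<integral>\<^sup>+l. indicator A l \<partial>L)"
    by (simp add: sets)
  also have "\<dots> = (\<integral>\<^sup>+x. \<integral>\<^sup>+l. indicator A (branch (snd x) (fst x) l) \<partial>L \<partial>draw_law)"
    by (rule fixed_point_law_nn_integral[OF assms]) auto
  also have "\<dots> = (\<integral>\<^sup>+z. indicator A (branch (snd (fst z)) (fst (fst z)) (snd z)) \<partial>(draw_law \<Otimes>\<^sub>M L))"
    by (subst L.nn_integral_fst[symmetric]) auto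
  also have "\<dots> = (\<integral>\<^sup>+l. indicator A l \<partial>distr (draw_law \<Otimes>\<^sub>M L) borel (\<lambda>(x, l). branch (snd x) (fst x) l))"
    by (subst nn_integral_distr) (auto simp: split_beta')
  finally show "emeasure L A = emeasure (distr (draw_law \<Otimes>\<^sub>M L) borel (\<lambda>(x, l). branch (snd x) (fst x) l)) A"
    by simp
qed

text \<open>Given the draw, \<open>branch\<close> is affine in \<open>l\<close>, so the exponential
  splits into a phase and the integrand of \<open>char L\<close> at the scaled argument.\<close>

lemma fixed_point_law_char:
  assumes "fixed_point_law L"
  shows "char L t = (CLINT x|draw_law. iexp (t * shift_coeff (snd x) (fst x)) * char L (t * scale_coeff (snd x) (fst x)))"
proof -
  have L: "prob_space L" and sets [measurable_cong]: "sets L = sets borel"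
    using assms unfolding fixed_point_law_def by auto
  interpret L: prob_space L by fact
  interpret WL: pair_prob_space draw_law L ..
  have "char L t = (CLINT l|distr (draw_law \<Otimes>\<^sub>M L) borel (\<lambda>(x, l). branch (snd x) (fst x) l). iexp (t * l))"
    unfolding char_def
    by (rule arg_cong[OF fixed_point_law_distr[OF assms], where f = "\<lambda>M. CLINT l|M. iexp (t * l)"])
  also have "\<dots> = (CLINT z|draw_law \<Otimes>\<^sub>M L. iexp (t * branch (snd (fst z)) (fst (fst z)) (snd z)))"
    by (subst integral_distr) (auto simp: split_beta')
  also have "\<dots> = (CLINT x|draw_law. CLINT l|L. iexp (t * branch (snd x) (fst x) l))"
    by (subst WL.integral_fst'[symmetric])
      (auto intro!: WL.P.integrable_const_bound[where B = 1])
  also have "\<dots> = (CLINT x|draw_law. iexp (t * shift_coeff (snd x) (fst x)) * char L (t * scale_coeff (snd x) (fst x)))"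
    unfolding char_def branch_affine
    by (intro Bochner_Integration.integral_cong refl)
      (simp add: distrib_left exp_add mult.assoc)
  finally show ?thesis .
qed

text \<open>A contraction argument in a transport metric would need a first moment. The function
  \<open>\<Delta>\<close> is continuous and bounded by 2 for any two laws.\<close>

lemma fixed_point_law_unique:
  assumes L1: "fixed_point_law L1" and L2: "fixed_point_law L2"
  shows "L1 = L2"
proof -
  have rd: "real_distribution L1" "real_distribution L2"
    using L1 L2 by (auto simp: fixed_point_law_def real_distribution_def real_distribution_axioms_def)
  interpret L1: real_distribution L1 by fact
  interpret L2: real_distribution L2 by fact
  define \<Delta> where "\<Delta> t = cmod (char L1 t - char L2 t)" for t
  have cont: "continuous_on UNIV \<Delta>"
    unfolding \<Delta>_def
    by (intro continuous_intros continuous_at_imp_continuous_on ballI L1.isCont_char L2.isCont_char)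
  note [measurable] = borel_measurable_continuous_onI[OF cont]
  have \<Delta>_le_2: "\<Delta> t \<le> 2" for t
    using norm_triangle_ineq4[of "char L1 t" "char L2 t"] L1.cmod_char_le_1[of t] L2.cmod_char_le_1[of t]
    by (simp add: \<Delta>_def)
  have \<Delta>_int: "integrable draw_law (\<lambda>x. \<Delta> (t * scale_coeff (snd x) (fst x)))" for t
    using \<Delta>_le_2 by (intro draw_law.integrable_const_bound[where B = 2]) (auto simp: \<Delta>_def)
  have step: "\<Delta> t \<le> (\<integral>x. \<Delta> (t * scale_coeff (snd x) (fst x)) \<partial>draw_law)" for t
  proof -
    let ?I = "\<lambda>L x. iexp (t * shift_coeff (snd x) (fst x)) * char L (t * scale_coeff (snd x) (fst x))"
    have int: "integrable draw_law (?I L1)" "integrable draw_law (?I L2)"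
      using L1.cmod_char_le_1 L2.cmod_char_le_1
      by (auto intro!: draw_law.integrable_const_bound[where B = 1] simp: norm_mult)
    have "\<Delta> t = cmod (CLINT x|draw_law. ?I L1 x - ?I L2 x)"
      unfolding \<Delta>_def using int
      by (simp add: fixed_point_law_char[OF L1, of t] fixed_point_law_char[OF L2, of t])
    also have "\<dots> \<le> (\<integral>x. cmod (?I L1 x - ?I L2 x) \<partial>draw_law)"
      by (rule integral_norm_bound)
    \<comment> \<open>Both integrands carry the same phase of modulus one, which drops out of the
      norm of their difference.\<close>
    also have "\<dots> = (\<integral>x. \<Delta> (t * scale_coeff (snd x) (fst x)) \<partial>draw_law)"
      unfolding \<Delta>_def right_diff_distrib[symmetric] norm_mult by simp
    finally show ?thesis .
  qed
  have "\<Delta> T = 0" for T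
  proof -
    \<comment> \<open>A symmetric interval is mapped into itself by multiplication with
      \<open>A\<close> in \<open>[0, 1]\<close>, so the value at a maximiser \<open>t\<close>
      dominates \<open>\<Delta>\<close> at \<open>t A\<close>.\<close>
    define I where "I = {-\<bar>T\<bar>..\<bar>T\<bar>}"
    have "compact I" "I \<noteq> {}" unfolding I_def by simp_all
    then obtain t where "t \<in> I" and t_max: "\<forall>s\<in>I. \<Delta> s \<le> \<Delta> t"
      using continuous_attains_sup[OF _ _ continuous_on_subset[OF cont subset_UNIV], of I] by metis
    then have "- \<bar>T\<bar> \<le> t \<and> t \<le> \<bar>T\<bar>" unfolding I_def by simp
    then have t: "\<bar>t\<bar> \<le> \<bar>T\<bar>" by (metis abs_le_iff minus_le_iff)
    have max: "\<Delta> s \<le> \<Delta> t" if "\<bar>s\<bar> \<le> \<bar>T\<bar>" for s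
    proof -
      have "s \<in> I" unfolding I_def atLeastAtMost_iff using that by linarith
      with t_max show ?thesis by (rule bspec)
    qed
    have "AE x in draw_law. \<bar>t * scale_coeff (snd x) (fst x)\<bar> \<le> \<bar>T\<bar>"
      using AE_draw_law_mem
    proof eventually_elim
      case (elim x)
      have "\<bar>scale_coeff (snd x) (fst x)\<bar> \<le> 1"
        using elim scale_coeff_bounds[of "fst x" "snd x"] by linarith
      then have "\<bar>t\<bar> * \<bar>scale_coeff (snd x) (fst x)\<bar> \<le> \<bar>t\<bar> * 1"
        by (rule mult_left_mono) simp
      with t show ?case unfolding abs_mult by linarith
    qed
    then have "AE x in draw_law. \<Delta> (t * scale_coeff (snd x) (fst x)) \<le> \<Delta> t"
      by eventually_elim (rule max)
    then have nonneg: "AE x in draw_law. 0 \<le> \<Delta> t - \<Delta> (t * scale_coeff (snd x) (fst x))"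
      by eventually_elim simp
    moreover have "(\<integral>x. \<Delta> t - \<Delta> (t * scale_coeff (snd x) (fst x)) \<partial>draw_law) = 0"
    proof (rule antisym)
      show "(\<integral>x. \<Delta> t - \<Delta> (t * scale_coeff (snd x) (fst x)) \<partial>draw_law) \<le> 0"
        using step[of t]
        by (subst Bochner_Integration.integral_diff[OF _ \<Delta>_int])
          (simp_all add: draw_law.prob_space[unfolded space_draw_law])
    qed (rule integral_nonneg_AE[OF nonneg])
    ultimately have "AE x in draw_law. \<Delta> t - \<Delta> (t * scale_coeff (snd x) (fst x)) = 0"
      using \<Delta>_int[of t] by (subst (asm) integral_nonneg_eq_0_iff_AE) auto
    then have eq: "AE x in draw_law. \<Delta> (t * scale_coeff (snd x) (fst x)) = \<Delta> t"
      by eventually_elim simp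
    have "\<Delta> t = 0"
    proof (rule ccontr)
      assume "\<Delta> t \<noteq> 0"
      then have pos: "\<Delta> t > 0" by (simp add: \<Delta>_def)
      have \<Delta>0: "\<Delta> 0 = 0" by (simp add: \<Delta>_def L1.char_zero L2.char_zero)
      have "isCont \<Delta> 0"
        using cont by (simp add: continuous_on_eq_continuous_at)
      then have "\<exists>d>0. \<forall>s. dist s 0 < d \<longrightarrow> dist (\<Delta> s) (\<Delta> 0) < \<Delta> t"
        using pos unfolding continuous_at_eps_delta by blast
      then obtain d where d: "d > 0" and small: "\<And>s. \<bar>s\<bar> < d \<Longrightarrow> \<Delta> s < \<Delta> t"
        unfolding \<Delta>0 dist_real_def diff_zero by (metis abs_less_iff)
      \<comment> \<open>For \<open>u < e\<close> the scale is at most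
        \<open>u < d / (\<bar>t\<bar> + 1)\<close>, which brings \<open>t A\<close> within
        \<open>d\<close> of 0. The added 1 covers \<open>t = 0\<close>; the minimum with 1 keeps
        \<open>{0..<e}\<close> inside the unit interval, where it has positive mass.\<close>
      define e where "e = min 1 (d / (\<bar>t\<bar> + 1))"
      have e: "0 < e" "e \<le> 1" using d by (auto simp: e_def)
      have "AE x in draw_law. \<not> fst x < e"
        using eq AE_draw_law_mem
      proof eventually_elim
        case (elim x)
        show ?case
        proof
          assume "fst x < e"
          then have "\<bar>scale_coeff (snd x) (fst x)\<bar> < d / (\<bar>t\<bar> + 1)"
            using elim scale_coeff_bounds[of "fst x" "snd x"] by (auto simp: e_def)
          then have "(\<bar>t\<bar> + 1) * \<bar>scale_coeff (snd x) (fst x)\<bar> < d"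
            by (simp add: field_simps)
          then have "\<bar>t * scale_coeff (snd x) (fst x)\<bar> < d"
            by (auto simp: abs_mult algebra_simps)
          with small elim(1) show False by (metis less_irrefl)
        qed
      qed
      then have "AE u in U01. \<not> u < e"
        by (subst (asm) AE_draw_law_fst[where P = "\<lambda>u. \<not> u < e"]) auto
      then have "AE u in lborel. u \<in> {0..1} \<longrightarrow> \<not> u < e"
        by (subst (asm) AE_uniform_measure) auto
      then have "AE u in lborel. u \<notin> {0..<e}"
        by eventually_elim (use e in auto)
      then have "emeasure lborel {0..<e} = 0"
        by (subst (asm) AE_iff_null_sets[symmetric]) auto
      then show False using e by simp
    qed
    then show "\<Delta> T = 0"
      using max[of T] by (simp add: \<Delta>_def)
  qed
  then have "char L1 = char L2" by (auto simp: \<Delta>_def)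
  then show ?thesis by (intro Levy_uniqueness rd)
qed

section \<open>The fixed-point equation: existence and exponential moments\<close>

text \<open>The expectation of the whole series is at most a geometric series, so the series is
  finite almost surely. This serves both the backward iteration and the widths of the core.\<close>

lemma AE_summable_geometric:
  assumes [measurable]: "\<And>n. f n \<in> borel_measurable M"
    and nonneg: "\<And>n x. 0 \<le> f n x"
    and le: "\<And>n. (\<integral>\<^sup>+x. ennreal (f n x) \<partial>M) \<le> ennreal (C * r ^ n)"
    and r: "0 \<le> r" "r < 1" and C: "0 \<le> C"
  shows "AE x in M. summable (\<lambda>n. f n x)"
proof -
  have "(\<integral>\<^sup>+x. (\<Sum>n. ennreal (f n x)) \<partial>M) = (\<Sum>n. \<integral>\<^sup>+x. ennreal (f n x) \<partial>M)"
    by (rule nn_integral_suminf) auto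
  also have "\<dots> \<le> (\<Sum>n. ennreal (C * r ^ n))"
    by (intro suminf_le le) auto
  also have "\<dots> < \<infinity>"
    using r C unfolding infinity_ennreal_def less_top[symmetric] by (intro ennreal_suminf_neq_top summable_mult summable_geometric) auto
  finally have "AE x in M. (\<Sum>n. ennreal (f n x)) \<noteq> \<infinity>"
    by (intro nn_integral_noteq_infinite) (auto simp: less_top)
  then show ?thesis
    by eventually_elim (use nonneg in \<open>auto intro!: summable_suminf_not_top\<close>)
qed

text \<open>The first draw is the outermost map and later draws enter at the inside. In this order
  the increments carry the product of all earlier scales and the iterates converge pointwise; with
  new maps applied on the outside only their laws would converge.\<close>

primrec approx :: "nat \<Rightarrow> (real \<times> nat) stream \<Rightarrow> real" where
  "approx 0 s = 0"
| "approx (Suc n) s = branch (snd (shd s)) (fst (shd s)) (approx n (stl s))"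

abbreviation draws :: "(real \<times> nat) stream measure" where
  "draws \<equiv> stream_space draw_law"

interpretation draws: prob_space draws
  by (rule draw_law.prob_space_stream_space)

lemma measurable_approx [measurable]: "approx n \<in> borel_measurable draws"
proof (induction n)
  case (Suc n)
  note [measurable] = Suc
  show ?case unfolding approx.simps by measurable
qed simp

text \<open>Peeling off the outermost map cancels its shift and multiplies the difference by a scale
  that is independent of the tail and at most \<open>u\<close>, of mean 1/2. The start is
  \<open>\<bar>B\<bar> \<le> 1\<close>; the factor 1 matches the shape \<open>C * r ^ n\<close> of
  the summability criterion.\<close>

lemma nn_integral_approx_diff:
  "(\<integral>\<^sup>+s. ennreal \<bar>approx (Suc n) s - approx n s\<bar> \<partial>draws) \<le> ennreal (1 * (1/2) ^ n)"
proof (induction n)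
  case 0
  have "(\<integral>\<^sup>+s. ennreal \<bar>approx (Suc 0) s - approx 0 s\<bar> \<partial>draws) =
    (\<integral>\<^sup>+x. ennreal \<bar>shift_coeff (snd x) (fst x)\<bar> \<partial>draw_law)"
    by (subst draw_law.nn_integral_stream_space) (auto simp: branch_affine draws.emeasure_space_1)
  also have "\<dots> \<le> (\<integral>\<^sup>+x. 1 \<partial>draw_law)"
    using AE_draw_law_mem by (intro nn_integral_mono_AE) (auto simp: shift_coeff_bound)
  finally show ?case by (simp add: draw_law.emeasure_space_1[simplified])
next
  case (Suc n)
  have "(\<integral>\<^sup>+s. ennreal \<bar>approx (Suc (Suc n)) s - approx (Suc n) s\<bar> \<partial>draws) =
    (\<integral>\<^sup>+x. \<integral>\<^sup>+s. ennreal \<bar>scale_coeff (snd x) (fst x) * (approx (Suc n) s - approx n s)\<bar> \<partial>draws \<partial>draw_law)"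
    by (subst draw_law.nn_integral_stream_space) (auto simp: branch_affine right_diff_distrib)
  also have "\<dots> = (\<integral>\<^sup>+x. ennreal \<bar>scale_coeff (snd x) (fst x)\<bar> * (\<integral>\<^sup>+s. ennreal \<bar>approx (Suc n) s - approx n s\<bar> \<partial>draws) \<partial>draw_law)"
    unfolding abs_mult by (simp add: ennreal_mult nn_integral_cmult del: approx.simps)
  also have "\<dots> \<le> (\<integral>\<^sup>+x. ennreal (fst x) * ennreal ((1/2) ^ n) \<partial>draw_law)"
    using AE_draw_law_mem
  proof (intro nn_integral_mono_AE, eventually_elim)
    case (elim x)
    then show ?case
      using scale_coeff_bounds[of "fst x" "snd x"] Suc by (intro mult_mono ennreal_leI) (auto simp del: approx.simps)
  qed
  also have "\<dots> = ennreal (1/2) * ennreal ((1/2) ^ n)"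
    using nn_integral_draw_law_fst[of ennreal] by (simp add: nn_integral_multc nn_integral_U01_id)
  also have "\<dots> = ennreal (1 * (1/2) ^ Suc n)"
    by (subst ennreal_mult[symmetric]) auto
  finally show ?case .
qed

lemma AE_convergent_approx: "AE s in draws. convergent (\<lambda>n. approx n s)"
proof -
  have "AE s in draws. summable (\<lambda>n. \<bar>approx (Suc n) s - approx n s\<bar>)"
    by (rule AE_summable_geometric[OF _ _ nn_integral_approx_diff]) (auto simp del: approx.simps)
  then show ?thesis
  proof eventually_elim
    case (elim s)
    have "(\<lambda>n. \<Sum>i<n. approx (Suc i) s - approx i s) = (\<lambda>n. approx n s)"
      by (rule ext, subst sum_lessThan_telescope) simp
    moreover have "summable (\<lambda>n. approx (Suc n) s - approx n s)"
      using elim by (rule summable_rabs_cancel)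
    ultimately show ?case
      by (simp only: summable_iff_convergent)
  qed
qed

text \<open>Almost surely the sum of the random series
  \<open>B1 + A1 B2 + A1 A2 B3 + ...\<close>.\<close>

definition perpetuity :: "(real \<times> nat) stream \<Rightarrow> real" where
  "perpetuity s = lim (\<lambda>n. approx n s)"

lemma measurable_perpetuity [measurable]: "perpetuity \<in> borel_measurable draws"
  unfolding perpetuity_def by measurable

definition L_law :: "real measure" where
  "L_law = distr draws borel perpetuity"

lemma sets_L_law [simp, measurable_cong]: "sets L_law = sets borel"
  by (simp add: L_law_def)

lemma space_L_law [simp]: "space L_law = UNIV"
  by (simp add: L_law_def)

interpretation L: prob_space L_law
  unfolding L_law_def by (rule draws.prob_space_distr) measurable

lemma perpetuity_Stream:
  assumes "convergent (\<lambda>n. approx n s)"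
  shows "perpetuity (x ## s) = branch (snd x) (fst x) (perpetuity s)"
  unfolding perpetuity_def
proof (rule limI)
  have "(\<lambda>n. approx n s) \<longlonglongrightarrow> lim (\<lambda>n. approx n s)"
    using assms by (simp add: convergent_LIMSEQ_iff)
  then have "(\<lambda>n. approx (Suc n) (x ## s)) \<longlonglongrightarrow> branch (snd x) (fst x) (lim (\<lambda>n. approx n s))"
    unfolding approx.simps stream.sel branch_affine by (intro tendsto_intros)
  then show "(\<lambda>n. approx n (x ## s)) \<longlonglongrightarrow> branch (snd x) (fst x) (lim (\<lambda>n. approx n s))"
    by (rule LIMSEQ_imp_Suc)
qed

text \<open>A stream of independent draws is a first draw followed by an independent stream of the
  same law, and the perpetuity of the whole is the first affine map applied to the perpetuity of the
  tail.\<close>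

lemma fixed_point_L_law: "fixed_point_law L_law"
proof (rule fixed_point_lawI)
  fix f :: "real \<Rightarrow> ennreal" assume [measurable]: "f \<in> borel_measurable borel"
  have "(\<integral>\<^sup>+l. f l \<partial>L_law) = (\<integral>\<^sup>+s. f (perpetuity s) \<partial>draws)"
    unfolding L_law_def by (subst nn_integral_distr) auto
  also have "\<dots> = (\<integral>\<^sup>+x. \<integral>\<^sup>+s. f (perpetuity (x ## s)) \<partial>draws \<partial>draw_law)"
    by (rule draw_law.nn_integral_stream_space) measurable
  also have "\<dots> = (\<integral>\<^sup>+x. \<integral>\<^sup>+s. f (branch (snd x) (fst x) (perpetuity s)) \<partial>draws \<partial>draw_law)"
    using AE_convergent_approx
    by (intro nn_integral_cong nn_integral_cong_AE) (auto simp: perpetuity_Stream)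
  also have "\<dots> = (\<integral>\<^sup>+x. \<integral>\<^sup>+l. f (branch (snd x) (fst x) l) \<partial>L_law \<partial>draw_law)"
    unfolding L_law_def by (intro nn_integral_cong, subst nn_integral_distr) auto
  finally show "(\<integral>\<^sup>+l. f l \<partial>L_law) = (\<integral>\<^sup>+x. \<integral>\<^sup>+l. f (branch (snd x) (fst x) l) \<partial>L_law \<partial>draw_law)" .
qed (auto intro: L.prob_space_axioms)

section \<open>Exponential moments\<close>

text \<open>
  The left-hand side is at most \<open>exp (1 + a) / a\<close>, which is below \<open>exp a / 2\<close> once \<open>a \<ge> 2 e\<close>;
  for smaller \<open>a\<close> the additive constant dominates. Hence the exponential moments of the iterates
  stay bounded.
\<close>

lemma nn_integral_U01_exp_le:
  assumes a: "0 \<le> a"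
  shows "(\<integral>\<^sup>+u. ennreal (exp (1 + u * a)) \<partial>U01) \<le> ennreal (1/2) * ennreal (exp a) + ennreal (exp (1 + 2 * exp 1))"
proof (cases "a < 2 * exp 1")
  case True
  have "(\<integral>\<^sup>+u. ennreal (exp (1 + u * a)) \<partial>U01) \<le> (\<integral>\<^sup>+u. ennreal (exp (1 + 2 * exp 1)) \<partial>U01)"
    using AE_U01_mem
  proof (intro nn_integral_mono_AE, eventually_elim)
    case (elim u)
    then have "u * a \<le> 1 * (2 * exp 1)" using True a by (intro mult_mono) auto
    then show ?case by simp
  qed
  also have "\<dots> = ennreal (exp (1 + 2 * exp 1))"
    using U01.emeasure_space_1 by simp
  finally show ?thesis by (simp add: add_increasing)
next
  case False
  moreover have "0 < exp (1::real)" by simp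
  ultimately have pos: "a > 0" by linarith
  have "(\<integral>\<^sup>+u. ennreal (exp (1 + u * a)) \<partial>U01) = (\<integral>\<^sup>+u. ennreal (exp (1 + u * a)) * indicator {0..1} u \<partial>lborel)"
    by (rule nn_integral_U01) simp
  also have "\<dots> = ennreal (exp (1 + 1 * a) / a - exp (1 + 0 * a) / a)"
    using pos by (intro nn_integral_FTC_Icc) (auto intro!: derivative_eq_intros)
  also have "\<dots> \<le> ennreal (1/2 * exp a)"
  proof (rule ennreal_leI)
    have "exp (1 + a) / a - exp 1 / a \<le> exp (1 + a) / a" using pos by simp
    also have "\<dots> = (exp 1 / a) * exp a" by (simp add: exp_add)
    also have "\<dots> \<le> 1/2 * exp a"
      using pos False by (intro mult_right_mono) (auto simp: field_simps)
    finally show "exp (1 + 1 * a) / a - exp (1 + 0 * a) / a \<le> 1/2 * exp a" by simp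
  qed
  also have "\<dots> = ennreal (1/2) * ennreal (exp a)"
    by (rule ennreal_mult) auto
  finally show ?thesis
    by (rule order_trans) simp
qed

text \<open>With \<open>\<bar>B + A l\<bar> \<le> 1 + u \<bar>l\<bar>\<close> the preceding estimate
  gives a recursion of the form \<open>K \<mapsto> K / 2 + C\<close>, where
  \<open>C = exp (1 + 2 * exp 1)\<close>. Its fixed point \<open>2 C\<close> is the bound that is
  preserved.\<close>

lemma nn_integral_exp_approx:
  "(\<integral>\<^sup>+s. ennreal (exp \<bar>approx n s\<bar>) \<partial>draws) \<le> ennreal (2 * exp (1 + 2 * exp 1))"
proof (induction n)
  case 0
  have "1 \<le> 2 * exp (1 + 2 * exp (1::real))"
    using exp_ge_add_one_self[of "1 + 2 * exp (1::real)"] exp_ge_zero[of "1::real"] by linarith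
  then show ?case by (simp add: draws.emeasure_space_1)
next
  case (Suc n)
  let ?C = "exp (1 + 2 * exp (1::real))"
  interpret WS: pair_prob_space draw_law draws ..
  have "(\<integral>\<^sup>+s. ennreal (exp \<bar>approx (Suc n) s\<bar>) \<partial>draws) =
    (\<integral>\<^sup>+x. \<integral>\<^sup>+s. ennreal (exp \<bar>branch (snd x) (fst x) (approx n s)\<bar>) \<partial>draws \<partial>draw_law)"
    by (subst draw_law.nn_integral_stream_space) auto
  also have "\<dots> \<le> (\<integral>\<^sup>+x. \<integral>\<^sup>+s. ennreal (exp (1 + fst x * \<bar>approx n s\<bar>)) \<partial>draws \<partial>draw_law)"
    using AE_draw_law_mem
  proof (intro nn_integral_mono_AE, eventually_elim)
    case (elim x)
    have "\<bar>branch (snd x) (fst x) l\<bar> \<le> 1 + fst x * \<bar>l\<bar>" for l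
    proof -
      have "\<bar>branch (snd x) (fst x) l\<bar> \<le> \<bar>shift_coeff (snd x) (fst x)\<bar> + scale_coeff (snd x) (fst x) * \<bar>l\<bar>"
        using elim scale_coeff_bounds[of "fst x" "snd x"] unfolding branch_affine
        by (metis abs_mult abs_of_nonneg abs_triangle_ineq)
      also have "\<dots> \<le> 1 + fst x * \<bar>l\<bar>"
        using elim scale_coeff_bounds[of "fst x" "snd x"] shift_coeff_bound[of "fst x" "snd x"]
        by (intro add_mono mult_right_mono) auto
      finally show ?thesis .
    qed
    then show ?case by (intro nn_integral_mono) auto
  qed
  also have "\<dots> = (\<integral>\<^sup>+s. \<integral>\<^sup>+x. ennreal (exp (1 + fst x * \<bar>approx n s\<bar>)) \<partial>draw_law \<partial>draws)"
    by (rule WS.Fubini'[symmetric]) measurable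
  also have "\<dots> = (\<integral>\<^sup>+s. \<integral>\<^sup>+u. ennreal (exp (1 + u * \<bar>approx n s\<bar>)) \<partial>U01 \<partial>draws)"
    by (intro nn_integral_cong nn_integral_draw_law_fst) measurable
  also have "\<dots> \<le> (\<integral>\<^sup>+s. ennreal (1/2) * ennreal (exp \<bar>approx n s\<bar>) + ennreal ?C \<partial>draws)"
    by (intro nn_integral_mono nn_integral_U01_exp_le) auto
  also have "\<dots> = ennreal (1/2) * (\<integral>\<^sup>+s. ennreal (exp \<bar>approx n s\<bar>) \<partial>draws) + ennreal ?C"
    by (simp add: nn_integral_add nn_integral_cmult draws.emeasure_space_1)
  also have "\<dots> \<le> ennreal (1/2) * ennreal (2 * ?C) + ennreal ?C"
    using Suc by (intro add_mono mult_left_mono) auto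
  also have "\<dots> = ennreal (2 * ?C)"
    by (subst ennreal_mult[symmetric]) (auto simp flip: ennreal_plus)
  finally show ?case .
qed

text \<open>Fatou's lemma carries the uniform bound on the iterates over to their limit.\<close>

lemma nn_integral_exp_L_law: "(\<integral>\<^sup>+l. ennreal (exp \<bar>l\<bar>) \<partial>L_law) < \<infinity>"
proof -
  have "(\<integral>\<^sup>+l. ennreal (exp \<bar>l\<bar>) \<partial>L_law) = (\<integral>\<^sup>+s. ennreal (exp \<bar>perpetuity s\<bar>) \<partial>draws)"
    unfolding L_law_def by (subst nn_integral_distr) auto
  also have "\<dots> = (\<integral>\<^sup>+s. liminf (\<lambda>n. ennreal (exp \<bar>approx n s\<bar>)) \<partial>draws)"
    using AE_convergent_approx
  proof (intro nn_integral_cong_AE, eventually_elim)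
    case (elim s)
    then have "(\<lambda>n. ennreal (exp \<bar>approx n s\<bar>)) \<longlonglongrightarrow> ennreal (exp \<bar>perpetuity s\<bar>)"
      unfolding perpetuity_def by (intro tendsto_intros tendsto_ennrealI) (simp_all add: convergent_LIMSEQ_iff)
    then show ?case by (intro lim_imp_Liminf[symmetric]) simp_all
  qed
  also have "\<dots> \<le> liminf (\<lambda>n. \<integral>\<^sup>+s. ennreal (exp \<bar>approx n s\<bar>) \<partial>draws)"
    by (rule nn_integral_liminf) measurable
  also have "\<dots> \<le> ennreal (2 * exp (1 + 2 * exp 1))"
    by (intro Liminf_le always_eventually allI nn_integral_exp_approx) auto
  also have "\<dots> < \<infinity>" by simp
  finally show ?thesis .
qed

lemma power_le_fact_exp:
  fixes x :: real
  assumes "0 \<le> x"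
  shows "x ^ k \<le> fact k * exp x"
proof -
  have "(\<Sum>i\<in>{k}. x ^ i /\<^sub>R fact i) \<le> (\<Sum>i. x ^ i /\<^sub>R fact i)"
    using assms by (intro sum_le_suminf summable_exp_generic) auto
  then show ?thesis by (simp add: exp_def field_simps)
qed

lemma integrable_L_law_abs_power: "integrable L_law (\<lambda>l. \<bar>l\<bar> ^ k)"
proof (rule integrableI_bounded)
  have "(\<integral>\<^sup>+l. ennreal (norm (\<bar>l\<bar> ^ k)) \<partial>L_law) \<le> (\<integral>\<^sup>+l. ennreal (fact k) * ennreal (exp \<bar>l\<bar>) \<partial>L_law)"
    by (intro nn_integral_mono)
      (auto simp: ennreal_mult[symmetric] power_abs intro!: ennreal_leI order_trans[OF power_le_fact_exp])
  also have "\<dots> = ennreal (fact k) * (\<integral>\<^sup>+l. ennreal (exp \<bar>l\<bar>) \<partial>L_law)"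
    by (rule nn_integral_cmult) simp
  also have "\<dots> < \<infinity>"
    using nn_integral_exp_L_law by (auto simp: ennreal_mult_less_top)
  finally show "(\<integral>\<^sup>+l. ennreal (norm (\<bar>l\<bar> ^ k)) \<partial>L_law) < \<infinity>" .
qed simp

lemma integrable_L_law_power [simp]: "integrable L_law (\<lambda>l. l ^ k)"
  using integrable_L_law_abs_power[of k]
  by (rule Bochner_Integration.integrable_bound) (auto simp: power_abs)

section \<open>Symmetry and moments of the solution\<close>

lemma branch_flip:
  "- branch 0 u l = branch 3 u (- l)" "- branch 1 u l = branch 2 u (- l)"
  "- branch 2 u l = branch 1 u (- l)" "- branch 3 u l = branch 0 u (- l)"
  by (simp_all add: branch_affine shift_coeff_def scale_coeff_def field_simps)

text \<open>The reflected law solves the same fixed-point equation, so uniqueness identifies it with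
  the original.\<close>

lemma L_law_symmetric: "distr L_law borel uminus = L_law"
proof (rule fixed_point_law_unique[OF fixed_point_lawI fixed_point_L_law])
  show "prob_space (distr L_law borel uminus)"
    by (rule L.prob_space_distr) measurable
  fix f :: "real \<Rightarrow> ennreal" assume [measurable]: "f \<in> borel_measurable borel"
  define g where "g c u = (\<integral>\<^sup>+l. f (branch c u (- l)) \<partial>L_law)" for c u
  have [measurable]: "(\<lambda>x. g (snd x) (fst x)) \<in> borel_measurable (borel \<Otimes>\<^sub>M count_space UNIV)"
    unfolding g_def by measurable
  define h where "h c = (if c = 0 then 3 else if c = 1 then 2 else if c = 2 then 1 else 0::nat)" for c :: nat
  have "(\<integral>\<^sup>+l. f l \<partial>distr L_law borel uminus) = (\<integral>\<^sup>+l. f (- l) \<partial>L_law)"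
    by (rule nn_integral_distr) auto
  also have "\<dots> = (\<integral>\<^sup>+x. \<integral>\<^sup>+l. f (- branch (snd x) (fst x) l) \<partial>L_law \<partial>draw_law)"
    by (rule fixed_point_law_nn_integral[OF fixed_point_L_law]) measurable
  also have "\<dots> = (\<integral>\<^sup>+u. \<integral>\<^sup>+c. \<integral>\<^sup>+l. f (- branch c u l) \<partial>L_law \<partial>measure_pmf branch_pmf \<partial>U01)"
    by (subst nn_integral_draw_law) auto
  \<comment> \<open>Reflection swaps case 0 with 3 and case 1 with 2. The cases of each pair have
    the same probability, so only the order of the four summands changes.\<close>
  also have "\<dots> = (\<integral>\<^sup>+u. \<integral>\<^sup>+c. g c u \<partial>measure_pmf branch_pmf \<partial>U01)"
    unfolding nn_integral_branch_pmf g_def branch_flip by (simp only: add_ac)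
  also have "\<dots> = (\<integral>\<^sup>+x. g (snd x) (fst x) \<partial>draw_law)"
    by (subst nn_integral_draw_law) auto
  also have "\<dots> = (\<integral>\<^sup>+x. \<integral>\<^sup>+l. f (branch (snd x) (fst x) l) \<partial>distr L_law borel uminus \<partial>draw_law)"
    unfolding g_def by (intro nn_integral_cong, subst nn_integral_distr) auto
  finally show "(\<integral>\<^sup>+l. f l \<partial>distr L_law borel uminus) = \<dots>" .
qed simp

lemma L_law_odd_moment:
  assumes "odd k"
  shows "(\<integral>l. l ^ k \<partial>L_law) = 0"
proof -
  have "(\<integral>l. l ^ k \<partial>L_law) = (\<integral>l. l ^ k \<partial>distr L_law borel uminus)"
    by (simp add: L_law_symmetric)
  also have "\<dots> = (\<integral>l. (- l) ^ k \<partial>L_law)"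
    by (rule integral_distr) auto
  also have "\<dots> = - (\<integral>l. l ^ k \<partial>L_law)"
    using assms by simp
  finally show ?thesis by simp
qed

section \<open>Moment equations\<close>

lemma has_bochner_integral_draw_law:
  fixes g :: "real \<times> nat \<Rightarrow> real"
  assumes "integrable draw_law g"
  shows "has_bochner_integral U01
    (\<lambda>u. 1/3 * g (u, 0) + 1/6 * g (u, 1) + 1/6 * g (u, 2) + 1/3 * g (u, 3)) (\<integral>x. g x \<partial>draw_law)"
proof -
  interpret UC: pair_prob_space U01 "measure_pmf branch_pmf" ..
  have eq: "(\<integral>c. g (u, c) \<partial>measure_pmf branch_pmf) =
    1/3 * g (u, 0) + 1/6 * g (u, 1) + 1/6 * g (u, 2) + 1/3 * g (u, 3)" for u
    by (simp add: integral_branch_pmf)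
  show ?thesis
    using UC.integrable_fst'[of g] UC.integral_fst'[of g] assms
    unfolding draw_law_def[symmetric] eq has_bochner_integral_iff by auto
qed

text \<open>The fixed-point equation with \<open>l\<close> and the case integrated out. For a power
  \<open>f\<close> the integrand is a polynomial in \<open>u\<close> whose coefficients involve
  moments of \<open>L_law\<close>.\<close>

lemma L_law_integral:
  fixes f :: "real \<Rightarrow> real"
  assumes "integrable L_law f"
  shows "has_bochner_integral U01
    (\<lambda>u. 1/3 * (\<integral>l. f (branch 0 u l) \<partial>L_law) + 1/6 * (\<integral>l. f (branch 1 u l) \<partial>L_law) +
      1/6 * (\<integral>l. f (branch 2 u l) \<partial>L_law) + 1/3 * (\<integral>l. f (branch 3 u l) \<partial>L_law)) (\<integral>l. f l \<partial>L_law)"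
proof -
  interpret WL: pair_prob_space draw_law L_law ..
  let ?D = "distr (draw_law \<Otimes>\<^sub>M L_law) borel (\<lambda>(x, l). branch (snd x) (fst x) l)"
  have [measurable]: "f \<in> borel_measurable borel"
    using borel_measurable_integrable[OF assms] by simp
  have "integrable ?D f"
    using assms by (subst fixed_point_law_distr[OF fixed_point_L_law, symmetric])
  then have int: "integrable (draw_law \<Otimes>\<^sub>M L_law) (\<lambda>(x, l). f (branch (snd x) (fst x) l))"
    by (subst (asm) integrable_distr_eq) (auto simp: split_beta')
  have "(\<integral>l. f l \<partial>L_law) = (\<integral>l. f l \<partial>?D)"
    by (rule arg_cong[OF fixed_point_law_distr[OF fixed_point_L_law], where f = "\<lambda>M. integral\<^sup>L M f"])
  also have "\<dots> = (\<integral>z. (\<lambda>(x, l). f (branch (snd x) (fst x) l)) z \<partial>(draw_law \<Otimes>\<^sub>M L_law))"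
    by (subst integral_distr) (auto simp: split_beta')
  also have "\<dots> = (\<integral>x. \<integral>l. f (branch (snd x) (fst x) l) \<partial>L_law \<partial>draw_law)"
    by (subst WL.integral_fst'[OF int, symmetric]) simp
  finally have eq: "(\<integral>l. f l \<partial>L_law) = (\<integral>x. \<integral>l. f (branch (snd x) (fst x) l) \<partial>L_law \<partial>draw_law)" .
  show ?thesis
    using has_bochner_integral_draw_law[OF WL.integrable_fst'[OF int]] unfolding eq by simp
qed

lemma L_law_affine_moment:
  "(\<integral>l. (a + b * l) ^ k \<partial>L_law) = (\<Sum>j\<le>k. real (k choose j) * b ^ j * a ^ (k - j) * (\<integral>l. l ^ j \<partial>L_law))"
proof -
  have "(a + b * l) ^ k = (\<Sum>j\<le>k. real (k choose j) * b ^ j * a ^ (k - j) * l ^ j)" for l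
    unfolding add.commute[of a] binomial_ring by (simp add: power_mult_distrib mult_ac)
  then show ?thesis
    by (simp add: Bochner_Integration.integral_sum)
qed

lemmas L_law_odd_moments = L_law_odd_moment[of 1, simplified] L_law_odd_moment[of 3, simplified] L_law_odd_moment[of 5, simplified]

lemma sum_atMost_numeral:
  "(\<Sum>j\<le>numeral n. f j) = (\<Sum>j\<le>pred_numeral n. f j) + f (numeral n)"
  by (simp add: numeral_eq_Suc)

lemma choose_values: "4 choose 2 = (6::nat)" "6 choose 2 = (15::nat)" "6 choose 4 = (15::nat)"
  by (simp_all add: eval_nat_numeral)

lemmas L_law_moments = L.prob_space[simplified] L_law_odd_moments choose_values

text \<open>
  In the next three proofs \<open>P\<close> is the antiderivative of the polynomial \<open>p\<close>, found by expanding it. It still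
  contains the unknown moment \<open>m\<close>, so that \<open>m = P 1 - P 0\<close> is a linear equation for \<open>m\<close>.
\<close>

lemma L_law_moment_2: "(\<integral>l. l ^ 2 \<partial>L_law) = 7 / 12"
proof -
  define m where "m = (\<integral>l. l ^ 2 \<partial>L_law)"
  define q where "q a b = (\<integral>l. (a + b * l) ^ 2 \<partial>L_law)" for a b
  define p where "p u = 1/3 * q (- (1 + u) / 2) u + 1/6 * q (- (2 - u) / 4) (u / 2) +
    1/6 * q ((2 - u) / 4) (u / 2) + 1/3 * q ((1 + u) / 2) u" for u
  have q: "q a b = a ^ 2 + b ^ 2 * m" for a b
    unfolding q_def m_def L_law_affine_moment
    by (simp add: sum_atMost_numeral L_law_moments)
  have "has_bochner_integral U01 p m"
    using L_law_integral[of "\<lambda>l. l ^ 2"]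
    by (simp add: branch_affine shift_coeff_def scale_coeff_def p_def[abs_def] q_def m_def)
  moreover define P where "P u = 1/4 * u + 1/8 * u ^ 2 + (1 + 4 * m) / 16 * u ^ 3" for u :: real
  have "has_bochner_integral U01 p (P 1 - P 0)"
  proof (rule has_bochner_integral_U01_FTC)
    show "(P has_real_derivative p u) (at u)" for u
      unfolding P_def p_def q by (rule derivative_eq_intros refl | simp add: field_simps eval_nat_numeral)+
    show "continuous_on UNIV p"
      unfolding p_def q by (intro continuous_intros) auto
  qed
  \<comment> \<open>The coefficient of \<open>m\<close> on the right is \<open>E A^2 = 1/4\<close>.
    As it is below 1, the equation determines \<open>m\<close>; for the fourth and sixth moments the
    corresponding coefficients are 11/80 and 43/448.\<close>
  ultimately have "m = P 1 - P 0"
    by (rule has_bochner_integral_eq)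
  then show ?thesis
    by (simp add: P_def m_def[symmetric] field_simps)
qed

lemma L_law_moment_4: "(\<integral>l. l ^ 4 \<partial>L_law) = 375 / 368"
proof -
  define m where "m = (\<integral>l. l ^ 4 \<partial>L_law)"
  define q where "q a b = (\<integral>l. (a + b * l) ^ 4 \<partial>L_law)" for a b
  define p where "p u = 1/3 * q (- (1 + u) / 2) u + 1/6 * q (- (2 - u) / 4) (u / 2) +
    1/6 * q ((2 - u) / 4) (u / 2) + 1/3 * q ((1 + u) / 2) u" for u
  \<comment> \<open>Odd moments vanish, and \<open>7/2\<close> is \<open>6 * 7/12\<close>.\<close>
  have q: "q a b = a ^ 4 + 7 / 2 * (a ^ 2 * b ^ 2) + b ^ 4 * m" for a b
    unfolding q_def m_def L_law_affine_moment
    by (simp add: sum_atMost_numeral L_law_moments L_law_moment_2)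
  have "has_bochner_integral U01 p m"
    using L_law_integral[of "\<lambda>l. l ^ 4"]
    by (simp add: branch_affine shift_coeff_def scale_coeff_def p_def[abs_def] q_def m_def)
  moreover define P where "P u = 1/16 * u + 1/16 * u ^ 2 + 5/16 * u ^ 3 + 5/16 * u ^ 4 + (33 / 256 + 11 / 80 * m) * u ^ 5" for u :: real
  have "has_bochner_integral U01 p (P 1 - P 0)"
  proof (rule has_bochner_integral_U01_FTC)
    show "(P has_real_derivative p u) (at u)" for u
      unfolding P_def p_def q by (rule derivative_eq_intros refl | simp add: field_simps eval_nat_numeral)+
    show "continuous_on UNIV p"
      unfolding p_def q by (intro continuous_intros) auto
  qed
  ultimately have "m = P 1 - P 0"
    by (rule has_bochner_integral_eq)
  then show ?thesis
    by (simp add: P_def m_def[symmetric] field_simps)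
qed

lemma L_law_moment_6: "(\<integral>l. l ^ 6 \<partial>L_law) = 76693 / 22080"
proof -
  define m where "m = (\<integral>l. l ^ 6 \<partial>L_law)"
  define q where "q a b = (\<integral>l. (a + b * l) ^ 6 \<partial>L_law)" for a b
  define p where "p u = 1/3 * q (- (1 + u) / 2) u + 1/6 * q (- (2 - u) / 4) (u / 2) +
    1/6 * q ((2 - u) / 4) (u / 2) + 1/3 * q ((1 + u) / 2) u" for u
  \<comment> \<open>Here \<open>35/4\<close> is \<open>15 * 7/12\<close> and \<open>5625/368\<close>
    is \<open>15 * 375/368\<close>.\<close>
  have q: "q a b = a ^ 6 + 35 / 4 * (a ^ 4 * b ^ 2) + 5625 / 368 * (a ^ 2 * b ^ 4) + b ^ 6 * m" for a b
    unfolding q_def m_def L_law_affine_moment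
    by (simp add: sum_atMost_numeral L_law_moments L_law_moment_2 L_law_moment_4 mult_ac)
  have "has_bochner_integral U01 p m"
    using L_law_integral[of "\<lambda>l. l ^ 6"]
    by (simp add: branch_affine shift_coeff_def scale_coeff_def p_def[abs_def] q_def m_def)
  moreover define P where "P u = 1/64 * u + 3/128 * u ^ 2 + 25/128 * u ^ 3 + 25/64 * u ^ 4 + 1485/1472 * u ^ 5 + 6391/5888 * u ^ 6 + (277479/659456 + 43/448 * m) * u ^ 7" for u :: real
  have "has_bochner_integral U01 p (P 1 - P 0)"
  proof (rule has_bochner_integral_U01_FTC)
    show "(P has_real_derivative p u) (at u)" for u
      unfolding P_def p_def q by (rule derivative_eq_intros refl | simp add: field_simps eval_nat_numeral)+
    show "continuous_on UNIV p"
      unfolding p_def q by (intro continuous_intros) auto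
  qed
  ultimately have "m = P 1 - P 0"
    by (rule has_bochner_integral_eq)
  then show ?thesis
    by (simp add: P_def m_def[symmetric] field_simps)
qed

section \<open>Random reordering and the core\<close>

lemma borel_measurable_vec_lambda:
  fixes f :: "'a \<Rightarrow> 'n::finite \<Rightarrow> real"
  assumes "\<And>i. (\<lambda>x. f x i) \<in> borel_measurable M"
  shows "(\<lambda>x. \<chi> i. f x i) \<in> borel_measurable M"
  using assms by (subst borel_measurable_euclidean_space) (auto simp: Basis_vec_def inner_axis)

lemma borel_measurable_vector3 [measurable (raw)]:
  fixes a b c :: "'a \<Rightarrow> real"
  assumes [measurable]: "a \<in> borel_measurable M" "b \<in> borel_measurable M" "c \<in> borel_measurable M"
  shows "(\<lambda>x. vector [a x, b x, c x] :: real ^ 3) \<in> borel_measurable M"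
proof -
  have "(\<lambda>x. vector [a x, b x, c x] :: real ^ 3) = (\<lambda>x. \<chi> i. if i = 1 then a x else if i = 2 then b x else c x)"
    by (simp add: fun_eq_iff vec_eq_iff forall_3)
  then show ?thesis
    by (simp only:) (rule borel_measurable_vec_lambda, measurable)
qed

lemma borel_measurable_nth_comp [measurable (raw)]:
  fixes f :: "'a \<Rightarrow> real ^ 'n"
  assumes "f \<in> borel_measurable M"
  shows "(\<lambda>x. f x $ i) \<in> borel_measurable M"
  using measurable_compose[OF assms borel_measurable_nth] .

lemma mean_pts_2: "mean_pts (x :: real ^ 2) = (x $ 1 + x $ 2) / 2"
  by (simp add: mean_pts_def sum_2)

lemma mean_pts_3: "mean_pts (x :: real ^ 3) = (x $ 1 + x $ 2 + x $ 3) / 3"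
  by (simp add: mean_pts_def sum_3)

lemma diam_pts_2: "diam_pts (x :: real ^ 2) = \<bar>x $ 1 - x $ 2\<bar>"
proof -
  have "(\<lambda>(i, j). \<bar>x $ i - x $ j\<bar>) ` (UNIV :: (2 \<times> 2) set) = {0, \<bar>x $ 1 - x $ 2\<bar>}"
    by (auto simp: UNIV_2 abs_minus_commute image_iff simp flip: UNIV_Times_UNIV)
  then show ?thesis
    by (simp add: diam_pts_def)
qed

text \<open>The state of the Markov chain that drives everything. It forgets the third point and the
  order within the core, neither of which influences the law of the next midpoint and width.\<close>

definition core_data :: "real ^ 3 \<Rightarrow> real \<times> real" where
  "core_data x = (mean_pts (core x), diam_pts (core x))"

lemma core_data_eq: "core_data x = ((x $ 1 + x $ 2) / 2, \<bar>x $ 1 - x $ 2\<bar>)"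
  by (simp add: core_data_def mean_pts_2 diam_pts_2 core_def)

lemma measurable_core_data [measurable]: "core_data \<in> borel_measurable borel"
  unfolding core_data_eq[abs_def] borel_prod[symmetric] by measurable

section \<open>The random order as a measurable kernel\<close>

definition reorder :: "real ^ 3 \<Rightarrow> (3 \<Rightarrow> 3) \<Rightarrow> real ^ 3" where
  "reorder x \<pi> = (\<chi> i. x $ \<pi> i)"

lemma reorder_nth [simp]: "reorder x \<pi> $ i = x $ \<pi> i"
  by (simp add: reorder_def)

lemma measurable_reorder [measurable]: "(\<lambda>x. reorder x \<pi>) \<in> borel_measurable borel"
  unfolding reorder_def by (rule borel_measurable_vec_lambda) measurable

lemma permutes_UNIV_3:
  "\<pi> permutes (UNIV :: 3 set) \<longleftrightarrow> \<pi> 1 \<noteq> \<pi> 2 \<and> \<pi> 1 \<noteq> \<pi> 3 \<and> \<pi> 2 \<noteq> \<pi> 3"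
proof -
  have "\<pi> permutes (UNIV :: 3 set) \<longleftrightarrow> inj \<pi>"
    by (auto intro: permutes_inj bij_imp_permutes simp: bij_def finite_UNIV_inj_surj)
  also have "\<dots> \<longleftrightarrow> \<pi> 1 \<noteq> \<pi> 2 \<and> \<pi> 1 \<noteq> \<pi> 3 \<and> \<pi> 2 \<noteq> \<pi> 3"
    unfolding inj_def forall_3 by auto
  finally show ?thesis .
qed

lemma permutes_UNIV_3_cases:
  assumes "\<pi> permutes (UNIV :: 3 set)"
  shows "\<pi> 1 = 1 \<and> \<pi> 2 = 2 \<and> \<pi> 3 = 3 \<or>
    \<pi> 1 = 2 \<and> \<pi> 2 = 1 \<and> \<pi> 3 = 3 \<or> \<pi> 1 = 1 \<and> \<pi> 2 = 3 \<and> \<pi> 3 = 2 \<or> \<pi> 1 = 3 \<and> \<pi> 2 = 1 \<and> \<pi> 3 = 2 \<or> \<pi> 1 = 2 \<and> \<pi> 2 = 3 \<and> \<pi> 3 = 1 \<or> \<pi> 1 = 3 \<and> \<pi> 2 = 2 \<and> \<pi> 3 = 1"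
proof -
  have "a = 1 \<and> b = 2 \<and> c = 3 \<or> a = 2 \<and> b = 1 \<and> c = 3 \<or> a = 1 \<and> b = 3 \<and> c = 2 \<or> a = 3 \<and> b = 1 \<and> c = 2 \<or> a = 2 \<and> b = 3 \<and> c = 1 \<or> a = 3 \<and> b = 2 \<and> c = 1"
    if "a \<noteq> b" "a \<noteq> c" "b \<noteq> c" for a b c :: 3
    using that exhaust_3[of a] exhaust_3[of b] exhaust_3[of c] by (elim disjE) simp_all
  with assms show ?thesis unfolding permutes_UNIV_3 by blast
qed

lemma finite_admissible_orders [simp]: "finite (admissible_orders x)"
  unfolding admissible_orders_def by (rule finite_subset[OF _ finite_permutations[of UNIV]]) auto

text \<open>Sorting three reals is always possible. This makes \<open>pmf_of_set\<close> in
  \<open>ord_pmf\<close> a genuine uniform distribution.\<close>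

lemma admissible_orders_nonempty: "admissible_orders x \<noteq> {}"
proof -
  define k where "k i = \<bar>x $ i - mean_pts x\<bar>" for i
  have *: "admissible_orders x \<noteq> {}" if "k p \<le> k q" "k q \<le> k r" "p \<noteq> q" "p \<noteq> r" "q \<noteq> r" for p q r
  proof -
    have "(\<lambda>i. if i = 1 then p else if i = 2 then q else r) \<in> admissible_orders x"
      using that unfolding admissible_orders_def permutes_UNIV_3 by (simp add: k_def)
    then show ?thesis by auto
  qed
  consider "k 1 \<le> k 2 \<and> k 2 \<le> k 3" | "k 1 \<le> k 3 \<and> k 3 \<le> k 2" | "k 2 \<le> k 1 \<and> k 1 \<le> k 3"
    | "k 2 \<le> k 3 \<and> k 3 \<le> k 1" | "k 3 \<le> k 1 \<and> k 1 \<le> k 2" | "k 3 \<le> k 2 \<and> k 2 \<le> k 1"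
    by linarith
  then show ?thesis
    using *[of 1 2 3] *[of 1 3 2] *[of 2 1 3] *[of 2 3 1] *[of 3 1 2] *[of 3 2 1] by cases simp_all
qed

lemma ord_pmf_eq: "ord_pmf x = map_pmf (reorder x) (pmf_of_set (admissible_orders x))"
  by (simp add: ord_pmf_def reorder_def[abs_def])

lemma set_ord_pmf: "set_pmf (ord_pmf x) = reorder x ` admissible_orders x"
  by (simp add: ord_pmf_eq admissible_orders_nonempty)

lemma nn_integral_ord_pmf:
  "(\<integral>\<^sup>+y. f y \<partial>measure_pmf (ord_pmf x)) =
    (\<Sum>\<pi>\<in>admissible_orders x. f (reorder x \<pi>)) / card (admissible_orders x)"
  by (simp add: ord_pmf_eq nn_integral_pmf_of_set admissible_orders_nonempty)

text \<open>The law \<open>ord_pmf x\<close> pushed to the Borel \<sigma>-algebra, where it can be a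
  kernel into \<open>subprob_algebra borel\<close>.\<close>

definition ord_kernel :: "real ^ 3 \<Rightarrow> (real ^ 3) measure" where
  "ord_kernel x = distr (measure_pmf (ord_pmf x)) borel (\<lambda>y. y)"

lemma nn_integral_ord_kernel:
  "f \<in> borel_measurable borel \<Longrightarrow> (\<integral>\<^sup>+y. f y \<partial>ord_kernel x) = (\<integral>\<^sup>+y. f y \<partial>measure_pmf (ord_pmf x))"
  unfolding ord_kernel_def by (rule nn_integral_distr) auto

lemma measure_ord_kernel: "B \<in> sets borel \<Longrightarrow> measure (ord_kernel x) B = measure (measure_pmf (ord_pmf x)) B"
  unfolding ord_kernel_def by (subst measure_distr) auto

lemma measurable_admissible [measurable]: "Measurable.pred borel (\<lambda>x. \<pi> \<in> admissible_orders x)"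
  unfolding admissible_orders_def mem_Collect_eq mean_pts_3 by measurable

lemma measurable_ord_kernel [measurable]: "ord_kernel \<in> borel \<rightarrow>\<^sub>M subprob_algebra borel"
proof (rule measurable_subprob_algebra)
  show "subprob_space (ord_kernel x)" for x
    unfolding ord_kernel_def
    by (intro prob_space_imp_subprob_space measure_pmf.prob_space_distr) auto
  show "sets (ord_kernel x) = sets borel" for x
    by (simp add: ord_kernel_def)
  fix A :: "(real ^ 3) set" assume [measurable]: "A \<in> sets borel"
  let ?P = "{\<pi>. \<pi> permutes (UNIV :: 3 set)}"
  have fin: "finite ?P" by (rule finite_permutations) simp
  have sub: "admissible_orders x \<subseteq> ?P" for x
    by (auto simp: admissible_orders_def)
  \<comment> \<open>The admissible set varies with \<open>x\<close>. Summing over all permutations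
    with a case distinction fixes the range, so that measurability in \<open>x\<close> can be read
    off termwise.\<close>
  have "emeasure (ord_kernel x) A =
      (\<Sum>\<pi>\<in>?P. if \<pi> \<in> admissible_orders x then indicator A (reorder x \<pi>) else 0) /
      (\<Sum>\<pi>\<in>?P. if \<pi> \<in> admissible_orders x then 1 else 0)" for x
  proof -
    have "emeasure (ord_kernel x) A = (\<integral>\<^sup>+y. indicator A y \<partial>ord_kernel x)"
      by (simp add: ord_kernel_def)
    also have "\<dots> = (\<Sum>\<pi>\<in>admissible_orders x. indicator A (reorder x \<pi>)) / of_nat (card (admissible_orders x))"
      by (subst nn_integral_ord_kernel) (simp_all add: nn_integral_ord_pmf)
    also have "(\<Sum>\<pi>\<in>admissible_orders x. indicator A (reorder x \<pi>)) =
      (\<Sum>\<pi>\<in>?P. if \<pi> \<in> admissible_orders x then indicator A (reorder x \<pi>) else (0::ennreal))"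
      using sub fin by (simp add: sum.If_cases Int_absorb1)
    also have "of_nat (card (admissible_orders x)) = (\<Sum>\<pi>\<in>?P. if \<pi> \<in> admissible_orders x then 1 else (0::ennreal))"
      using sub fin by (simp add: sum.If_cases Int_absorb1)
    finally show ?thesis .
  qed
  then show "(\<lambda>x. emeasure (ord_kernel x) A) \<in> borel_measurable borel"
    by simp
qed

section \<open>The core as a closest pair\<close>

text \<open>The deviations \<open>y1\<close>, \<open>y2\<close>, \<open>y3\<close> from the mean sum
  to 0 and \<open>y3\<close> is the largest in modulus. Neither of the others can have the strict
  sign of \<open>y3\<close>, since the remaining one would then exceed \<open>y3\<close> in modulus.
  So \<open>y1\<close> and \<open>y2\<close> lie on the opposite side of 0 and differ by at most
  \<open>\<bar>y3\<bar>\<close>, while both are at least that far from \<open>y3\<close>.\<close>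

lemma admissible_closest:
  assumes "\<pi> \<in> admissible_orders z"
  shows "\<bar>z $ \<pi> 1 - z $ \<pi> 2\<bar> \<le> \<bar>z $ \<pi> 1 - z $ \<pi> 3\<bar>" "\<bar>z $ \<pi> 1 - z $ \<pi> 2\<bar> \<le> \<bar>z $ \<pi> 2 - z $ \<pi> 3\<bar>"
proof -
  have perm: "\<pi> permutes UNIV" and le: "\<bar>z $ \<pi> 1 - mean_pts z\<bar> \<le> \<bar>z $ \<pi> 2 - mean_pts z\<bar>"
    "\<bar>z $ \<pi> 2 - mean_pts z\<bar> \<le> \<bar>z $ \<pi> 3 - mean_pts z\<bar>"
    using assms by (auto simp: admissible_orders_def)
  have "3 * mean_pts z = z $ \<pi> 1 + z $ \<pi> 2 + z $ \<pi> 3"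
    using permutes_UNIV_3_cases[OF perm] unfolding mean_pts_3 by (elim disjE) simp_all
  with le show "\<bar>z $ \<pi> 1 - z $ \<pi> 2\<bar> \<le> \<bar>z $ \<pi> 1 - z $ \<pi> 3\<bar>" "\<bar>z $ \<pi> 1 - z $ \<pi> 2\<bar> \<le> \<bar>z $ \<pi> 2 - z $ \<pi> 3\<bar>"
    by (smt (verit))+
qed

text \<open>The permutation enters only through which pair it selects. The inequalities are weak
  because under ties several pairs may be selected.\<close>

lemma core_data_reorder_cases:
  assumes "\<pi> \<in> admissible_orders z"
  shows "core_data (reorder z \<pi>) = ((z $ 1 + z $ 2) / 2, \<bar>z $ 1 - z $ 2\<bar>) \<and>
      \<bar>z $ 1 - z $ 2\<bar> \<le> \<bar>z $ 1 - z $ 3\<bar> \<and> \<bar>z $ 1 - z $ 2\<bar> \<le> \<bar>z $ 2 - z $ 3\<bar> \<or>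
    core_data (reorder z \<pi>) = ((z $ 1 + z $ 3) / 2, \<bar>z $ 1 - z $ 3\<bar>) \<and>
      \<bar>z $ 1 - z $ 3\<bar> \<le> \<bar>z $ 1 - z $ 2\<bar> \<and> \<bar>z $ 1 - z $ 3\<bar> \<le> \<bar>z $ 2 - z $ 3\<bar> \<or>
    core_data (reorder z \<pi>) = ((z $ 2 + z $ 3) / 2, \<bar>z $ 2 - z $ 3\<bar>) \<and>
      \<bar>z $ 2 - z $ 3\<bar> \<le> \<bar>z $ 1 - z $ 2\<bar> \<and> \<bar>z $ 2 - z $ 3\<bar> \<le> \<bar>z $ 1 - z $ 3\<bar>"
proof -
  have "\<pi> permutes UNIV" using assms by (simp add: admissible_orders_def)
  from permutes_UNIV_3_cases[OF this] show ?thesis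
    using admissible_closest[OF assms] unfolding core_data_eq reorder_nth prod.inject
    by (elim disjE conjE; simp only:; smt (verit))
qed

text \<open>
  The place of the new point in the case \<open>c\<close> with parameter \<open>u\<close>: the interval of length \<open>3 d\<close> centred
  at \<open>m\<close> is cut at the two core points and at \<open>m\<close>, and on each piece \<open>u\<close> is the distance of the new
  point to the nearest core point, divided by the length of the piece.
\<close>

definition new_point :: "nat \<Rightarrow> real \<Rightarrow> real \<Rightarrow> real \<Rightarrow> real" where
  "new_point c m d u = (if c = 0 then m - d / 2 - d * u else if c = 1 then m - d / 2 + d * u / 2
     else if c = 2 then m + d / 2 - d * u / 2 else m + d / 2 + d * u)"

definition step_map :: "real \<times> real \<Rightarrow> real \<times> nat \<Rightarrow> real \<times> real" where
  "step_map z x = (fst z + snd z * shift_coeff (snd x) (fst x), snd z * scale_coeff (snd x) (fst x))"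

lemma measurable_step_map [measurable (raw)]:
  assumes [measurable]: "z \<in> measurable M borel" "x \<in> M \<rightarrow>\<^sub>M borel \<Otimes>\<^sub>M count_space UNIV"
  shows "(\<lambda>w. step_map (z w) (x w)) \<in> measurable M borel"
proof -
  note [measurable] = assms(1)[folded borel_prod]
  show ?thesis unfolding step_map_def borel_prod[symmetric] by measurable
qed

section \<open>One step of the process\<close>

lemma nearest_pair:
  fixes p q r :: real
  assumes PQ: "P = (p + q) / 2 \<and> Q = \<bar>p - q\<bar> \<and> \<bar>p - q\<bar> \<le> \<bar>p - r\<bar> \<and> \<bar>p - q\<bar> \<le> \<bar>q - r\<bar> \<or>
      P = (p + r) / 2 \<and> Q = \<bar>p - r\<bar> \<and> \<bar>p - r\<bar> \<le> \<bar>p - q\<bar> \<and> \<bar>p - r\<bar> \<le> \<bar>q - r\<bar> \<or>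
      P = (q + r) / 2 \<and> Q = \<bar>q - r\<bar> \<and> \<bar>q - r\<bar> \<le> \<bar>p - q\<bar> \<and> \<bar>q - r\<bar> \<le> \<bar>p - r\<bar>"
  shows "\<bar>q - r\<bar> < \<bar>p - q\<bar> \<Longrightarrow> \<bar>q - r\<bar> < \<bar>p - r\<bar> \<Longrightarrow> P = (q + r) / 2 \<and> Q = \<bar>q - r\<bar>"
    and "\<bar>p - r\<bar> < \<bar>p - q\<bar> \<Longrightarrow> \<bar>p - r\<bar> < \<bar>q - r\<bar> \<Longrightarrow> P = (p + r) / 2 \<and> Q = \<bar>p - r\<bar>"
  using PQ by (metis linorder_not_le)+
lemma nearest_pair_cases:
  fixes p q r :: real
  assumes PQ: "P = (p + q) / 2 \<and> Q = \<bar>p - q\<bar> \<and> \<bar>p - q\<bar> \<le> \<bar>p - r\<bar> \<and> \<bar>p - q\<bar> \<le> \<bar>q - r\<bar> \<or>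
      P = (p + r) / 2 \<and> Q = \<bar>p - r\<bar> \<and> \<bar>p - r\<bar> \<le> \<bar>p - q\<bar> \<and> \<bar>p - r\<bar> \<le> \<bar>q - r\<bar> \<or>
      P = (q + r) / 2 \<and> Q = \<bar>q - r\<bar> \<and> \<bar>q - r\<bar> \<le> \<bar>p - q\<bar> \<and> \<bar>q - r\<bar> \<le> \<bar>p - r\<bar>"
    and x: "p = m - d / 2 \<and> q = m + d / 2 \<or> p = m + d / 2 \<and> q = m - d / 2"
    and w: "0 < w" "w < d"
  shows "r = m - d / 2 - w \<Longrightarrow> P = m - d / 2 - w / 2 \<and> Q = w"
    and "r = m - d / 2 + w / 2 \<Longrightarrow> P = m - d / 2 + w / 4 \<and> Q = w / 2"
    and "r = m + d / 2 - w / 2 \<Longrightarrow> P = m + d / 2 - w / 4 \<and> Q = w / 2"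
    and "r = m + d / 2 + w \<Longrightarrow> P = m + d / 2 + w / 2 \<and> Q = w"
  using x
  by (elim disjE; use w nearest_pair[OF PQ] in \<open>simp add: abs_if split: if_splits\<close>)+

text \<open>For \<open>0 < u < 1\<close> the new point and its nearest core point form the only
  closest pair. Every admissible order then has this pair as its core, so the random tie-breaking
  does not affect the result.\<close>

lemma core_data_new_point:
  assumes md: "core_data x = (m, d)" and d: "0 < d" and u: "0 < u" "u < 1" and c: "c \<le> 3"
    and \<pi>: "\<pi> \<in> admissible_orders (vector [x $ 1, x $ 2, new_point c m d u])"
  shows "core_data (reorder (vector [x $ 1, x $ 2, new_point c m d u]) \<pi>) = step_map (m, d) (u, c)"
proof -
  define w where "w = d * u"
  have w: "0 < w" "w < d" using d u by (auto simp: w_def)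
  have dw: "d * (a * u) = a * w" "d * u = w" for a by (auto simp: w_def)
  have step: "step_map (m, d) (u, c) = (if c = 0 then (m - d / 2 - w / 2, w)
    else if c = 1 then (m - d / 2 + w / 4, w / 2) else if c = 2 then (m + d / 2 - w / 4, w / 2)
    else (m + d / 2 + w / 2, w))"
    unfolding step_map_def shift_coeff_def scale_coeff_def w_def by (auto simp: field_simps)
  have c: "c = 0 \<or> c = 1 \<or> c = 2 \<or> c = 3" using c by auto
  have x: "x $ 1 = m - d / 2 \<and> x $ 2 = m + d / 2 \<or> x $ 1 = m + d / 2 \<and> x $ 2 = m - d / 2"
    using md unfolding core_data_eq prod.inject by (auto simp: field_simps abs_if split: if_splits)
  obtain P Q where PQ: "core_data (reorder (vector [x $ 1, x $ 2, new_point c m d u]) \<pi>) = (P, Q)"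
    by (metis surj_pair)
  have cases: "P = (x $ 1 + x $ 2) / 2 \<and> Q = \<bar>x $ 1 - x $ 2\<bar> \<and> \<bar>x $ 1 - x $ 2\<bar> \<le> \<bar>x $ 1 - r\<bar> \<and> \<bar>x $ 1 - x $ 2\<bar> \<le> \<bar>x $ 2 - r\<bar> \<or>
      P = (x $ 1 + r) / 2 \<and> Q = \<bar>x $ 1 - r\<bar> \<and> \<bar>x $ 1 - r\<bar> \<le> \<bar>x $ 1 - x $ 2\<bar> \<and> \<bar>x $ 1 - r\<bar> \<le> \<bar>x $ 2 - r\<bar> \<or>
      P = (x $ 2 + r) / 2 \<and> Q = \<bar>x $ 2 - r\<bar> \<and> \<bar>x $ 2 - r\<bar> \<le> \<bar>x $ 1 - x $ 2\<bar> \<and> \<bar>x $ 2 - r\<bar> \<le> \<bar>x $ 1 - r\<bar>"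
    if "r = new_point c m d u" for r
    using core_data_reorder_cases[OF \<pi>] unfolding PQ vector_3 prod.inject that by (simp only: conj_assoc)
  note nearest = nearest_pair_cases[OF cases x w, OF refl]
  show ?thesis
    unfolding PQ step using c nearest by (elim disjE) (simp_all add: new_point_def w_def)
qed

section \<open>A uniform point on the four pieces\<close>

text \<open>The unit interval is cut at 1/3, 1/2 and 2/3, and each piece is parametrised so that
  \<open>u = 0\<close> is its end at 1/3 or 2/3, the places of the core points. The weights are the
  lengths of the pieces.\<close>

lemma nn_integral_U01_split:
  assumes [measurable]: "h \<in> borel_measurable borel"
  shows "(\<integral>\<^sup>+v. h v \<partial>U01) = (\<integral>\<^sup>+u. ennreal (1/3) * h ((1 - u) / 3) + ennreal (1/6) * h ((2 + u) / 6) +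
    ennreal (1/6) * h ((4 - u) / 6) + ennreal (1/3) * h ((2 + u) / 3) \<partial>U01)"
proof -
  \<comment> \<open>A negative \<open>c\<close> reverses the orientation of a piece, hence
    \<open>min\<close> and \<open>max\<close>. Open intervals keep the pieces disjoint; the end
    points are null.\<close>
  have aff: "(\<integral>\<^sup>+v. h v * indicator {min a (a + c)<..<max a (a + c)} v \<partial>lborel) = (\<integral>\<^sup>+u. ennreal \<bar>c\<bar> * h (a + c * u) \<partial>U01)"
    if "c \<noteq> 0" for a c :: real
  proof -
    have ind: "indicator {min a (a + c)<..<max a (a + c)} (a + c * u) = (indicator {0<..<1} u :: ennreal)" for u
    proof (cases "c > 0")
      case True
      then have "a + c * u < a + c \<longleftrightarrow> u < 1" "a < a + c * u \<longleftrightarrow> 0 < u"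
        by (simp_all add: zero_less_mult_iff)
      with True show ?thesis by (auto simp: indicator_def min_def max_def)
    next
      case False
      with that have "c < 0" by simp
      then have "a + c < a + c * u \<longleftrightarrow> u < 1" "a + c * u < a \<longleftrightarrow> 0 < u"
        by (simp_all add: mult_less_0_iff)
      with \<open>c < 0\<close> show ?thesis by (auto simp: indicator_def min_def max_def)
    qed
    have "(\<integral>\<^sup>+v. h v * indicator {min a (a + c)<..<max a (a + c)} v \<partial>lborel) =
        ennreal \<bar>c\<bar> * (\<integral>\<^sup>+u. h (a + c * u) * indicator {0<..<1} u \<partial>lborel)"
      by (subst nn_integral_real_affine[OF _ that, where t = a]) (simp_all add: ind)
    also have "(\<integral>\<^sup>+u. h (a + c * u) * indicator {0<..<1} u \<partial>lborel) = (\<integral>\<^sup>+u. h (a + c * u) * indicator {0..1} u \<partial>lborel)"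
      using AE_lborel_singleton[of 0] AE_lborel_singleton[of 1]
      by (intro nn_integral_cong_AE) (auto simp: indicator_def elim!: eventually_mono[OF eventually_conj] )
    also have "\<dots> = (\<integral>\<^sup>+u. h (a + c * u) \<partial>U01)"
      by (rule nn_integral_U01[symmetric]) measurable
    finally show ?thesis by (simp add: nn_integral_cmult)
  qed
  have "(\<integral>\<^sup>+v. h v \<partial>U01) = (\<integral>\<^sup>+v. h v * indicator {0..1} v \<partial>lborel)"
    by (rule nn_integral_U01) fact
  also have "\<dots> = (\<integral>\<^sup>+v. h v * indicator {0<..<1/3} v + h v * indicator {1/3<..<1/2} v +
      h v * indicator {1/2<..<2/3} v + h v * indicator {2/3<..<1} v \<partial>lborel)"
  proof (rule nn_integral_cong_AE)
    have "AE v in lborel. v \<notin> {0, 1/3, 1/2, 2/3, 1 :: real}"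
      by (rule AE_not_in[OF finite_imp_null_set_lborel]) simp
    then show "AE v in lborel. h v * indicator {0..1} v = h v * indicator {0<..<1/3} v + h v * indicator {1/3<..<1/2} v +
      h v * indicator {1/2<..<2/3} v + h v * indicator {2/3<..<1} v"
      by eventually_elim (auto simp: indicator_def)
  qed
  also have "\<dots> = (\<integral>\<^sup>+v. h v * indicator {0<..<1/3} v \<partial>lborel) + (\<integral>\<^sup>+v. h v * indicator {1/3<..<1/2} v \<partial>lborel) +
      (\<integral>\<^sup>+v. h v * indicator {1/2<..<2/3} v \<partial>lborel) + (\<integral>\<^sup>+v. h v * indicator {2/3<..<1} v \<partial>lborel)"
    by (subst nn_integral_add; (measurable | simp))+
  also have "\<dots> = (\<integral>\<^sup>+u. ennreal (1/3) * h ((1 - u) / 3) \<partial>U01) + (\<integral>\<^sup>+u. ennreal (1/6) * h ((2 + u) / 6) \<partial>U01) +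
      (\<integral>\<^sup>+u. ennreal (1/6) * h ((4 - u) / 6) \<partial>U01) + (\<integral>\<^sup>+u. ennreal (1/3) * h ((2 + u) / 3) \<partial>U01)"
    using aff[of "-1/3" "1/3"] aff[of "1/6" "1/3"] aff[of "-1/6" "2/3"] aff[of "1/3" "2/3"]
    by (simp add: diff_divide_distrib add_divide_distrib)
  also have "\<dots> = (\<integral>\<^sup>+u. ennreal (1/3) * h ((1 - u) / 3) + ennreal (1/6) * h ((2 + u) / 6) +
    ennreal (1/6) * h ((4 - u) / 6) + ennreal (1/3) * h ((2 + u) / 3) \<partial>U01)"
    by (subst nn_integral_add; (measurable | simp))+
  finally show ?thesis .
qed

text \<open>
  The kernel \<open>K\<close> stands in for \<open>\<kappa>\<close> because the laws \<open>\<kappa> \<omega>\<close> of interest need not be kernels into \<open>borel\<close>: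
  \<open>measure_pmf\<close> lives on the discrete \<open>\<sigma>\<close>-algebra, and the uniform law degenerates if the core does.
\<close>

lemma cond_law_nn_integral:
  fixes Y :: "'a \<Rightarrow> 'b::topological_space" and f :: "'c \<Rightarrow> 'b \<Rightarrow> ennreal"
  assumes M: "prob_space M" and G: "subalgebra M G" and Y: "has_cond_law M G Y \<kappa>"
    and Z: "Z \<in> G \<rightarrow>\<^sub>M N" and K [measurable]: "K \<in> N \<rightarrow>\<^sub>M subprob_algebra borel"
    and \<kappa>: "\<And>B. B \<in> sets borel \<Longrightarrow> AE \<omega> in M. measure (\<kappa> \<omega>) B = measure (K (Z \<omega>)) B"
    and f [measurable]: "case_prod f \<in> borel_measurable (N \<Otimes>\<^sub>M borel)"
  shows "(\<integral>\<^sup>+\<omega>. f (Z \<omega>) (Y \<omega>) \<partial>M) = (\<integral>\<^sup>+\<omega>. \<integral>\<^sup>+y. f (Z \<omega>) y \<partial>K (Z \<omega>) \<partial>M)"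
proof -
  interpret prob_space M by fact
  interpret finite_measure_subalgebra M G
    by unfold_locales fact
  have [measurable]: "Y \<in> borel_measurable M"
    using Y by (simp add: has_cond_law_def)
  have ZM [measurable]: "Z \<in> M \<rightarrow>\<^sub>M N"
    using measurable_from_subalg[OF G Z] .
  define J where "J = (\<lambda>z. distr (K z) (N \<Otimes>\<^sub>M borel) (Pair z))"
  have J [measurable]: "J \<in> N \<rightarrow>\<^sub>M subprob_algebra (N \<Otimes>\<^sub>M borel)"
    unfolding J_def by (rule measurable_distr2[where M = borel]) measurable
  \<comment> \<open>The joint law of \<open>(Z, Y)\<close> that the kernel predicts. It is compared
    with the true one on rectangles, which form an intersection-stable generator.\<close>
  define Q where "Q = distr M N Z \<bind> J"
  have sets_Q: "sets Q = sets (N \<Otimes>\<^sub>M borel)"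
    unfolding Q_def using ZM not_empty measurable_space[OF ZM]
    by (intro sets_bind[where N = "N \<Otimes>\<^sub>M borel"] sets_kernel[OF J]) auto
  have Q_int: "(\<integral>\<^sup>+p. g p \<partial>Q) = (\<integral>\<^sup>+\<omega>. \<integral>\<^sup>+y. g (Z \<omega>, y) \<partial>K (Z \<omega>) \<partial>M)"
    if [measurable]: "g \<in> borel_measurable (N \<Otimes>\<^sub>M borel)" for g
  proof -
    have "(\<integral>\<^sup>+p. g p \<partial>Q) = (\<integral>\<^sup>+z. \<integral>\<^sup>+p. g p \<partial>J z \<partial>distr M N Z)"
      unfolding Q_def by (rule nn_integral_bind[where B = "N \<Otimes>\<^sub>M borel"]) auto
    also have "\<dots> = (\<integral>\<^sup>+\<omega>. \<integral>\<^sup>+p. g p \<partial>J (Z \<omega>) \<partial>M)"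
      by (rule nn_integral_distr) measurable
    also have "\<dots> = (\<integral>\<^sup>+\<omega>. \<integral>\<^sup>+y. g (Z \<omega>, y) \<partial>K (Z \<omega>) \<partial>M)"
    proof (rule nn_integral_cong)
      fix \<omega> assume "\<omega> \<in> space M"
      then have z: "Z \<omega> \<in> space N" by (rule measurable_space[OF ZM])
      then have [measurable_cong]: "sets (K (Z \<omega>)) = sets borel" by (rule sets_kernel[OF K])
      show "(\<integral>\<^sup>+p. g p \<partial>J (Z \<omega>)) = (\<integral>\<^sup>+y. g (Z \<omega>, y) \<partial>K (Z \<omega>))"
        unfolding J_def using z by (intro nn_integral_distr) measurable
    qed
    finally show ?thesis .
  qed
  have rect: "emeasure (distr M (N \<Otimes>\<^sub>M borel) (\<lambda>\<omega>. (Z \<omega>, Y \<omega>))) (A \<times> B) = emeasure Q (A \<times> B)"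
    if A [measurable]: "A \<in> sets N" and B [measurable]: "B \<in> sets borel" for A B
  proof -
    have ZA: "Z -` A \<inter> space M \<in> sets G"
      using measurable_sets[OF Z A] G by (simp add: subalgebra_def)
    have int: "integrable M (\<lambda>\<omega>. indicator B (Y \<omega>) :: real)"
      by (rule integrable_const_bound[where B = 1]) (auto simp: indicator_def)
    have "emeasure (distr M (N \<Otimes>\<^sub>M borel) (\<lambda>\<omega>. (Z \<omega>, Y \<omega>))) (A \<times> B) = (\<integral>\<^sup>+\<omega>. indicator (A \<times> B) (Z \<omega>, Y \<omega>) \<partial>M)"
      by (subst nn_integral_distr[symmetric, where f = "indicator (A \<times> B)" and T = "\<lambda>\<omega>. (Z \<omega>, Y \<omega>)" and M' = "N \<Otimes>\<^sub>M borel"]) auto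
    also have "\<dots> = (\<integral>\<^sup>+\<omega>. ennreal (indicator (Z -` A \<inter> space M) \<omega> * indicator B (Y \<omega>)) \<partial>M)"
      by (intro nn_integral_cong) (auto simp: indicator_def)
    also have "\<dots> = ennreal (\<integral>\<omega>. indicator (Z -` A \<inter> space M) \<omega> * indicator B (Y \<omega>) \<partial>M)"
      by (intro nn_integral_eq_integral integrable_const_bound[where B = 1]) (auto simp: indicator_def)
    \<comment> \<open>The event that \<open>Z\<close> lies in \<open>A\<close> belongs to
      \<open>G\<close>, so on it the indicator of \<open>Y\<close> in \<open>B\<close> may be
      replaced by its conditional expectation.\<close>
    also have "(\<integral>\<omega>. indicator (Z -` A \<inter> space M) \<omega> * indicator B (Y \<omega>) \<partial>M) =
        (\<integral>\<omega>. indicator (Z -` A \<inter> space M) \<omega> * real_cond_exp M G (\<lambda>\<omega>. indicator B (Y \<omega>)) \<omega> \<partial>M)"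
      using real_cond_exp_intA[OF int ZA] by (simp add: set_lebesgue_integral_def)
    also have "\<dots> = (\<integral>\<omega>. indicator (Z -` A \<inter> space M) \<omega> * measure (K (Z \<omega>)) B \<partial>M)"
    proof (rule integral_cong_AE)
      have "AE \<omega> in M. real_cond_exp M G (\<lambda>\<omega>. indicator B (Y \<omega>)) \<omega> = measure (\<kappa> \<omega>) B"
        using Y B by (simp add: has_cond_law_def)
      with \<kappa>[OF B] show "AE \<omega> in M. indicat_real (Z -` A \<inter> space M) \<omega> * real_cond_exp M G (\<lambda>\<omega>. indicator B (Y \<omega>)) \<omega> =
          indicator (Z -` A \<inter> space M) \<omega> * measure (K (Z \<omega>)) B"
        by eventually_elim simp
    qed measurable
    also have "ennreal \<dots> = (\<integral>\<^sup>+\<omega>. ennreal (indicator (Z -` A \<inter> space M) \<omega> * measure (K (Z \<omega>)) B) \<partial>M)"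
    proof (rule nn_integral_eq_integral[symmetric])
      show "integrable M (\<lambda>\<omega>. indicat_real (Z -` A \<inter> space M) \<omega> * measure (K (Z \<omega>)) B)"
      proof (rule integrable_const_bound[where B = 1])
        have "measure (K (Z \<omega>)) B \<le> 1" if "\<omega> \<in> space M" for \<omega>
          using subprob_space_kernel[OF K measurable_space[OF ZM that]] by (rule subprob_space.subprob_measure_le_1)
        then show "AE \<omega> in M. norm (indicat_real (Z -` A \<inter> space M) \<omega> * measure (K (Z \<omega>)) B) \<le> 1"
          by (intro AE_I2) (auto simp: indicator_def)
      qed measurable
    qed auto
    also have "\<dots> = (\<integral>\<^sup>+\<omega>. \<integral>\<^sup>+y. indicator (A \<times> B) (Z \<omega>, y) \<partial>K (Z \<omega>) \<partial>M)"
    proof (rule nn_integral_cong)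
      fix \<omega> assume \<omega>: "\<omega> \<in> space M"
      note z = measurable_space[OF ZM this]
      interpret K: subprob_space "K (Z \<omega>)" by (rule subprob_space_kernel[OF K z])
      have "B \<in> sets (K (Z \<omega>))" using B sets_kernel[OF K z] by simp
      then have "(\<integral>\<^sup>+y. indicator (A \<times> B) (Z \<omega>, y) \<partial>K (Z \<omega>)) = indicator A (Z \<omega>) * emeasure (K (Z \<omega>)) B"
        by (simp add: indicator_times nn_integral_cmult)
      then show "ennreal (indicator (Z -` A \<inter> space M) \<omega> * measure (K (Z \<omega>)) B) =
          (\<integral>\<^sup>+y. indicator (A \<times> B) (Z \<omega>, y) \<partial>K (Z \<omega>))"
        using \<omega> by (simp add: K.emeasure_eq_measure indicator_def)
    qed
    also have "\<dots> = emeasure Q (A \<times> B)"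
      by (subst Q_int[symmetric]) (auto simp: sets_Q)
    finally show ?thesis .
  qed
  have "distr M (N \<Otimes>\<^sub>M borel) (\<lambda>\<omega>. (Z \<omega>, Y \<omega>)) = Q"
  proof (rule measure_eqI_generator_eq[OF Int_stable_pair_measure_generator[of N borel],
        where A = "\<lambda>_. space N \<times> UNIV" and \<Omega> = "space N \<times> UNIV"])
    show "{a \<times> b |a b. a \<in> sets N \<and> b \<in> sets borel} \<subseteq> Pow (space N \<times> (UNIV :: 'b set))"
      using sets.sets_into_space by fastforce
    show "sets (distr M (N \<Otimes>\<^sub>M borel) (\<lambda>\<omega>. (Z \<omega>, Y \<omega>))) = sigma_sets (space N \<times> UNIV) {a \<times> b |a b. a \<in> sets N \<and> b \<in> sets (borel :: 'b measure)}"
      by (simp add: sets_pair_measure)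
    show "sets Q = sigma_sets (space N \<times> UNIV) {a \<times> b |a b. a \<in> sets N \<and> b \<in> sets (borel :: 'b measure)}"
      by (simp add: sets_Q sets_pair_measure)
    show "emeasure (distr M (N \<Otimes>\<^sub>M borel) (\<lambda>\<omega>. (Z \<omega>, Y \<omega>))) (space N \<times> UNIV) \<noteq> \<infinity>"
      using finite_measure.emeasure_finite[OF finite_measure_distr, of "\<lambda>\<omega>. (Z \<omega>, Y \<omega>)" "N \<Otimes>\<^sub>M borel"]
      by (simp add: infinity_ennreal_def)
    show "range (\<lambda>_. space N \<times> UNIV) \<subseteq> {a \<times> b |a b. a \<in> sets N \<and> b \<in> sets (borel :: 'b measure)}"
      using sets.top[of N] by (auto intro!: exI[of _ "space N"] exI[of _ "UNIV :: 'b set"])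
  qed (auto intro: rect)
  then have "(\<integral>\<^sup>+p. case_prod f p \<partial>distr M (N \<Otimes>\<^sub>M borel) (\<lambda>\<omega>. (Z \<omega>, Y \<omega>))) = (\<integral>\<^sup>+p. case_prod f p \<partial>Q)"
    by simp
  then show ?thesis
    by (subst (asm) nn_integral_distr) (simp_all add: Q_int)
qed

section \<open>The law of the new point as a kernel\<close>

lemma uniform_measure_affine:
  fixes a c :: real
  assumes c: "0 < c"
  shows "uniform_measure lborel {a..a + c} = distr U01 borel (\<lambda>v. a + c * v)"
proof (rule measure_eqI)
  fix A assume "A \<in> sets (uniform_measure lborel {a..a + c})"
  then have [measurable]: "A \<in> sets borel" by simp
  have "emeasure (uniform_measure lborel {a..a + c}) A = (\<integral>\<^sup>+v. indicator A v * indicator {a..a + c} v \<partial>lborel) / ennreal c"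
    using c nn_integral_uniform_measure[of "indicator A" lborel "{a..a + c}"] by simp
  also have "(\<integral>\<^sup>+v. indicator A v * indicator {a..a + c} v \<partial>lborel) =
      ennreal c * (\<integral>\<^sup>+v. indicator A (a + c * v) * indicator {a..a + c} (a + c * v) \<partial>lborel)"
    using c by (subst nn_integral_real_affine[where c = c and t = a]) auto
  also have "(\<lambda>v. indicator {a..a + c} (a + c * v) :: ennreal) = indicator {0..1}"
    using c by (auto simp: indicator_def fun_eq_iff zero_le_mult_iff)
  then have "(\<integral>\<^sup>+v. indicator A (a + c * v) * indicator {a..a + c} (a + c * v) \<partial>lborel) =
      (\<integral>\<^sup>+v. indicator A (a + c * v) * indicator {0..1} v \<partial>lborel)"
    by (simp only: fun_eq_iff)
  also have "\<dots> = (\<integral>\<^sup>+v. indicator A (a + c * v) \<partial>U01)"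
    by (rule nn_integral_U01[symmetric]) measurable
  also have "\<dots> = (\<integral>\<^sup>+v. indicator A v \<partial>distr U01 borel (\<lambda>v. a + c * v))"
    by (rule nn_integral_distr[symmetric]) measurable
  finally show "emeasure (uniform_measure lborel {a..a + c}) A = emeasure (distr U01 borel (\<lambda>v. a + c * v)) A"
    using c by (simp add: mult.commute[of "ennreal c"] ennreal_mult_divide_eq)
qed simp

text \<open>Written as an affine image of the uniform law on the unit interval, it is the point mass
  at the midpoint when the core degenerates, and hence a probability kernel everywhere.\<close>

definition unif_kernel :: "real ^ 3 \<Rightarrow> real measure" where
  "unif_kernel x = distr U01 borel
     (\<lambda>v. (fst (core_data x) - 3 / 2 * snd (core_data x)) + 3 * snd (core_data x) * v)"

lemma measurable_unif_kernel [measurable]: "unif_kernel \<in> borel \<rightarrow>\<^sub>M subprob_algebra borel"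
  unfolding unif_kernel_def
proof (rule measurable_distr2[where M = borel])
  note [measurable] = measurable_core_data[folded borel_prod]
  show "(\<lambda>(x, v). (fst (core_data x) - 3 / 2 * snd (core_data x)) + 3 * snd (core_data x) * v) \<in> borel_measurable (borel \<Otimes>\<^sub>M borel)"
    by measurable
  show "(\<lambda>x. U01) \<in> borel \<rightarrow>\<^sub>M subprob_algebra borel"
    by (rule measurable_const) (simp add: space_subprob_algebra prob_space_imp_subprob_space prob_space_U01)
qed

lemma unif_kernel_eq:
  assumes "x $ 1 \<noteq> x $ 2"
  shows "(let a = x $ 1; b = x $ 2; d = \<bar>a - b\<bar> in uniform_measure lborel {min a b - d .. max a b + d}) = unif_kernel x"
proof -
  let ?m = "(x $ 1 + x $ 2) / 2" and ?d = "\<bar>x $ 1 - x $ 2\<bar>"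
  have "min (x $ 1) (x $ 2) - ?d = ?m - 3 / 2 * ?d" "max (x $ 1) (x $ 2) + ?d = (?m - 3 / 2 * ?d) + 3 * ?d"
    by (auto simp: min_def max_def abs_if field_simps)
  then show ?thesis
    using assms unfolding Let_def unif_kernel_def core_data_eq fst_conv snd_conv
    by (simp only:) (rule uniform_measure_affine, simp)
qed

context modified_process
begin

lemma measurable_X_M [measurable]: "X t \<in> borel_measurable M"
  using measurable_from_subalg[OF F_subalgebra X_adapted] .

text \<open>
  On a degenerate core the uniform law prescribed for the new point is the null measure (a junk value),
  which is no version of a conditional distribution.
\<close>

lemma AE_X_distinct: "AE \<omega> in M. X t \<omega> $ 1 \<noteq> X t \<omega> $ 2"
proof -
  interpret finite_measure_subalgebra M "F t"
    by unfold_locales (rule F_subalgebra)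
  have "AE \<omega> in M. real_cond_exp M (F t) (\<lambda>\<omega>. 1) \<omega> = 1"
    by (rule real_cond_exp_F_meas) auto
  moreover have "AE \<omega> in M. real_cond_exp M (F t) (\<lambda>\<omega>. indicator UNIV (U (Suc t) \<omega>)) \<omega> =
      measure (let a = X t \<omega> $ 1; b = X t \<omega> $ 2; d = \<bar>a - b\<bar> in uniform_measure lborel {min a b - d .. max a b + d}) UNIV"
    by (rule U_step[of t, unfolded has_cond_law_def, THEN conjunct2, THEN bspec]) simp
  ultimately show ?thesis
  proof eventually_elim
    case (elim \<omega>)
    show ?case
    proof
      assume eq: "X t \<omega> $ 1 = X t \<omega> $ 2"
      \<comment> \<open>The normalisation is \<open>0 / 0\<close>, which is 0 in
        \<open>ennreal\<close>, so the conditional probability of the whole line would be 0 instead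
        of 1.\<close>
      have "emeasure (uniform_measure lborel {X t \<omega> $ 2}) UNIV = 0"
        by (subst emeasure_uniform_measure) auto
      then show False
        using elim eq by (simp add: measure_def Let_def)
    qed
  qed
qed

text \<open>The sole source of information on the dynamics in what follows. The two conditional laws
  are removed in reverse order of drawing: the order of the points given the past and the new point,
  then the new point given the past.\<close>

lemma nn_integral_step:
  assumes f: "case_prod f \<in> borel_measurable (borel \<Otimes>\<^sub>M borel)"
  shows "(\<integral>\<^sup>+\<omega>. f (core_data (X t \<omega>)) (core_data (X (Suc t) \<omega>)) \<partial>M) =
    (\<integral>\<^sup>+\<omega>. \<integral>\<^sup>+x. f (core_data (X t \<omega>)) (step_map (core_data (X t \<omega>)) x) \<partial>draw_law \<partial>M)"
proof -
  have [measurable (raw)]: "(\<lambda>w. f (a w) (b w)) \<in> borel_measurable K"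
    if "a \<in> measurable K borel" "b \<in> measurable K borel" for a b and K :: "'k measure"
    using measurable_compose[OF measurable_Pair[OF that] f] by simp
  define G where "G = sigma (space M) (sets (F t) \<union> sets (vimage_algebra (space M) (U (Suc t)) borel))"
  have U_M: "U (Suc t) \<in> borel_measurable M"
    using U_step[of t] by (simp add: has_cond_law_def)
  have Ft: "sets (F t) \<subseteq> sets M" "space (F t) = space M"
    using F_subalgebra[of t] by (auto simp: subalgebra_def)
  have vU: "sets (vimage_algebra (space M) (U (Suc t)) borel) \<subseteq> sets M"
    using U_M by (auto simp: sets_vimage_algebra2 intro: measurable_sets)
  have gen: "sets (F t) \<union> sets (vimage_algebra (space M) (U (Suc t)) borel) \<subseteq> Pow (space M)"
    using Ft vU sets.sets_into_space by blast
  have sets_G: "sets G = sigma_sets (space M) (sets (F t) \<union> sets (vimage_algebra (space M) (U (Suc t)) borel))"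
    unfolding G_def by (rule sets_measure_of[OF gen])
  have space_G: "space G = space M"
    unfolding G_def by (rule space_measure_of[OF gen])
  have G: "subalgebra M G"
    unfolding subalgebra_def sets_G space_G
    using Ft vU by (auto intro!: sets.sigma_sets_subset)
  have XG: "X t \<in> borel_measurable G"
  proof (rule measurableI)
    fix B :: "(real ^ 3) set" assume "B \<in> sets borel"
    then have "X t -` B \<inter> space M \<in> sets (F t)"
      using measurable_sets[OF X_adapted] Ft(2) by metis
    then show "X t -` B \<inter> space G \<in> sets G"
      unfolding space_G sets_G by (intro sigma_sets.Basic) auto
  qed simp
  have UG: "U (Suc t) \<in> borel_measurable G"
  proof (rule measurableI)
    fix B :: "real set" assume "B \<in> sets borel"
    then have "U (Suc t) -` B \<inter> space M \<in> sets (vimage_algebra (space M) (U (Suc t)) borel)"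
      by (rule in_vimage_algebra)
    then show "U (Suc t) -` B \<inter> space G \<in> sets G"
      unfolding space_G sets_G by (intro sigma_sets.Basic) auto
  qed simp
  \<comment> \<open>\<open>H x u\<close> averages over the random order when the configuration
    \<open>x\<close> and the new point \<open>u\<close> are given.\<close>
  define H where "H x u = (\<integral>\<^sup>+y. f (core_data x) (core_data y) \<partial>ord_kernel (vector [x $ 1, x $ 2, u]))" for x u
  have H_measurable [measurable]: "case_prod H \<in> borel_measurable (borel \<Otimes>\<^sub>M borel)"
    unfolding H_def split_beta'
    by (rule nn_integral_measurable_subprob_algebra2[where N = borel]) measurable
  have "(\<integral>\<^sup>+\<omega>. f (core_data (X t \<omega>)) (core_data (X (Suc t) \<omega>)) \<partial>M) = (\<integral>\<^sup>+\<omega>. H (X t \<omega>) (U (Suc t) \<omega>) \<partial>M)"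
    using cond_law_nn_integral[OF prob_space_axioms G X_step[of t, folded G_def],
        of "\<lambda>\<omega>. (X t \<omega>, U (Suc t) \<omega>)" "borel \<Otimes>\<^sub>M borel" "\<lambda>(x, u). ord_kernel (vector [x $ 1, x $ 2, u])"
          "\<lambda>(x, u) y. f (core_data x) (core_data y)"] XG UG
    by (simp add: H_def measure_ord_kernel split_beta')
  also have "\<dots> = (\<integral>\<^sup>+\<omega>. \<integral>\<^sup>+u. H (X t \<omega>) u \<partial>unif_kernel (X t \<omega>) \<partial>M)"
  proof (rule cond_law_nn_integral[OF prob_space_axioms F_subalgebra U_step X_adapted])
    fix B :: "real set"
    show "AE \<omega> in M. measure (let a = X t \<omega> $ 1; b = X t \<omega> $ 2; d = \<bar>a - b\<bar> in uniform_measure lborel {min a b - d .. max a b + d}) B =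
        measure (unif_kernel (X t \<omega>)) B"
      using AE_X_distinct[of t] by eventually_elim (rule arg_cong[OF unif_kernel_eq, where f = "\<lambda>K. measure K B"])
  qed measurable
  also have "\<dots> = (\<integral>\<^sup>+\<omega>. \<integral>\<^sup>+x. f (core_data (X t \<omega>)) (step_map (core_data (X t \<omega>)) x) \<partial>draw_law \<partial>M)"
    using AE_X_distinct[of t]
  proof (intro nn_integral_cong_AE, eventually_elim)
    case (elim \<omega>)
    define x where "x = X t \<omega>"
    obtain m d where md: "core_data x = (m, d)" by (metis surj_pair)
    have d: "0 < d" using elim md by (auto simp: core_data_eq x_def)
    have H_new: "H x (new_point c m d u) = f (m, d) (step_map (m, d) (u, c))"
      if "0 < u" "u < 1" "c \<le> 3" for u c
    proof -
      have "H x (new_point c m d u) = (\<integral>\<^sup>+y. f (m, d) (core_data y) \<partial>measure_pmf (ord_pmf (vector [x $ 1, x $ 2, new_point c m d u])))"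
        unfolding H_def md by (rule nn_integral_ord_kernel) measurable
      also have "\<dots> = (\<integral>\<^sup>+y. f (m, d) (step_map (m, d) (u, c)) \<partial>measure_pmf (ord_pmf (vector [x $ 1, x $ 2, new_point c m d u])))"
        using core_data_new_point[OF md d that]
        by (intro nn_integral_cong_AE AE_pmfI) (auto simp: set_ord_pmf)
      finally show ?thesis by (simp add: measure_pmf.emeasure_space_1[simplified])
    qed
    \<comment> \<open>In the coordinate \<open>v\<close> the core points sit at 1/3 and 2/3 and the
      midpoint at 1/2.\<close>
    define h where "h v = H x ((m - 3 / 2 * d) + 3 * d * v)" for v
    have [measurable]: "h \<in> borel_measurable borel" unfolding h_def by measurable
    have h: "h ((1 - u) / 3) = H x (new_point 0 m d u)" "h ((2 + u) / 6) = H x (new_point 1 m d u)"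
      "h ((4 - u) / 6) = H x (new_point 2 m d u)" "h ((2 + u) / 3) = H x (new_point 3 m d u)" for u
      unfolding h_def new_point_def by (auto intro!: arg_cong[where f = "H x"] simp: field_simps)
    have "(\<integral>\<^sup>+u. H x u \<partial>unif_kernel x) = (\<integral>\<^sup>+v. h v \<partial>U01)"
      unfolding unif_kernel_def md fst_conv snd_conv h_def by (rule nn_integral_distr) measurable
    also have "\<dots> = (\<integral>\<^sup>+u. ennreal (1/3) * h ((1 - u) / 3) + ennreal (1/6) * h ((2 + u) / 6) +
        ennreal (1/6) * h ((4 - u) / 6) + ennreal (1/3) * h ((2 + u) / 3) \<partial>U01)"
      by (rule nn_integral_U01_split) measurable
    also have "\<dots> = (\<integral>\<^sup>+u. \<integral>\<^sup>+c. f (m, d) (step_map (m, d) (u, c)) \<partial>measure_pmf branch_pmf \<partial>U01)"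
    proof (rule nn_integral_cong_AE)
      \<comment> \<open>At \<open>u = 0\<close> the new point coincides with a core point, and at
        \<open>u = 1\<close> two distances tie; the closest-pair description holds strictly in
        between.\<close>
      have "AE u in U01. 0 < u \<and> u < 1"
      proof (rule AE_uniform_measureI)
        show "AE u in lborel. u \<in> {0..1} \<longrightarrow> 0 < u \<and> u < (1::real)"
          using AE_lborel_singleton[of "0::real"] AE_lborel_singleton[of "1::real"] by eventually_elim auto
      qed simp
      then show "AE u in U01. ennreal (1/3) * h ((1 - u) / 3) + ennreal (1/6) * h ((2 + u) / 6) +
        ennreal (1/6) * h ((4 - u) / 6) + ennreal (1/3) * h ((2 + u) / 3) =
        (\<integral>\<^sup>+c. f (m, d) (step_map (m, d) (u, c)) \<partial>measure_pmf branch_pmf)"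
        by eventually_elim (simp add: h H_new nn_integral_branch_pmf)
    qed
    also have "\<dots> = (\<integral>\<^sup>+x. f (m, d) (step_map (m, d) x) \<partial>draw_law)"
      by (rule nn_integral_draw_law[symmetric]) measurable
    finally show ?case unfolding x_def[symmetric] md .
  qed
  finally show ?thesis .
qed

end

section \<open>Convergence and the law of the limit\<close>

lemma core_nth [simp]: "core x $ 1 = x $ 1" "core x $ 2 = x $ 2"
  by (simp_all add: core_def)

context modified_process
begin

abbreviation mid :: "nat \<Rightarrow> 'a \<Rightarrow> real" where
  "mid t \<omega> \<equiv> mean_pts (core (X t \<omega>))"

abbreviation wid :: "nat \<Rightarrow> 'a \<Rightarrow> real" where
  "wid t \<omega> \<equiv> diam_pts (core (X t \<omega>))"

lemma measurable_mid [measurable]: "mid t \<in> borel_measurable M"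
  unfolding mean_pts_2 core_nth by measurable

lemma measurable_wid [measurable]: "wid t \<in> borel_measurable M"
  unfolding diam_pts_2 core_nth by measurable

lemma wid_nonneg: "0 \<le> wid t \<omega>"
  by (simp add: diam_pts_2)

section \<open>The initial configuration\<close>

lemma nn_integral_init:
  assumes f [measurable]: "case_prod f \<in> borel_measurable (borel \<Otimes>\<^sub>M borel)"
  shows "(\<integral>\<^sup>+\<omega>. f (P \<omega>) (X 0 \<omega>) \<partial>M) = (\<integral>\<^sup>+\<omega>. \<integral>\<^sup>+y. f (P \<omega>) y \<partial>measure_pmf (ord_pmf (P \<omega>)) \<partial>M)"
proof -
  have sub: "subalgebra M (vimage_algebra (space M) P borel)"
    using P_measurable by (auto simp: subalgebra_def sets_vimage_algebra2 intro: measurable_sets)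
  have "(\<integral>\<^sup>+\<omega>. f (P \<omega>) (X 0 \<omega>) \<partial>M) = (\<integral>\<^sup>+\<omega>. \<integral>\<^sup>+y. f (P \<omega>) y \<partial>ord_kernel (P \<omega>) \<partial>M)"
  proof (rule cond_law_nn_integral[OF prob_space_axioms sub X_init])
    show "P \<in> borel_measurable (vimage_algebra (space M) P borel)"
      by (rule measurable_vimage_algebra1) simp
    show "AE \<omega> in M. measure (measure_pmf (ord_pmf (P \<omega>))) B = measure (ord_kernel (P \<omega>)) B"
      if "B \<in> sets borel" for B
      by (intro AE_I2 measure_ord_kernel[OF that, symmetric])
  qed (rule measurable_ord_kernel f)+
  also have "\<dots> = (\<integral>\<^sup>+\<omega>. \<integral>\<^sup>+y. f (P \<omega>) y \<partial>measure_pmf (ord_pmf (P \<omega>)) \<partial>M)"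
    by (intro nn_integral_cong nn_integral_ord_kernel) measurable
  finally show ?thesis .
qed

text \<open>Reordering only permutes coordinates. Since \<open>X 0\<close> is tied to
  \<open>P\<close> only in law, the property is transferred by integrating the indicator
  \<open>f\<close> of its failure.\<close>

lemma AE_X_0_unit: "AE \<omega> in M. \<forall>i. X 0 \<omega> $ i \<in> {0..1}"
proof -
  define f :: "real ^ 3 \<Rightarrow> real ^ 3 \<Rightarrow> ennreal" where
    "f z y = (if \<forall>i. y $ i \<in> {0..1} then 0 else 1)" for z y
  have [measurable]: "case_prod f \<in> borel_measurable (borel \<Otimes>\<^sub>M borel)"
    unfolding f_def forall_3 split_beta' by measurable
  have "(\<integral>\<^sup>+\<omega>. f (P \<omega>) (X 0 \<omega>) \<partial>M) = (\<integral>\<^sup>+\<omega>. \<integral>\<^sup>+y. f (P \<omega>) y \<partial>measure_pmf (ord_pmf (P \<omega>)) \<partial>M)"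
    by (rule nn_integral_init) measurable
  also have "\<dots> = (\<integral>\<^sup>+\<omega>. 0 \<partial>M)"
    using P_unit
  proof (intro nn_integral_cong_AE, eventually_elim)
    case (elim \<omega>)
    then have "(\<integral>\<^sup>+y. f (P \<omega>) y \<partial>measure_pmf (ord_pmf (P \<omega>))) = (\<integral>\<^sup>+y. 0 \<partial>measure_pmf (ord_pmf (P \<omega>)))"
      by (intro nn_integral_cong_AE AE_pmfI) (auto simp: f_def set_ord_pmf)
    then show ?case by simp
  qed
  finally have "(\<integral>\<^sup>+\<omega>. f (P \<omega>) (X 0 \<omega>) \<partial>M) = 0" by simp
  moreover have "(\<lambda>\<omega>. f (P \<omega>) (X 0 \<omega>)) \<in> borel_measurable M"
    unfolding f_def forall_3 by measurable
  ultimately have "AE \<omega> in M. f (P \<omega>) (X 0 \<omega>) = 0"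
    by (simp only: nn_integral_0_iff_AE)
  then show ?thesis
    by eventually_elim (metis f_def zero_neq_one)
qed

lemma AE_mid_wid_0: "AE \<omega> in M. \<bar>mid 0 \<omega>\<bar> \<le> 1 \<and> \<bar>wid 0 \<omega>\<bar> \<le> 1"
  using AE_X_0_unit
proof eventually_elim
  case (elim \<omega>)
  then have "0 \<le> X 0 \<omega> $ 1 \<and> X 0 \<omega> $ 1 \<le> 1" "0 \<le> X 0 \<omega> $ 2 \<and> X 0 \<omega> $ 2 \<le> 1"
    by auto
  then show ?case unfolding mean_pts_2 diam_pts_2 core_nth by (auto simp: abs_le_iff)
qed

section \<open>Almost sure convergence of the core\<close>

lemma nn_integral_wid: "(\<integral>\<^sup>+\<omega>. ennreal (wid t \<omega>) \<partial>M) \<le> ennreal (1 * (1/2) ^ t)"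
proof (induction t)
  case 0
  have "(\<integral>\<^sup>+\<omega>. ennreal (wid 0 \<omega>) \<partial>M) \<le> (\<integral>\<^sup>+\<omega>. 1 \<partial>M)"
    using AE_mid_wid_0 by (intro nn_integral_mono_AE) auto
  then show ?case by (simp add: emeasure_space_1)
next
  case (Suc t)
  have "(\<integral>\<^sup>+\<omega>. ennreal (wid (Suc t) \<omega>) \<partial>M) = (\<integral>\<^sup>+\<omega>. \<integral>\<^sup>+x. ennreal (wid t \<omega> * scale_coeff (snd x) (fst x)) \<partial>draw_law \<partial>M)"
    using nn_integral_step[of "\<lambda>z z'. ennreal (snd z')" t]
    by (simp add: core_data_def step_map_def split_beta' borel_prod[symmetric])
  also have "\<dots> \<le> (\<integral>\<^sup>+\<omega>. \<integral>\<^sup>+x. ennreal (wid t \<omega>) * ennreal (fst x) \<partial>draw_law \<partial>M)"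
  proof (rule nn_integral_mono, rule nn_integral_mono_AE)
    fix \<omega>
    show "AE x in draw_law. ennreal (wid t \<omega> * scale_coeff (snd x) (fst x)) \<le> ennreal (wid t \<omega>) * ennreal (fst x)"
      using AE_draw_law_mem
    proof eventually_elim
      case (elim x)
      then show ?case
        using scale_coeff_bounds[of "fst x" "snd x"] wid_nonneg[of t \<omega>]
        by (auto simp: ennreal_mult[symmetric] intro!: ennreal_leI mult_left_mono)
    qed
  qed
  also have "\<dots> = (\<integral>\<^sup>+\<omega>. ennreal (wid t \<omega>) \<partial>M) * ennreal (1/2)"
    using nn_integral_draw_law_fst[of ennreal] by (simp add: nn_integral_cmult nn_integral_multc nn_integral_U01_id)
  also have "\<dots> \<le> ennreal (1 * (1/2) ^ t) * ennreal (1/2)"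
    by (intro mult_right_mono Suc) auto
  also have "\<dots> = ennreal (1 * (1/2) ^ Suc t)"
    by (subst ennreal_mult[symmetric]) auto
  finally show ?case .
qed

lemma AE_summable_wid: "AE \<omega> in M. summable (\<lambda>t. wid t \<omega>)"
  by (rule AE_summable_geometric[OF _ _ nn_integral_wid]) (auto simp: wid_nonneg)

text \<open>The midpoint moves by \<open>d B\<close> with \<open>\<bar>B\<bar> \<le> 1\<close>. As
  \<open>step_map\<close> describes the step only in law, it is the probability of a violation that
  is shown to vanish.\<close>

lemma AE_mid_diff_le: "AE \<omega> in M. \<bar>mid (Suc t) \<omega> - mid t \<omega>\<bar> \<le> wid t \<omega>"
proof -
  define f :: "real \<times> real \<Rightarrow> real \<times> real \<Rightarrow> ennreal" where
    "f z z' = (if \<bar>fst z' - fst z\<bar> \<le> snd z then 0 else 1)" for z z'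
  have "case_prod f \<in> borel_measurable (borel \<Otimes>\<^sub>M borel)"
    unfolding f_def split_beta' borel_prod[symmetric] by measurable
  then have "(\<integral>\<^sup>+\<omega>. f (core_data (X t \<omega>)) (core_data (X (Suc t) \<omega>)) \<partial>M) =
      (\<integral>\<^sup>+\<omega>. \<integral>\<^sup>+x. f (core_data (X t \<omega>)) (step_map (core_data (X t \<omega>)) x) \<partial>draw_law \<partial>M)"
    by (rule nn_integral_step)
  also have "\<dots> = (\<integral>\<^sup>+\<omega>. \<integral>\<^sup>+x. 0 \<partial>draw_law \<partial>M)"
  proof (rule nn_integral_cong, rule nn_integral_cong_AE)
    fix \<omega>
    show "AE x in draw_law. f (core_data (X t \<omega>)) (step_map (core_data (X t \<omega>)) x) = 0"
      using AE_draw_law_mem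
    proof eventually_elim
      case (elim x)
      have "wid t \<omega> * \<bar>shift_coeff (snd x) (fst x)\<bar> \<le> wid t \<omega> * 1"
        using elim by (intro mult_left_mono shift_coeff_bound wid_nonneg) auto
      then show ?case
        using wid_nonneg[of t \<omega>] by (simp add: f_def core_data_def step_map_def abs_mult)
    qed
  qed
  finally have "(\<integral>\<^sup>+\<omega>. f (core_data (X t \<omega>)) (core_data (X (Suc t) \<omega>)) \<partial>M) = 0" by simp
  then have "AE \<omega> in M. f (core_data (X t \<omega>)) (core_data (X (Suc t) \<omega>)) = 0"
    by (subst (asm) nn_integral_0_iff_AE) (auto simp: f_def core_data_def)
  then show ?thesis
    by eventually_elim (auto simp: f_def core_data_def split: if_splits)
qed

definition limit_point :: "'a \<Rightarrow> real" where
  "limit_point \<omega> = lim (\<lambda>t. mid t \<omega>)"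

lemma measurable_limit_point [measurable]: "limit_point \<in> borel_measurable M"
  unfolding limit_point_def by measurable

lemma AE_wid_tendsto: "AE \<omega> in M. (\<lambda>t. wid t \<omega>) \<longlonglongrightarrow> 0"
  using AE_summable_wid by eventually_elim (rule summable_LIMSEQ_zero)

lemma AE_mid_tendsto: "AE \<omega> in M. (\<lambda>t. mid t \<omega>) \<longlonglongrightarrow> limit_point \<omega>"
proof -
  have "AE \<omega> in M. \<forall>t. \<bar>mid (Suc t) \<omega> - mid t \<omega>\<bar> \<le> wid t \<omega>"
    using AE_mid_diff_le by (subst AE_all_countable) blast
  then show ?thesis using AE_summable_wid
  proof eventually_elim
    case (elim \<omega>)
    have "summable (\<lambda>t. mid (Suc t) \<omega> - mid t \<omega>)"
      by (rule summable_comparison_test'[OF elim(2)]) (use elim(1) in auto)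
    then have "convergent (\<lambda>n. \<Sum>t<n. mid (Suc t) \<omega> - mid t \<omega>)"
      by (simp only: summable_iff_convergent)
    then have "convergent (\<lambda>n. mid n \<omega> - mid 0 \<omega>)"
      by (simp only: sum_lessThan_telescope[of "\<lambda>t. mid t \<omega>"])
    then have "convergent (\<lambda>n. (mid n \<omega> - mid 0 \<omega>) + mid 0 \<omega>)"
      by (intro convergent_add convergent_const)
    then have "convergent (\<lambda>n. mid n \<omega>)"
      by simp
    then show ?case unfolding limit_point_def by (rule convergent_LIMSEQ_iff[THEN iffD1])
  qed
qed

lemma AE_core_tendsto: "AE \<omega> in M. (\<lambda>t. core (X t \<omega>)) \<longlonglongrightarrow> vector [limit_point \<omega>, limit_point \<omega>]"
  using AE_mid_tendsto AE_wid_tendsto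
proof eventually_elim
  case (elim \<omega>)
  have lim: "(\<lambda>t. x t) \<longlonglongrightarrow> limit_point \<omega>" if le: "\<And>t. \<bar>x t - mid t \<omega>\<bar> \<le> wid t \<omega>" for x :: "nat \<Rightarrow> real"
  proof -
    have "(\<lambda>t. x t - mid t \<omega>) \<longlonglongrightarrow> 0"
      by (rule Lim_null_comparison[OF _ elim(2)]) (simp add: le)
    from tendsto_add[OF this elim(1)] show ?thesis by simp
  qed
  show ?case
  proof (rule vec_tendstoI)
    fix i :: 2
    have "\<bar>core (X t \<omega>) $ 1 - mid t \<omega>\<bar> \<le> wid t \<omega>" "\<bar>core (X t \<omega>) $ 2 - mid t \<omega>\<bar> \<le> wid t \<omega>" for t
      unfolding mean_pts_2 diam_pts_2 by (auto simp: abs_if field_simps)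
    from this[THEN lim]
    have "(\<lambda>t. core (X t \<omega>) $ 1) \<longlonglongrightarrow> limit_point \<omega>" "(\<lambda>t. core (X t \<omega>) $ 2) \<longlonglongrightarrow> limit_point \<omega>"
      by this
    then show "(\<lambda>t. core (X t \<omega>) $ i) \<longlonglongrightarrow> vector [limit_point \<omega>, limit_point \<omega>] $ i"
      using exhaust_2[of i] by (elim disjE) simp_all
  qed
qed

section \<open>The law of the limit\<close>

text \<open>One step turns \<open>m + d l\<close> into
  \<open>(m + d B) + d A l = m + d (B + A l)\<close>, and for \<open>l\<close> with law
  \<open>L_law\<close> and an independent draw the bracket again has law
  \<open>L_law\<close>.\<close>

lemma nn_integral_mid_wid_invariant:
  assumes [measurable]: "h \<in> borel_measurable borel"
  shows "(\<integral>\<^sup>+\<omega>. \<integral>\<^sup>+l. h (mid t \<omega> + wid t \<omega> * l) \<partial>L_law \<partial>M) = (\<integral>\<^sup>+\<omega>. \<integral>\<^sup>+l. h (mid 0 \<omega> + wid 0 \<omega> * l) \<partial>L_law \<partial>M)"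
proof (induction t)
  case (Suc t)
  define f :: "real \<times> real \<Rightarrow> real \<times> real \<Rightarrow> ennreal" where
    "f z z' = (\<integral>\<^sup>+l. h (fst z' + snd z' * l) \<partial>L_law)" for z z'
  have f: "case_prod f \<in> borel_measurable (borel \<Otimes>\<^sub>M borel)"
    unfolding f_def split_beta' borel_prod[symmetric] by measurable
  have "(\<integral>\<^sup>+\<omega>. \<integral>\<^sup>+l. h (mid (Suc t) \<omega> + wid (Suc t) \<omega> * l) \<partial>L_law \<partial>M) =
      (\<integral>\<^sup>+\<omega>. \<integral>\<^sup>+x. \<integral>\<^sup>+l. h (mid t \<omega> + wid t \<omega> * branch (snd x) (fst x) l) \<partial>L_law \<partial>draw_law \<partial>M)"
    using nn_integral_step[OF f, of t]
    by (simp add: f_def core_data_def step_map_def branch_affine algebra_simps)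
  also have "\<dots> = (\<integral>\<^sup>+\<omega>. \<integral>\<^sup>+l. h (mid t \<omega> + wid t \<omega> * l) \<partial>L_law \<partial>M)"
    by (intro nn_integral_cong fixed_point_law_nn_integral[OF fixed_point_L_law, symmetric]) measurable
  finally show ?case using Suc by simp
qed simp

definition limit_law :: "real measure" where
  "limit_law = distr (distr M (borel \<Otimes>\<^sub>M borel) (\<lambda>\<omega>. (mid 0 \<omega>, wid 0 \<omega>)) \<Otimes>\<^sub>M L_law) borel (\<lambda>((m, d), l). m + d * l)"

text \<open>The invariance in the form used for the limit: the law on the left does not involve
  \<open>t\<close>, so \<open>t\<close> may be chosen freely on the right.\<close>

lemma limit_law_eq: "limit_law = distr (M \<Otimes>\<^sub>M L_law) borel (\<lambda>(\<omega>, l). mid t \<omega> + wid t \<omega> * l)"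
proof (rule measure_eqI)
  show "sets limit_law = sets (distr (M \<Otimes>\<^sub>M L_law) borel (\<lambda>(\<omega>, l). mid t \<omega> + wid t \<omega> * l))"
    by (simp add: limit_law_def)
  fix A assume "A \<in> sets limit_law"
  then have [measurable]: "A \<in> sets borel" by (simp add: limit_law_def)
  have "emeasure limit_law A = (\<integral>\<^sup>+x. indicator A x \<partial>limit_law)"
    by (simp add: limit_law_def)
  also have "\<dots> = (\<integral>\<^sup>+z. indicator A (fst (fst z) + snd (fst z) * snd z) \<partial>(distr M (borel \<Otimes>\<^sub>M borel) (\<lambda>\<omega>. (mid 0 \<omega>, wid 0 \<omega>)) \<Otimes>\<^sub>M L_law))"
    unfolding limit_law_def by (subst nn_integral_distr) (auto simp: split_beta')
  also have "\<dots> = (\<integral>\<^sup>+z. \<integral>\<^sup>+l. indicator A (fst z + snd z * l) \<partial>L_law \<partial>distr M (borel \<Otimes>\<^sub>M borel) (\<lambda>\<omega>. (mid 0 \<omega>, wid 0 \<omega>)))"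
    by (subst L.nn_integral_fst[symmetric]) auto
  also have "\<dots> = (\<integral>\<^sup>+\<omega>. \<integral>\<^sup>+l. indicator A (mid 0 \<omega> + wid 0 \<omega> * l) \<partial>L_law \<partial>M)"
    by (subst nn_integral_distr) auto
  also have "\<dots> = (\<integral>\<^sup>+\<omega>. \<integral>\<^sup>+l. indicator A (mid t \<omega> + wid t \<omega> * l) \<partial>L_law \<partial>M)"
    by (rule nn_integral_mid_wid_invariant[symmetric]) measurable
  also have "\<dots> = (\<integral>\<^sup>+z. indicator A (mid t (fst z) + wid t (fst z) * snd z) \<partial>(M \<Otimes>\<^sub>M L_law))"
    by (subst L.nn_integral_fst[symmetric]) auto
  also have "\<dots> = (\<integral>\<^sup>+x. indicator A x \<partial>distr (M \<Otimes>\<^sub>M L_law) borel (\<lambda>(\<omega>, l). mid t \<omega> + wid t \<omega> * l))"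
    by (subst nn_integral_distr) (auto simp: split_beta')
  finally show "emeasure limit_law A = emeasure (distr (M \<Otimes>\<^sub>M L_law) borel (\<lambda>(\<omega>, l). mid t \<omega> + wid t \<omega> * l)) A"
    by simp
qed

lemma distr_limit_point: "distr M borel limit_point = limit_law"
proof (rule Levy_uniqueness)
  interpret PL: pair_prob_space M L_law
    by unfold_locales
  show "real_distribution (distr M borel limit_point)"
    by (rule real_distribution_distr) measurable
  show "real_distribution limit_law"
    unfolding limit_law_eq[of 0] by (rule PL.P.real_distribution_distr) (auto simp: split_beta')
  show "char (distr M borel limit_point) = char limit_law"
  proof
    fix s
    have eq: "char limit_law s = (CLINT z|M \<Otimes>\<^sub>M L_law. iexp (s * (mid t (fst z) + wid t (fst z) * snd z)))" for t
      unfolding char_def limit_law_eq[of t] by (subst integral_distr) (auto simp: split_beta')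
    have lim: "AE z in M \<Otimes>\<^sub>M L_law. (\<lambda>t. iexp (s * (mid t (fst z) + wid t (fst z) * snd z))) \<longlonglongrightarrow> iexp (s * limit_point (fst z))"
    proof -
      have "AE z in M \<Otimes>\<^sub>M L_law. (\<lambda>t. mid t (fst z)) \<longlonglongrightarrow> limit_point (fst z) \<and> (\<lambda>t. wid t (fst z)) \<longlonglongrightarrow> 0"
      proof (rule AE_distrD[of fst "M \<Otimes>\<^sub>M L_law" M])
        show "AE \<omega> in distr (M \<Otimes>\<^sub>M L_law) M fst. (\<lambda>t. mid t \<omega>) \<longlonglongrightarrow> limit_point \<omega> \<and> (\<lambda>t. wid t \<omega>) \<longlonglongrightarrow> 0"
          unfolding L.distr_pair_fst using AE_mid_tendsto AE_wid_tendsto by eventually_elim blast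
      qed measurable
      then show ?thesis
      proof eventually_elim
        case (elim z)
        then have "(\<lambda>t. iexp (s * (mid t (fst z) + wid t (fst z) * snd z))) \<longlonglongrightarrow> iexp (s * (limit_point (fst z) + 0 * snd z))"
          by (intro tendsto_intros) auto
        then show ?case by simp
      qed
    qed
    have "(\<lambda>t. CLINT z|M \<Otimes>\<^sub>M L_law. iexp (s * (mid t (fst z) + wid t (fst z) * snd z))) \<longlonglongrightarrow> (CLINT z|M \<Otimes>\<^sub>M L_law. iexp (s * limit_point (fst z)))"
      by (rule integral_dominated_convergence[OF _ _ _ lim, where w = "\<lambda>_. 1"]) auto
    \<comment> \<open>All terms of the sequence equal the one value \<open>char limit_law s\<close>,
      so the limit of the integrals is that value.\<close>
    then have "(\<lambda>t. char limit_law s) \<longlonglongrightarrow> (CLINT z|M \<Otimes>\<^sub>M L_law. iexp (s * limit_point (fst z)))"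
      by (simp only: eq[symmetric])
    then have "char limit_law s = (CLINT z|M \<Otimes>\<^sub>M L_law. iexp (s * limit_point (fst z)))"
      by (simp add: LIMSEQ_const_iff)
    also have "\<dots> = (CLINT \<omega>|M. CLINT l|L_law. iexp (s * limit_point \<omega>))"
      by (subst PL.integral_fst'[symmetric]) (auto intro!: PL.P.integrable_const_bound[where B = 1])
    also have "\<dots> = char (distr M borel limit_point) s"
      unfolding char_def by (subst integral_distr) (auto simp: L.prob_space[simplified])
    finally show "char (distr M borel limit_point) s = char limit_law s" ..
  qed
qed

end

section \<open>Moments of the limit\<close>

lemma (in pair_sigma_finite) has_bochner_integral_times:
  fixes f :: "'a \<Rightarrow> real" and g :: "'b \<Rightarrow> real"
  assumes f: "integrable M1 f" and g: "integrable M2 g"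
  shows "has_bochner_integral (M1 \<Otimes>\<^sub>M M2) (\<lambda>z. f (fst z) * g (snd z)) ((\<integral>x. f x \<partial>M1) * (\<integral>y. g y \<partial>M2))"
proof -
  note [measurable] = borel_measurable_integrable[OF f] borel_measurable_integrable[OF g]
  have int: "integrable (M1 \<Otimes>\<^sub>M M2) (\<lambda>z. f (fst z) * g (snd z))"
    using f g by (intro Fubini_integrable) (auto simp: abs_mult)
  moreover have "(\<integral>z. f (fst z) * g (snd z) \<partial>(M1 \<Otimes>\<^sub>M M2)) = (\<integral>x. \<integral>y. f x * g y \<partial>M2 \<partial>M1)"
    using integral_fst'[OF int] by simp
  ultimately show ?thesis
    by (simp add: has_bochner_integral_iff)
qed

lemma choose_3_2: "3 choose 2 = (3::nat)"
  by (simp add: eval_nat_numeral)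

text \<open>The \<open>k\<close>-th moment of the limit conditionally on the initial midpoint
  \<open>m\<close> and width \<open>d\<close>.\<close>

definition affine_moment :: "nat \<Rightarrow> real \<Rightarrow> real \<Rightarrow> real" where
  "affine_moment k m d = (\<integral>l. (m + d * l) ^ k \<partial>L_law)"

text \<open>Only even powers of \<open>d\<close> survive. The coefficients are binomial coefficients
  times moments: \<open>7/4 = 3 * 7/12\<close> and \<open>7/2 = 6 * 7/12\<close>.\<close>

lemma affine_moment_eq:
  "affine_moment 1 m d = m"
  "affine_moment 2 m d = m ^ 2 + 7 / 12 * d ^ 2"
  "affine_moment 3 m d = m ^ 3 + 7 / 4 * (m * d ^ 2)"
  "affine_moment 4 m d = m ^ 4 + 7 / 2 * (m ^ 2 * d ^ 2) + 375 / 368 * d ^ 4"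
  unfolding affine_moment_def L_law_affine_moment
  by (simp_all add: sum_atMost_numeral L_law_moments L_law_moment_2 L_law_moment_4 choose_3_2 mult_ac)

context modified_process
begin

lemma integrable_mid_wid: "integrable M (\<lambda>\<omega>. mid 0 \<omega> ^ i * wid 0 \<omega> ^ j)"
proof (rule integrable_const_bound[where B = 1])
  show "AE \<omega> in M. norm (mid 0 \<omega> ^ i * wid 0 \<omega> ^ j) \<le> 1"
    using AE_mid_wid_0
    by eventually_elim (simp add: abs_mult power_abs mult_le_one power_le_one)
qed measurable

text \<open>The binomial expansion of \<open>(m + d l) ^ k\<close> consists of products of a
  function of the process and a power of \<open>l\<close>, whose integrals factor on the product
  space. Integrability holds as \<open>\<bar>m\<bar>\<close> and \<open>d\<close> are at most 1 and
  \<open>L_law\<close> has all moments.\<close>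

lemma limit_point_moment:
  "has_bochner_integral M (\<lambda>\<omega>. limit_point \<omega> ^ k) (\<integral>\<omega>. affine_moment k (mid 0 \<omega>) (wid 0 \<omega>) \<partial>M)"
proof -
  interpret PL: pair_prob_space M L_law
    by unfold_locales
  let ?t = "\<lambda>j. real (k choose j)"
  have am: "affine_moment k m d = (\<Sum>j\<le>k. ?t j * ((m ^ (k - j) * d ^ j) * (\<integral>l. l ^ j \<partial>L_law)))" for m d
    unfolding affine_moment_def L_law_affine_moment by (simp add: mult_ac)
  have "has_bochner_integral (M \<Otimes>\<^sub>M L_law)
      (\<lambda>z. \<Sum>j\<le>k. ?t j * ((mid 0 (fst z) ^ (k - j) * wid 0 (fst z) ^ j) * snd z ^ j))
      (\<Sum>j\<le>k. ?t j * ((\<integral>\<omega>. mid 0 \<omega> ^ (k - j) * wid 0 \<omega> ^ j \<partial>M) * (\<integral>l. l ^ j \<partial>L_law)))"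
    by (intro has_bochner_integral_sum has_bochner_integral_mult_right
        PL.has_bochner_integral_times[where f = "\<lambda>\<omega>. mid 0 \<omega> ^ _ * wid 0 \<omega> ^ _"] integrable_mid_wid integrable_L_law_power)
  also have "(\<lambda>z. \<Sum>j\<le>k. ?t j * ((mid 0 (fst z) ^ (k - j) * wid 0 (fst z) ^ j) * snd z ^ j)) =
      (\<lambda>z. (mid 0 (fst z) + wid 0 (fst z) * snd z) ^ k)"
    unfolding add.commute[of "mid 0 _"] binomial_ring by (simp add: power_mult_distrib mult_ac)
  also have "(\<Sum>j\<le>k. ?t j * ((\<integral>\<omega>. mid 0 \<omega> ^ (k - j) * wid 0 \<omega> ^ j \<partial>M) * (\<integral>l. l ^ j \<partial>L_law))) =
      (\<integral>\<omega>. affine_moment k (mid 0 \<omega>) (wid 0 \<omega>) \<partial>M)"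
    unfolding am
    by (subst Bochner_Integration.integral_sum)
      (auto intro!: integrable_mult_right integrable_mult_left integrable_mid_wid)
  finally have "has_bochner_integral (distr (M \<Otimes>\<^sub>M L_law) borel (\<lambda>(\<omega>, l). mid 0 \<omega> + wid 0 \<omega> * l)) (\<lambda>x. x ^ k)
      (\<integral>\<omega>. affine_moment k (mid 0 \<omega>) (wid 0 \<omega>) \<partial>M)"
    unfolding has_bochner_integral_iff by (subst integrable_distr_eq integral_distr; simp add: split_beta')+
  then have "has_bochner_integral (distr M borel limit_point) (\<lambda>x. x ^ k)
      (\<integral>\<omega>. affine_moment k (mid 0 \<omega>) (wid 0 \<omega>) \<partial>M)"
    unfolding distr_limit_point limit_law_eq[of 0] .
  then show ?thesis
    unfolding has_bochner_integral_iff by (simp add: integrable_distr_eq integral_distr)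
qed

lemma limit_point_moments:
  "has_bochner_integral M limit_point (\<integral>\<omega>. mid 0 \<omega> \<partial>M)"
  "has_bochner_integral M (\<lambda>\<omega>. limit_point \<omega> ^ 2)
     ((\<integral>\<omega>. mid 0 \<omega> ^ 2 \<partial>M) + 7 / 12 * (\<integral>\<omega>. wid 0 \<omega> ^ 2 \<partial>M))"
  "has_bochner_integral M (\<lambda>\<omega>. limit_point \<omega> ^ 3)
     ((\<integral>\<omega>. mid 0 \<omega> ^ 3 \<partial>M) + 7 / 4 * (\<integral>\<omega>. mid 0 \<omega> * wid 0 \<omega> ^ 2 \<partial>M))"
proof -
  have int: "integrable M (\<lambda>\<omega>. mid 0 \<omega> ^ 2)" "integrable M (\<lambda>\<omega>. wid 0 \<omega> ^ 2)"
    "integrable M (\<lambda>\<omega>. mid 0 \<omega> ^ 3)" "integrable M (\<lambda>\<omega>. mid 0 \<omega> * wid 0 \<omega> ^ 2)"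
    using integrable_mid_wid[of 2 0] integrable_mid_wid[of 0 2] integrable_mid_wid[of 3 0] integrable_mid_wid[of 1 2]
    by simp_all
  show "has_bochner_integral M limit_point (\<integral>\<omega>. mid 0 \<omega> \<partial>M)"
    using limit_point_moment[of 1] unfolding affine_moment_eq by simp
  show "has_bochner_integral M (\<lambda>\<omega>. limit_point \<omega> ^ 2)
     ((\<integral>\<omega>. mid 0 \<omega> ^ 2 \<partial>M) + 7 / 12 * (\<integral>\<omega>. wid 0 \<omega> ^ 2 \<partial>M))"
    using limit_point_moment[of 2] int unfolding affine_moment_eq by simp
  show "has_bochner_integral M (\<lambda>\<omega>. limit_point \<omega> ^ 3)
     ((\<integral>\<omega>. mid 0 \<omega> ^ 3 \<partial>M) + 7 / 4 * (\<integral>\<omega>. mid 0 \<omega> * wid 0 \<omega> ^ 2 \<partial>M))"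
    using limit_point_moment[of 3] int unfolding affine_moment_eq by simp
qed

text \<open>The law of \<open>X 0\<close> is accessible through nonnegative integrals. Initial
  points in the unit interval have a nonnegative midpoint, so the integrand is nonnegative where it
  matters.\<close>

lemma limit_point_moment_nn:
  assumes meas: "case_prod (affine_moment k) \<in> borel_measurable (borel \<Otimes>\<^sub>M borel)"
    and nonneg: "\<And>m d. 0 \<le> m \<Longrightarrow> 0 \<le> d \<Longrightarrow> 0 \<le> affine_moment k m d"
    and v: "(\<integral>\<^sup>+\<omega>. ennreal (case_prod (affine_moment k) (core_data (X 0 \<omega>))) \<partial>M) = ennreal v" "0 \<le> v"
  shows "has_bochner_integral M (\<lambda>\<omega>. limit_point \<omega> ^ k) v"
proof -
  have "has_bochner_integral M (\<lambda>\<omega>. affine_moment k (mid 0 \<omega>) (wid 0 \<omega>)) v"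
  proof (rule has_bochner_integral_nn_integral)
    show "(\<lambda>\<omega>. affine_moment k (mid 0 \<omega>) (wid 0 \<omega>)) \<in> borel_measurable M"
      using measurable_compose[OF measurable_Pair[OF measurable_mid[of 0] measurable_wid[of 0]] meas] by simp
    show "AE \<omega> in M. 0 \<le> affine_moment k (mid 0 \<omega>) (wid 0 \<omega>)"
      using AE_X_0_unit
    proof eventually_elim
      case (elim \<omega>)
      then have "0 \<le> X 0 \<omega> $ 1" "0 \<le> X 0 \<omega> $ 2" by auto
      then have "0 \<le> mid 0 \<omega>" unfolding mean_pts_2 core_nth by simp
      then show ?case by (intro nonneg wid_nonneg)
    qed
  qed (use v in \<open>auto simp: core_data_def\<close>)
  then show ?thesis
    using limit_point_moment[of k] by (simp add: has_bochner_integral_iff)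
qed

lemma nn_integral_init_core_data:
  assumes [measurable]: "h \<in> borel_measurable borel"
  shows "(\<integral>\<^sup>+\<omega>. h (core_data (X 0 \<omega>)) \<partial>M) = (\<integral>\<^sup>+\<omega>. \<integral>\<^sup>+y. h (core_data y) \<partial>measure_pmf (ord_pmf (P \<omega>)) \<partial>M)"
  by (rule nn_integral_init) (unfold split_beta', measurable)

end

lemma measurable_affine_moment:
  assumes "k \<in> {1, 2, 3, 4}"
  shows "case_prod (affine_moment k) \<in> borel_measurable (borel \<Otimes>\<^sub>M borel)"
  using assms by (elim insertE emptyE) (simp_all only: affine_moment_eq split_beta', measurable)

lemma affine_moment_nonneg:
  assumes "k \<in> {1, 2, 3, 4}" "0 \<le> m" "0 \<le> d"
  shows "0 \<le> affine_moment k m d"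
  using assms by (elim insertE emptyE) (simp_all only: affine_moment_eq, auto)

section \<open>The initial points 1/4, 1/2, 3/4\<close>

definition tie_config :: "real ^ 3" where
  "tie_config = vector [1/4, 1/2, 3/4]"

text \<open>The mean 1/2 is itself one of the points and comes first; the other two are equally far
  from it and may follow in either order.\<close>

lemma admissible_orders_tie_config:
  "admissible_orders tie_config =
    {\<lambda>i. if i = 1 then 2 else if i = 2 then 1 else 3, \<lambda>i. if i = 1 then 2 else if i = 2 then 3 else 1}"
  (is "_ = {?a, ?b}")
proof (intro equalityI subsetI)
  fix \<pi> assume "\<pi> \<in> admissible_orders tie_config"
  then have perm: "\<pi> permutes UNIV" and le: "\<bar>tie_config $ \<pi> 1 - 1/2\<bar> \<le> \<bar>tie_config $ \<pi> 2 - 1/2\<bar>"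
    "\<bar>tie_config $ \<pi> 2 - 1/2\<bar> \<le> \<bar>tie_config $ \<pi> 3 - 1/2\<bar>"
    by (auto simp: admissible_orders_def mean_pts_3 tie_config_def)
  have "\<pi> 1 = 2 \<and> (\<pi> 2 = 1 \<and> \<pi> 3 = 3 \<or> \<pi> 2 = 3 \<and> \<pi> 3 = 1)"
    using permutes_UNIV_3_cases[OF perm] le by (elim disjE) (simp_all add: tie_config_def)
  then show "\<pi> \<in> {?a, ?b}"
    by (simp add: fun_eq_iff forall_3)
next
  fix \<pi> assume "\<pi> \<in> {?a, ?b}"
  then show "\<pi> \<in> admissible_orders tie_config"
    by (elim insertE emptyE) (simp_all add: admissible_orders_def permutes_UNIV_3 mean_pts_3 tie_config_def)
qed

lemma nn_integral_ord_pmf_tie_config: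
  "(\<integral>\<^sup>+y. h (core_data y) \<partial>measure_pmf (ord_pmf tie_config)) = (h (3/8, 1/4) + h (5/8, 1/4)) / 2"
proof -
  let ?a = "\<lambda>i::3. if i = 1 then 2 else if i = 2 then 1 else 3 :: 3"
  let ?b = "\<lambda>i::3. if i = 1 then 2 else if i = 2 then 3 else 1 :: 3"
  have "?a \<noteq> ?b" by (simp add: fun_eq_iff exI[of _ 2])
  moreover have "core_data (reorder tie_config ?a) = (3/8, 1/4)" "core_data (reorder tie_config ?b) = (5/8, 1/4)"
    unfolding core_data_eq by (simp_all add: tie_config_def)
  ultimately show ?thesis
    unfolding nn_integral_ord_pmf admissible_orders_tie_config by simp
qed

context modified_process
begin

lemma tie_config_moment:
  assumes P: "AE \<omega> in M. P \<omega> = vector [1/4, 1/2, 3/4]" and k: "k \<in> {1, 2, 3, 4}"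
  shows "has_bochner_integral M (\<lambda>\<omega>. limit_point \<omega> ^ k) ((affine_moment k (3/8) (1/4) + affine_moment k (5/8) (1/4)) / 2)"
proof (rule limit_point_moment_nn[OF measurable_affine_moment affine_moment_nonneg])
  let ?h = "\<lambda>z. ennreal (case_prod (affine_moment k) z)"
  note [measurable] = measurable_affine_moment[OF k, unfolded borel_prod]
  have "(\<integral>\<^sup>+\<omega>. ?h (core_data (X 0 \<omega>)) \<partial>M) = (\<integral>\<^sup>+\<omega>. \<integral>\<^sup>+y. ?h (core_data y) \<partial>measure_pmf (ord_pmf (P \<omega>)) \<partial>M)"
    by (rule nn_integral_init_core_data) measurable
  also have "\<dots> = (\<integral>\<^sup>+\<omega>. (?h (3/8, 1/4) + ?h (5/8, 1/4)) / 2 \<partial>M)"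
    using P
  proof (intro nn_integral_cong_AE, eventually_elim)
    case (elim \<omega>)
    then show ?case
      using nn_integral_ord_pmf_tie_config[of ?h] by (simp add: tie_config_def)
  qed
  also have "\<dots> = ennreal (affine_moment k (3/8) (1/4) + affine_moment k (5/8) (1/4)) / 2"
    using affine_moment_nonneg[OF k] by (simp add: emeasure_space_1 flip: ennreal_plus)
  also have "\<dots> = ennreal ((affine_moment k (3/8) (1/4) + affine_moment k (5/8) (1/4)) / 2)"
    using affine_moment_nonneg[OF k] divide_ennreal[of "affine_moment k (3/8) (1/4) + affine_moment k (5/8) (1/4)" 2]
    by (simp del: ennreal_plus)
  finally show "(\<integral>\<^sup>+\<omega>. ?h (core_data (X 0 \<omega>)) \<partial>M) = ennreal ((affine_moment k (3/8) (1/4) + affine_moment k (5/8) (1/4)) / 2)" .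
qed (use k affine_moment_nonneg[OF k] in auto)

lemma tie_config_moments:
  assumes "AE \<omega> in M. P \<omega> = vector [1/4, 1/2, 3/4]"
  shows "has_bochner_integral M limit_point (1 / 2)"
    "has_bochner_integral M (\<lambda>\<omega>. limit_point \<omega> ^ 2) (29 / 96)"
    "has_bochner_integral M (\<lambda>\<omega>. limit_point \<omega> ^ 3) (13 / 64)"
    "has_bochner_integral M (\<lambda>\<omega>. limit_point \<omega> ^ 4) (873 / 5888)"
  using tie_config_moment[OF assms, of 1] tie_config_moment[OF assms, of 2]
    tie_config_moment[OF assms, of 3] tie_config_moment[OF assms, of 4]
  unfolding affine_moment_eq by (simp_all add: power_divide)

end

section \<open>Uniform initial points\<close>

text \<open>Two applications of the fundamental theorem, with \<open>G y\<close> for the inner and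
  \<open>K\<close> for the outer integral.\<close>

lemma nn_integral_double_FTC:
  fixes f G :: "real \<Rightarrow> real \<Rightarrow> real" and a b K :: "real \<Rightarrow> real"
  assumes [measurable]: "\<And>y. f y \<in> borel_measurable borel"
    and G: "\<And>y x. (G y has_real_derivative f y x) (at x)"
    and ab: "\<And>y. 0 \<le> y \<Longrightarrow> y \<le> 1 \<Longrightarrow> a y \<le> b y"
    and nonneg: "\<And>y x. 0 \<le> y \<Longrightarrow> y \<le> 1 \<Longrightarrow> a y \<le> x \<Longrightarrow> x \<le> b y \<Longrightarrow> 0 \<le> f y x"
    and K: "\<And>y. (K has_real_derivative G y (b y) - G y (a y)) (at y)"
    and meas: "(\<lambda>y. G y (b y) - G y (a y)) \<in> borel_measurable borel"
  shows "(\<integral>\<^sup>+y. \<integral>\<^sup>+x. ennreal (f y x) * indicator {a y..b y} x \<partial>lborel \<partial>U01) = ennreal (K 1 - K 0)"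
proof -
  have inner: "(\<integral>\<^sup>+x. ennreal (f y x) * indicator {a y..b y} x \<partial>lborel) = ennreal (G y (b y) - G y (a y))"
    "0 \<le> G y (b y) - G y (a y)" if y: "0 \<le> y" "y \<le> 1" for y
  proof -
    show "(\<integral>\<^sup>+x. ennreal (f y x) * indicator {a y..b y} x \<partial>lborel) = ennreal (G y (b y) - G y (a y))"
      using y nonneg ab by (intro nn_integral_FTC_Icc G) auto
    \<comment> \<open>The outer application needs a nonnegative integrand. The inner value is
      nonnegative because it is the integral of a nonnegative function.\<close>
    have "(\<integral>x. f y x * indicator {a y..b y} x \<partial>lborel) = G y (b y) - G y (a y)"
      using y nonneg ab by (intro integral_FTC_Icc_nonneg G) auto
    moreover have "0 \<le> (\<integral>x. f y x * indicator {a y..b y} x \<partial>lborel)"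
      using y nonneg by (intro integral_nonneg_AE AE_I2) (auto simp: indicator_def)
    ultimately show "0 \<le> G y (b y) - G y (a y)" by simp
  qed
  have "(\<integral>\<^sup>+y. \<integral>\<^sup>+x. ennreal (f y x) * indicator {a y..b y} x \<partial>lborel \<partial>U01) = (\<integral>\<^sup>+y. ennreal (G y (b y) - G y (a y)) \<partial>U01)"
  proof (rule nn_integral_cong_AE)
    show "AE y in U01. (\<integral>\<^sup>+x. ennreal (f y x) * indicator {a y..b y} x \<partial>lborel) = ennreal (G y (b y) - G y (a y))"
      using AE_U01_mem by eventually_elim (simp only: inner)
  qed
  also have "\<dots> = (\<integral>\<^sup>+y. ennreal (G y (b y) - G y (a y)) * indicator {0..1} y \<partial>lborel)"
    by (rule nn_integral_U01[OF measurable_compose[OF meas measurable_ennreal]])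
  also have "\<dots> = ennreal (K 1 - K 0)"
    using inner(2) by (intro nn_integral_FTC_Icc K meas) auto
  finally show ?thesis .
qed

section \<open>The closest pair among three uniform points\<close>

definition closest_ind :: "real \<Rightarrow> real \<Rightarrow> real \<Rightarrow> ennreal" where
  "closest_ind p q r = (if \<bar>p - q\<bar> < \<bar>p - r\<bar> \<and> \<bar>p - q\<bar> < \<bar>q - r\<bar> then 1 else 0)"

lemma measurable_closest_ind [measurable (raw)]:
  assumes [measurable]: "a \<in> borel_measurable M" "b \<in> borel_measurable M" "c \<in> borel_measurable M"
  shows "(\<lambda>x. closest_ind (a x) (b x) (c x)) \<in> borel_measurable M"
  unfolding closest_ind_def by measurable

lemma nn_integral_ord_pmf_no_ties:
  assumes ne: "\<bar>p - q\<bar> \<noteq> \<bar>p - r\<bar>" "\<bar>p - q\<bar> \<noteq> \<bar>q - r\<bar>" "\<bar>p - r\<bar> \<noteq> \<bar>q - r\<bar>"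
  shows "(\<integral>\<^sup>+y. h (core_data y) \<partial>measure_pmf (ord_pmf (vector [p, q, r]))) =
    h ((p + q) / 2, \<bar>p - q\<bar>) * closest_ind p q r + h ((p + r) / 2, \<bar>p - r\<bar>) * closest_ind p r q +
    h ((q + r) / 2, \<bar>q - r\<bar>) * closest_ind q r p"
proof -
  have const: "(\<integral>\<^sup>+y. h (core_data y) \<partial>measure_pmf (ord_pmf (vector [p, q, r]))) = h c"
    if "\<And>\<pi>. \<pi> \<in> admissible_orders (vector [p, q, r]) \<Longrightarrow> core_data (reorder (vector [p, q, r]) \<pi>) = c" for c
  proof -
    have "(\<integral>\<^sup>+y. h (core_data y) \<partial>measure_pmf (ord_pmf (vector [p, q, r]))) = (\<integral>\<^sup>+y. h c \<partial>measure_pmf (ord_pmf (vector [p, q, r])))"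
      using that by (intro nn_integral_cong_AE AE_pmfI) (auto simp: set_ord_pmf)
    then show ?thesis by (simp add: measure_pmf.emeasure_space_1[simplified])
  qed
  note cases = core_data_reorder_cases[where z = "vector [p, q, r]", unfolded vector_3]
  consider "\<bar>p - q\<bar> < \<bar>p - r\<bar>" "\<bar>p - q\<bar> < \<bar>q - r\<bar>" | "\<bar>p - r\<bar> < \<bar>p - q\<bar>" "\<bar>p - r\<bar> < \<bar>q - r\<bar>"
    | "\<bar>q - r\<bar> < \<bar>p - q\<bar>" "\<bar>q - r\<bar> < \<bar>p - r\<bar>"
    using ne by linarith
  then show ?thesis
  proof cases
    case 1
    then have "(\<integral>\<^sup>+y. h (core_data y) \<partial>measure_pmf (ord_pmf (vector [p, q, r]))) = h ((p + q) / 2, \<bar>p - q\<bar>)"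
      using cases by (intro const) (metis linorder_not_le)
    with 1 show ?thesis by (simp add: closest_ind_def abs_minus_commute)
  next
    case 2
    then have "(\<integral>\<^sup>+y. h (core_data y) \<partial>measure_pmf (ord_pmf (vector [p, q, r]))) = h ((p + r) / 2, \<bar>p - r\<bar>)"
      using cases by (intro const) (metis linorder_not_le)
    with 2 show ?thesis by (simp add: closest_ind_def abs_minus_commute)
  next
    case 3
    then have "(\<integral>\<^sup>+y. h (core_data y) \<partial>measure_pmf (ord_pmf (vector [p, q, r]))) = h ((q + r) / 2, \<bar>q - r\<bar>)"
      using cases by (intro const) (metis linorder_not_le)
    with 3 show ?thesis by (simp add: closest_ind_def abs_minus_commute)
  qed
qed

lemma AE_U01_finite:
  assumes "finite A"
  shows "AE u in U01. u \<notin> A"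
proof (rule AE_uniform_measureI)
  have "AE u in lborel. u \<notin> A"
    by (rule AE_not_in[OF finite_imp_null_set_lborel[OF assms]])
  then show "AE u in lborel. u \<in> {0..1} \<longrightarrow> u \<notin> A" by eventually_elim simp
qed simp

interpretation UU: pair_prob_space U01 U01
  by unfold_locales

lemma three_times_ennreal: "x + x + x = 3 * (x :: ennreal)"
proof -
  have "3 * x = (1 + 1 + 1) * x" by simp
  also have "\<dots> = x + x + x" by (simp only: distrib_right mult_1_left)
  finally show ?thesis ..
qed

text \<open>
  By exchangeability each of the three pairs contributes equally.
\<close>

lemma nn_integral_ord_pmf_iid:
  assumes [measurable]: "h \<in> borel_measurable borel"
  shows "(\<integral>\<^sup>+p. \<integral>\<^sup>+q. \<integral>\<^sup>+r. (\<integral>\<^sup>+y. h (core_data y) \<partial>measure_pmf (ord_pmf (vector [p, q, r]))) \<partial>U01 \<partial>U01 \<partial>U01) =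
    3 * (\<integral>\<^sup>+p. \<integral>\<^sup>+q. h ((p + q) / 2, \<bar>p - q\<bar>) * (\<integral>\<^sup>+r. closest_ind p q r \<partial>U01) \<partial>U01 \<partial>U01)"
proof -
  define f where "f p q r = h ((p + q) / 2, \<bar>p - q\<bar>) * closest_ind p q r" for p q r
  have [measurable (raw)]: "(\<lambda>x. f (a x) (b x) (c x)) \<in> borel_measurable N"
    if [measurable]: "a \<in> borel_measurable N" "b \<in> borel_measurable N" "c \<in> borel_measurable N" for a b c and N :: "'n measure"
  proof -
    have "(\<lambda>x. ((a x + b x) / 2, \<bar>a x - b x\<bar>)) \<in> N \<rightarrow>\<^sub>M borel"
      unfolding borel_prod[symmetric] by measurable
    then show ?thesis unfolding f_def by measurable
  qed
  have "(\<integral>\<^sup>+p. \<integral>\<^sup>+q. \<integral>\<^sup>+r. (\<integral>\<^sup>+y. h (core_data y) \<partial>measure_pmf (ord_pmf (vector [p, q, r]))) \<partial>U01 \<partial>U01 \<partial>U01) =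
      (\<integral>\<^sup>+p. \<integral>\<^sup>+q. \<integral>\<^sup>+r. f p q r + f p r q + f q r p \<partial>U01 \<partial>U01 \<partial>U01)"
  proof (rule nn_integral_cong, rule nn_integral_cong_AE)
    fix p :: real
    have "AE q in U01. q \<notin> {p}" by (rule AE_U01_finite) simp
    then show "AE q in U01. (\<integral>\<^sup>+r. (\<integral>\<^sup>+y. h (core_data y) \<partial>measure_pmf (ord_pmf (vector [p, q, r]))) \<partial>U01) =
        (\<integral>\<^sup>+r. f p q r + f p r q + f q r p \<partial>U01)"
    proof eventually_elim
      case (elim q)
      \<comment> \<open>These are exactly the positions of \<open>r\<close> at which two of the
        three distances agree, given that \<open>p\<close> and \<open>q\<close> differ.\<close>
      have "AE r in U01. r \<notin> {p, q, 2 * p - q, 2 * q - p, (p + q) / 2}" by (rule AE_U01_finite) simp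
      then show ?case
      proof (intro nn_integral_cong_AE, eventually_elim)
        case (elim r)
        have "\<bar>p - q\<bar> \<noteq> \<bar>p - r\<bar>" "\<bar>p - q\<bar> \<noteq> \<bar>q - r\<bar>" "\<bar>p - r\<bar> \<noteq> \<bar>q - r\<bar>"
          using elim \<open>q \<notin> {p}\<close> by (auto simp: abs_if field_simps split: if_splits)
        then show ?case unfolding f_def by (rule nn_integral_ord_pmf_no_ties)
      qed
    qed
  qed
  also have "\<dots> = (\<integral>\<^sup>+p. \<integral>\<^sup>+q. \<integral>\<^sup>+r. f p q r \<partial>U01 \<partial>U01 \<partial>U01) + (\<integral>\<^sup>+p. \<integral>\<^sup>+q. \<integral>\<^sup>+r. f p r q \<partial>U01 \<partial>U01 \<partial>U01) +
      (\<integral>\<^sup>+p. \<integral>\<^sup>+q. \<integral>\<^sup>+r. f q r p \<partial>U01 \<partial>U01 \<partial>U01)"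
    by (simp add: nn_integral_add)
  also have "(\<integral>\<^sup>+p. \<integral>\<^sup>+q. \<integral>\<^sup>+r. f p r q \<partial>U01 \<partial>U01 \<partial>U01) = (\<integral>\<^sup>+p. \<integral>\<^sup>+q. \<integral>\<^sup>+r. f p q r \<partial>U01 \<partial>U01 \<partial>U01)"
    by (rule nn_integral_cong, rule UU.Fubini') measurable
  also have "(\<integral>\<^sup>+p. \<integral>\<^sup>+q. \<integral>\<^sup>+r. f q r p \<partial>U01 \<partial>U01 \<partial>U01) = (\<integral>\<^sup>+q. \<integral>\<^sup>+p. \<integral>\<^sup>+r. f q r p \<partial>U01 \<partial>U01 \<partial>U01)"
    by (rule UU.Fubini') measurable
  also have "\<dots> = (\<integral>\<^sup>+p. \<integral>\<^sup>+q. \<integral>\<^sup>+r. f p q r \<partial>U01 \<partial>U01 \<partial>U01)"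
    by (rule nn_integral_cong, rule UU.Fubini') measurable
  also have "(\<integral>\<^sup>+p. \<integral>\<^sup>+q. \<integral>\<^sup>+r. f p q r \<partial>U01 \<partial>U01 \<partial>U01) =
      (\<integral>\<^sup>+p. \<integral>\<^sup>+q. h ((p + q) / 2, \<bar>p - q\<bar>) * (\<integral>\<^sup>+r. closest_ind p q r \<partial>U01) \<partial>U01 \<partial>U01)"
    unfolding f_def by (simp add: nn_integral_cmult)
  finally show ?thesis
    unfolding three_times_ennreal .
qed

text \<open>The third point has to be farther than \<open>q - p\<close> from both others, that is,
  below \<open>2 p - q\<close> or above \<open>2 q - p\<close>. A negative length counts as 0
  because \<open>ennreal\<close> truncates it.\<close>

lemma nn_integral_closest_ind:
  assumes p: "0 \<le> p" and pq: "p < q" and q: "q \<le> 1"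
  shows "(\<integral>\<^sup>+r. closest_ind p q r \<partial>U01) = ennreal (2 * p - q) + ennreal (1 + p - 2 * q)"
proof -
  have "(\<integral>\<^sup>+r. closest_ind p q r \<partial>U01) = (\<integral>\<^sup>+r. closest_ind p q r * indicator {0..1} r \<partial>lborel)"
    by (rule nn_integral_U01) measurable
  also have "\<dots> = (\<integral>\<^sup>+r. indicator {0..<2 * p - q} r + indicator {2 * q - p<..1} r \<partial>lborel)"
    using assms by (intro nn_integral_cong) (auto simp: closest_ind_def indicator_def abs_if)
  also have "\<dots> = emeasure lborel {0..<2 * p - q} + emeasure lborel {2 * q - p<..1}"
    by (subst nn_integral_add) auto
  also have "emeasure lborel {0..<2 * p - q} = ennreal (2 * p - q)"
    by (cases "0 \<le> 2 * p - q") (auto simp: ennreal_neg)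
  also have "emeasure lborel {2 * q - p<..1} = ennreal (1 + p - 2 * q)"
    by (cases "2 * q - p \<le> 1") (auto simp: ennreal_neg algebra_simps)
  finally show ?thesis .
qed

lemma closest_ind_commute: "closest_ind p q = closest_ind q p"
  by (auto simp: fun_eq_iff closest_ind_def abs_minus_commute)

text \<open>The integrand is symmetric, so \<open>p < q\<close> may be assumed at the cost of a
  factor 2. The ranges of integration are where the two lengths \<open>2 p - q\<close> and
  \<open>1 + p - 2 q\<close> are nonnegative; without this cut the truncation would spoil the
  polynomial form.\<close>

lemma nn_integral_closest_pair:
  fixes g :: "real \<Rightarrow> real \<Rightarrow> real"
  assumes [measurable]: "case_prod g \<in> borel_measurable (borel \<Otimes>\<^sub>M borel)"
    and g: "\<And>m d. 0 \<le> m \<Longrightarrow> 0 \<le> d \<Longrightarrow> 0 \<le> g m d"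
  shows "(\<integral>\<^sup>+p. \<integral>\<^sup>+q. ennreal (g ((p + q) / 2) \<bar>p - q\<bar>) * (\<integral>\<^sup>+r. closest_ind p q r \<partial>U01) \<partial>U01 \<partial>U01) =
    2 * ((\<integral>\<^sup>+q. \<integral>\<^sup>+p. ennreal (g ((p + q) / 2) (q - p) * (2 * p - q)) * indicator {q / 2..q} p \<partial>lborel \<partial>U01) +
      (\<integral>\<^sup>+p. \<integral>\<^sup>+q. ennreal (g ((p + q) / 2) (q - p) * (1 + p - 2 * q)) * indicator {p..(1 + p) / 2} q \<partial>lborel \<partial>U01))"
    (is "?lhs = 2 * (?I1 + ?I2)")
proof -
  have [measurable (raw)]: "(\<lambda>x. g (a x) (b x)) \<in> borel_measurable N"
    if "a \<in> borel_measurable N" "b \<in> borel_measurable N" for a b and N :: "'n measure"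
    using measurable_compose[OF measurable_Pair[OF that] assms(1)] by simp
  define c where "c p q = ennreal (g ((p + q) / 2) \<bar>p - q\<bar>) * (\<integral>\<^sup>+r. closest_ind p q r \<partial>U01)" for p q
  have c_commute: "c p q = c q p" for p q
    unfolding c_def by (simp add: add.commute abs_minus_commute closest_ind_commute[of p q])
  have [measurable (raw)]: "(\<lambda>x. c (a x) (b x)) \<in> borel_measurable N"
    if [measurable]: "a \<in> borel_measurable N" "b \<in> borel_measurable N" for a b and N :: "'n measure"
    unfolding c_def by measurable
  define e where "e p q = (if p < q then 1 else 0 :: ennreal)" for p q :: real
  have [measurable (raw)]: "(\<lambda>x. e (a x) (b x)) \<in> borel_measurable N"
    if [measurable]: "a \<in> borel_measurable N" "b \<in> borel_measurable N" for a b and N :: "'n measure"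
    unfolding e_def by measurable
  \<comment> \<open>The two lengths are treated separately. For \<open>c1\<close> the range of
    \<open>p\<close> depends on \<open>q\<close>, for \<open>c2\<close> that of \<open>q\<close> on
    \<open>p\<close>; both ranges stay inside the unit interval, so the inner integrals extend to
    \<open>lborel\<close>.\<close>
  define c1 where "c1 p q = ennreal (g ((p + q) / 2) (q - p) * (2 * p - q)) * indicator {q / 2..q} p" for p q
  define c2 where "c2 p q = ennreal (g ((p + q) / 2) (q - p) * (1 + p - 2 * q)) * indicator {p..(1 + p) / 2} q" for p q
  have [measurable (raw)]: "(\<lambda>x. c1 (a x) (b x)) \<in> borel_measurable N" "(\<lambda>x. c2 (a x) (b x)) \<in> borel_measurable N"
    if [measurable]: "a \<in> borel_measurable N" "b \<in> borel_measurable N" for a b and N :: "'n measure"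
    unfolding c1_def c2_def indicator_def atLeastAtMost_iff by measurable
  have "?lhs = (\<integral>\<^sup>+p. \<integral>\<^sup>+q. e p q * c p q + e q p * c q p \<partial>U01 \<partial>U01)"
  proof (rule nn_integral_cong, rule nn_integral_cong_AE)
    fix p :: real
    have "AE q in U01. q \<notin> {p}" by (rule AE_U01_finite) simp
    then show "AE q in U01. ennreal (g ((p + q) / 2) \<bar>p - q\<bar>) * (\<integral>\<^sup>+r. closest_ind p q r \<partial>U01) = e p q * c p q + e q p * c q p"
      unfolding c_def[symmetric] c_commute[of _ p] by eventually_elim (auto simp: e_def)
  qed
  also have "\<dots> = (\<integral>\<^sup>+p. \<integral>\<^sup>+q. e p q * c p q \<partial>U01 \<partial>U01) + (\<integral>\<^sup>+p. \<integral>\<^sup>+q. e q p * c q p \<partial>U01 \<partial>U01)"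
    by (simp add: nn_integral_add)
  also have "(\<integral>\<^sup>+p. \<integral>\<^sup>+q. e q p * c q p \<partial>U01 \<partial>U01) = (\<integral>\<^sup>+p. \<integral>\<^sup>+q. e p q * c p q \<partial>U01 \<partial>U01)"
    by (rule UU.Fubini') measurable
  finally have lhs: "?lhs = 2 * (\<integral>\<^sup>+p. \<integral>\<^sup>+q. e p q * c p q \<partial>U01 \<partial>U01)"
    unfolding mult_2 .
  have "(\<integral>\<^sup>+p. \<integral>\<^sup>+q. e p q * c p q \<partial>U01 \<partial>U01) = (\<integral>\<^sup>+p. \<integral>\<^sup>+q. c1 p q + c2 p q \<partial>U01 \<partial>U01)"
  proof (rule nn_integral_cong_AE)
    show "AE p in U01. (\<integral>\<^sup>+q. e p q * c p q \<partial>U01) = (\<integral>\<^sup>+q. c1 p q + c2 p q \<partial>U01)"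
      using AE_U01_mem
    proof eventually_elim
      case (elim p)
      have "AE q in U01. q \<notin> {p, 2 * p, (1 + p) / 2}" by (rule AE_U01_finite) simp
      then show "(\<integral>\<^sup>+q. e p q * c p q \<partial>U01) = (\<integral>\<^sup>+q. c1 p q + c2 p q \<partial>U01)"
        using AE_U01_mem
      proof (intro nn_integral_cong_AE, eventually_elim)
        case (elim q)
        show ?case
        proof (cases "p < q")
          case True
          let ?g = "g ((p + q) / 2) (q - p)"
          have "0 \<le> ?g" using True \<open>0 \<le> p \<and> p \<le> 1\<close> by (intro g) auto
          moreover have "c p q = ennreal ?g * (ennreal (2 * p - q) + ennreal (1 + p - 2 * q))"
            unfolding c_def using True \<open>0 \<le> p \<and> p \<le> 1\<close> elim by (simp add: nn_integral_closest_ind)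
          moreover have "ennreal ?g * ennreal (2 * p - q) = c1 p q"
            using \<open>0 \<le> ?g\<close> True by (auto simp: c1_def indicator_def ennreal_mult' ennreal_neg)
          moreover have "ennreal ?g * ennreal (1 + p - 2 * q) = c2 p q"
            using \<open>0 \<le> ?g\<close> True by (auto simp: c2_def indicator_def ennreal_mult' ennreal_neg)
          ultimately show ?thesis
            using True by (simp add: e_def distrib_left)
        next
          case False
          with elim have "q < p" by auto
          then show ?thesis by (simp add: e_def c1_def c2_def)
        qed
      qed
    qed
  qed
  also have "\<dots> = (\<integral>\<^sup>+p. \<integral>\<^sup>+q. c1 p q \<partial>U01 \<partial>U01) + (\<integral>\<^sup>+p. \<integral>\<^sup>+q. c2 p q \<partial>U01 \<partial>U01)"
    by (simp add: nn_integral_add)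
  also have "(\<integral>\<^sup>+p. \<integral>\<^sup>+q. c1 p q \<partial>U01 \<partial>U01) = (\<integral>\<^sup>+q. \<integral>\<^sup>+p. c1 p q \<partial>U01 \<partial>U01)"
    by (rule UU.Fubini') measurable
  also have "\<dots> = ?I1"
  proof (rule nn_integral_cong_AE)
    show "AE q in U01. (\<integral>\<^sup>+p. c1 p q \<partial>U01) = (\<integral>\<^sup>+p. ennreal (g ((p + q) / 2) (q - p) * (2 * p - q)) * indicator {q / 2..q} p \<partial>lborel)"
      using AE_U01_mem
    proof eventually_elim
      case (elim q)
      have "(\<integral>\<^sup>+p. c1 p q \<partial>U01) = (\<integral>\<^sup>+p. c1 p q * indicator {0..1} p \<partial>lborel)"
        by (rule nn_integral_U01) measurable
      also have "\<dots> = (\<integral>\<^sup>+p. c1 p q \<partial>lborel)"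
        using elim by (intro nn_integral_cong) (auto simp: c1_def indicator_def)
      finally show ?case unfolding c1_def .
    qed
  qed
  also have "(\<integral>\<^sup>+p. \<integral>\<^sup>+q. c2 p q \<partial>U01 \<partial>U01) = ?I2"
  proof (rule nn_integral_cong_AE)
    show "AE p in U01. (\<integral>\<^sup>+q. c2 p q \<partial>U01) = (\<integral>\<^sup>+q. ennreal (g ((p + q) / 2) (q - p) * (1 + p - 2 * q)) * indicator {p..(1 + p) / 2} q \<partial>lborel)"
      using AE_U01_mem
    proof eventually_elim
      case (elim p)
      have "(\<integral>\<^sup>+q. c2 p q \<partial>U01) = (\<integral>\<^sup>+q. c2 p q * indicator {0..1} q \<partial>lborel)"
        by (rule nn_integral_U01) measurable
      also have "\<dots> = (\<integral>\<^sup>+q. c2 p q \<partial>lborel)"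
        using elim by (intro nn_integral_cong) (auto simp: c2_def indicator_def)
      finally show ?case unfolding c2_def .
    qed
  qed
  finally show ?thesis unfolding lhs by simp
qed

section \<open>Explicit double integrals for the first three moments\<close>

text \<open>
  In the next three proofs \<open>G1\<close> and \<open>G2\<close> are antiderivatives in the inner variable, and \<open>K1\<close> and \<open>K2\<close>
  are antiderivatives of the resulting functions of the outer variable.
\<close>

lemma uniform_moment_1:
  "(\<integral>\<^sup>+q. \<integral>\<^sup>+p. ennreal (affine_moment 1 ((p + q) / 2) (q - p) * (2 * p - q)) * indicator {q / 2..q} p \<partial>lborel \<partial>U01) = ennreal (11 / 192)"
  "(\<integral>\<^sup>+p. \<integral>\<^sup>+q. ennreal (affine_moment 1 ((p + q) / 2) (q - p) * (1 + p - 2 * q)) * indicator {p..(1 + p) / 2} q \<partial>lborel \<partial>U01) = ennreal (5 / 192)"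
proof -
  define G1 where "G1 q p = - 1/2 * p * q^2 + 1/4 * p^2 * q + 1/3 * p^3" for q p :: real
  \<comment> \<open>Substituting \<open>p = q s\<close> shows that the inner integral is a multiple
    of \<open>q ^ 3\<close>, hence a monomial.\<close>
  define K1 where "K1 q = 11/192 * q^4" for q :: real
  have "(\<integral>\<^sup>+q. \<integral>\<^sup>+p. ennreal (affine_moment 1 ((p + q) / 2) (q - p) * (2 * p - q)) * indicator {q / 2..q} p \<partial>lborel \<partial>U01) = ennreal (K1 1 - K1 0)"
  proof (rule nn_integral_double_FTC)
    show "(G1 q has_real_derivative affine_moment 1 ((p + q) / 2) (q - p) * (2 * p - q)) (at p)" for q p
      unfolding G1_def affine_moment_eq
      by (rule derivative_eq_intros refl | simp add: field_simps eval_nat_numeral)+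
    show "(K1 has_real_derivative G1 q q - G1 q (q / 2)) (at q)" for q
      unfolding G1_def K1_def
      by (rule derivative_eq_intros refl | simp add: field_simps eval_nat_numeral)+
    show "(\<lambda>p. affine_moment 1 ((p + q) / 2) (q - p) * (2 * p - q)) \<in> borel_measurable borel" for q
      unfolding affine_moment_eq by measurable
    show "0 \<le> affine_moment 1 ((p + q) / 2) (q - p) * (2 * p - q)" if "0 \<le> q" "q / 2 \<le> p" "p \<le> q" for p q
      using that by (intro mult_nonneg_nonneg affine_moment_nonneg) auto
    show "(\<lambda>q. G1 q q - G1 q (q / 2)) \<in> borel_measurable borel"
      unfolding G1_def by measurable
  qed auto
  then show "(\<integral>\<^sup>+q. \<integral>\<^sup>+p. ennreal (affine_moment 1 ((p + q) / 2) (q - p) * (2 * p - q)) * indicator {q / 2..q} p \<partial>lborel \<partial>U01) = ennreal (11 / 192)"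
    by (simp add: K1_def)
  define G2 where "G2 p q = 1/4 * q^2 - 1/3 * q^3 + 1/2 * p * q - 1/4 * p * q^2 + 1/2 * p^2 * q" for q p :: real
  define K2 where "K2 p = 1/48 * p + 3/32 * p^2 - 7/48 * p^3 + 11/192 * p^4" for p :: real
  have "(\<integral>\<^sup>+p. \<integral>\<^sup>+q. ennreal (affine_moment 1 ((p + q) / 2) (q - p) * (1 + p - 2 * q)) * indicator {p..(1 + p) / 2} q \<partial>lborel \<partial>U01) = ennreal (K2 1 - K2 0)"
  proof (rule nn_integral_double_FTC)
    show "(G2 p has_real_derivative affine_moment 1 ((p + q) / 2) (q - p) * (1 + p - 2 * q)) (at q)" for q p
      unfolding G2_def affine_moment_eq
      by (rule derivative_eq_intros refl | simp add: field_simps eval_nat_numeral)+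
    show "(K2 has_real_derivative G2 p ((1 + p) / 2) - G2 p p) (at p)" for p
      unfolding G2_def K2_def
      by (rule derivative_eq_intros refl | simp add: field_simps eval_nat_numeral)+
    show "(\<lambda>q. affine_moment 1 ((p + q) / 2) (q - p) * (1 + p - 2 * q)) \<in> borel_measurable borel" for p
      unfolding affine_moment_eq by measurable
    show "0 \<le> affine_moment 1 ((p + q) / 2) (q - p) * (1 + p - 2 * q)" if "0 \<le> p" "p \<le> q" "q \<le> (1 + p) / 2" for p q
      using that by (intro mult_nonneg_nonneg affine_moment_nonneg) auto
    show "(\<lambda>p. G2 p ((1 + p) / 2) - G2 p p) \<in> borel_measurable borel"
      unfolding G2_def by measurable
  qed auto
  then show "(\<integral>\<^sup>+p. \<integral>\<^sup>+q. ennreal (affine_moment 1 ((p + q) / 2) (q - p) * (1 + p - 2 * q)) * indicator {p..(1 + p) / 2} q \<partial>lborel \<partial>U01) = ennreal (5 / 192)"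
    by (simp add: K2_def)
qed

lemma uniform_moment_2:
  "(\<integral>\<^sup>+q. \<integral>\<^sup>+p. ennreal (affine_moment 2 ((p + q) / 2) (q - p) * (2 * p - q)) * indicator {q / 2..q} p \<partial>lborel \<partial>U01) = ennreal (25 / 576)"
  "(\<integral>\<^sup>+p. \<integral>\<^sup>+q. ennreal (affine_moment 2 ((p + q) / 2) (q - p) * (1 + p - 2 * q)) * indicator {p..(1 + p) / 2} q \<partial>lborel \<partial>U01) = ennreal (7 / 576)"
proof -
  define G1 where "G1 q p = - 5/6 * p * q^3 + 7/6 * p^2 * q^2 - 13/18 * p^3 * q + 5/12 * p^4" for q p :: real
  define K1 where "K1 q = 25/576 * q^5" for q :: real
  have "(\<integral>\<^sup>+q. \<integral>\<^sup>+p. ennreal (affine_moment 2 ((p + q) / 2) (q - p) * (2 * p - q)) * indicator {q / 2..q} p \<partial>lborel \<partial>U01) = ennreal (K1 1 - K1 0)"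
  proof (rule nn_integral_double_FTC)
    show "(G1 q has_real_derivative affine_moment 2 ((p + q) / 2) (q - p) * (2 * p - q)) (at p)" for q p
      unfolding G1_def affine_moment_eq
      by (rule derivative_eq_intros refl | simp add: field_simps eval_nat_numeral)+
    show "(K1 has_real_derivative G1 q q - G1 q (q / 2)) (at q)" for q
      unfolding G1_def K1_def
      by (rule derivative_eq_intros refl | simp add: field_simps eval_nat_numeral)+
    show "(\<lambda>p. affine_moment 2 ((p + q) / 2) (q - p) * (2 * p - q)) \<in> borel_measurable borel" for q
      unfolding affine_moment_eq by measurable
    show "0 \<le> affine_moment 2 ((p + q) / 2) (q - p) * (2 * p - q)" if "0 \<le> q" "q / 2 \<le> p" "p \<le> q" for p q
      using that by (intro mult_nonneg_nonneg affine_moment_nonneg) auto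
    show "(\<lambda>q. G1 q q - G1 q (q / 2)) \<in> borel_measurable borel"
      unfolding G1_def by measurable
  qed auto
  then show "(\<integral>\<^sup>+q. \<integral>\<^sup>+p. ennreal (affine_moment 2 ((p + q) / 2) (q - p) * (2 * p - q)) * indicator {q / 2..q} p \<partial>lborel \<partial>U01) = ennreal (25 / 576)"
    by (simp add: K1_def)
  define G2 where "G2 p q = 5/18 * q^3 - 5/12 * q^4 - 1/3 * p * q^2 + 13/18 * p * q^3 + 5/6 * p^2 * q - 7/6 * p^2 * q^2 + 5/6 * p^3 * q" for q p :: real
  define K2 where "K2 p = 5/576 * p + 1/288 * p^2 + 17/288 * p^3 - 59/576 * p^4 + 25/576 * p^5" for p :: real
  have "(\<integral>\<^sup>+p. \<integral>\<^sup>+q. ennreal (affine_moment 2 ((p + q) / 2) (q - p) * (1 + p - 2 * q)) * indicator {p..(1 + p) / 2} q \<partial>lborel \<partial>U01) = ennreal (K2 1 - K2 0)"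
  proof (rule nn_integral_double_FTC)
    show "(G2 p has_real_derivative affine_moment 2 ((p + q) / 2) (q - p) * (1 + p - 2 * q)) (at q)" for q p
      unfolding G2_def affine_moment_eq
      by (rule derivative_eq_intros refl | simp add: field_simps eval_nat_numeral)+
    show "(K2 has_real_derivative G2 p ((1 + p) / 2) - G2 p p) (at p)" for p
      unfolding G2_def K2_def
      by (rule derivative_eq_intros refl | simp add: field_simps eval_nat_numeral)+
    show "(\<lambda>q. affine_moment 2 ((p + q) / 2) (q - p) * (1 + p - 2 * q)) \<in> borel_measurable borel" for p
      unfolding affine_moment_eq by measurable
    show "0 \<le> affine_moment 2 ((p + q) / 2) (q - p) * (1 + p - 2 * q)" if "0 \<le> p" "p \<le> q" "q \<le> (1 + p) / 2" for p q
      using that by (intro mult_nonneg_nonneg affine_moment_nonneg) auto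
    show "(\<lambda>p. G2 p ((1 + p) / 2) - G2 p p) \<in> borel_measurable borel"
      unfolding G2_def by measurable
  qed auto
  then show "(\<integral>\<^sup>+p. \<integral>\<^sup>+q. ennreal (affine_moment 2 ((p + q) / 2) (q - p) * (1 + p - 2 * q)) * indicator {p..(1 + p) / 2} q \<partial>lborel \<partial>U01) = ennreal (7 / 576)"
    by (simp add: K2_def)
qed

lemma uniform_moment_3:
  "(\<integral>\<^sup>+q. \<integral>\<^sup>+p. ennreal (affine_moment 3 ((p + q) / 2) (q - p) * (2 * p - q)) * indicator {q / 2..q} p \<partial>lborel \<partial>U01) = ennreal (101 / 2880)"
  "(\<integral>\<^sup>+p. \<integral>\<^sup>+q. ennreal (affine_moment 3 ((p + q) / 2) (q - p) * (1 + p - 2 * q)) * indicator {p..(1 + p) / 2} q \<partial>lborel \<partial>U01) = ennreal (19 / 2880)"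
proof -
  define G1 where "G1 q p = - p * q^4 + 5/4 * p^2 * q^3 - 1/6 * p^3 * q^2 - 1/2 * p^4 * q + 2/5 * p^5" for q p :: real
  define K1 where "K1 q = 101/2880 * q^6" for q :: real
  have "(\<integral>\<^sup>+q. \<integral>\<^sup>+p. ennreal (affine_moment 3 ((p + q) / 2) (q - p) * (2 * p - q)) * indicator {q / 2..q} p \<partial>lborel \<partial>U01) = ennreal (K1 1 - K1 0)"
  proof (rule nn_integral_double_FTC)
    show "(G1 q has_real_derivative affine_moment 3 ((p + q) / 2) (q - p) * (2 * p - q)) (at p)" for q p
      unfolding G1_def affine_moment_eq
      by (rule derivative_eq_intros refl | simp add: field_simps eval_nat_numeral)+
    show "(K1 has_real_derivative G1 q q - G1 q (q / 2)) (at q)" for q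
      unfolding G1_def K1_def
      by (rule derivative_eq_intros refl | simp add: field_simps eval_nat_numeral)+
    show "(\<lambda>p. affine_moment 3 ((p + q) / 2) (q - p) * (2 * p - q)) \<in> borel_measurable borel" for q
      unfolding affine_moment_eq by measurable
    show "0 \<le> affine_moment 3 ((p + q) / 2) (q - p) * (2 * p - q)" if "0 \<le> q" "q / 2 \<le> p" "p \<le> q" for p q
      using that by (intro mult_nonneg_nonneg affine_moment_nonneg) auto
    show "(\<lambda>q. G1 q q - G1 q (q / 2)) \<in> borel_measurable borel"
      unfolding G1_def by measurable
  qed auto
  then show "(\<integral>\<^sup>+q. \<integral>\<^sup>+p. ennreal (affine_moment 3 ((p + q) / 2) (q - p) * (2 * p - q)) * indicator {q / 2..q} p \<partial>lborel \<partial>U01) = ennreal (101 / 2880)"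
    by (simp add: K1_def)
  define G2 where "G2 p q = 1/4 * q^4 - 2/5 * q^5 - 1/6 * p * q^3 + 1/2 * p * q^4 - 1/4 * p^2 * q^2 + 1/6 * p^2 * q^3 + p^3 * q - 5/4 * p^3 * q^2 + p^4 * q" for q p :: real
  define K2 where "K2 p = 1/320 * p + 1/192 * p^2 - 1/288 * p^3 + 3/64 * p^4 - 77/960 * p^5 + 101/2880 * p^6" for p :: real
  have "(\<integral>\<^sup>+p. \<integral>\<^sup>+q. ennreal (affine_moment 3 ((p + q) / 2) (q - p) * (1 + p - 2 * q)) * indicator {p..(1 + p) / 2} q \<partial>lborel \<partial>U01) = ennreal (K2 1 - K2 0)"
  proof (rule nn_integral_double_FTC)
    show "(G2 p has_real_derivative affine_moment 3 ((p + q) / 2) (q - p) * (1 + p - 2 * q)) (at q)" for q p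
      unfolding G2_def affine_moment_eq
      by (rule derivative_eq_intros refl | simp add: field_simps eval_nat_numeral)+
    show "(K2 has_real_derivative G2 p ((1 + p) / 2) - G2 p p) (at p)" for p
      unfolding G2_def K2_def
      by (rule derivative_eq_intros refl | simp add: field_simps eval_nat_numeral)+
    show "(\<lambda>q. affine_moment 3 ((p + q) / 2) (q - p) * (1 + p - 2 * q)) \<in> borel_measurable borel" for p
      unfolding affine_moment_eq by measurable
    show "0 \<le> affine_moment 3 ((p + q) / 2) (q - p) * (1 + p - 2 * q)" if "0 \<le> p" "p \<le> q" "q \<le> (1 + p) / 2" for p q
      using that by (intro mult_nonneg_nonneg affine_moment_nonneg) auto
    show "(\<lambda>p. G2 p ((1 + p) / 2) - G2 p p) \<in> borel_measurable borel"
      unfolding G2_def by measurable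
  qed auto
  then show "(\<integral>\<^sup>+p. \<integral>\<^sup>+q. ennreal (affine_moment 3 ((p + q) / 2) (q - p) * (1 + p - 2 * q)) * indicator {p..(1 + p) / 2} q \<partial>lborel \<partial>U01) = ennreal (19 / 2880)"
    by (simp add: K2_def)
qed

section \<open>Moments of the limit for uniform initial points\<close>

context modified_process
begin

text \<open>Independence makes the joint law of the coordinates a product measure over the index
  type \<open>3\<close>, whose factors are then integrated one at a time.\<close>

lemma nn_integral_iid:
  assumes indep: "indep_vars (\<lambda>_. borel) (\<lambda>i \<omega>. P \<omega> $ i) UNIV"
    and unif: "\<And>i. distr M borel (\<lambda>\<omega>. P \<omega> $ i) = U01"
    and [measurable]: "G \<in> borel_measurable borel"
  shows "(\<integral>\<^sup>+\<omega>. G (P \<omega>) \<partial>M) = (\<integral>\<^sup>+p. \<integral>\<^sup>+q. \<integral>\<^sup>+r. G (vector [p, q, r]) \<partial>U01 \<partial>U01 \<partial>U01)"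
proof -
  note [measurable] = P_measurable
  interpret PS: product_sigma_finite "\<lambda>_::3. U01"
    by unfold_locales
  have U: "(UNIV :: 3 set) = insert 1 (insert 2 {3})"
    by (rule UNIV_3)
  have D: "distr M (\<Pi>\<^sub>M i\<in>UNIV. borel) (\<lambda>\<omega>. \<lambda>i\<in>UNIV. P \<omega> $ i) = (\<Pi>\<^sub>M i\<in>(UNIV :: 3 set). U01)"
    using indep by (subst (asm) indep_vars_iff_distr_eq_PiM) (simp_all add: unif)
  define g where "g x = G (vector [x 1, x 2, x 3])" for x :: "3 \<Rightarrow> real"
  have [measurable]: "g \<in> borel_measurable (\<Pi>\<^sub>M i\<in>(UNIV :: 3 set). borel)"
    unfolding g_def by measurable
  have g_U: "g \<in> borel_measurable (\<Pi>\<^sub>M i\<in>(UNIV :: 3 set). U01)"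
    unfolding g_def by measurable
  have vec: "vector [x $ 1, x $ 2, x $ 3] = (x :: real ^ 3)" for x
    by (simp add: vec_eq_iff forall_3)
  have "(\<integral>\<^sup>+\<omega>. G (P \<omega>) \<partial>M) = (\<integral>\<^sup>+\<omega>. g (\<lambda>i\<in>UNIV. P \<omega> $ i) \<partial>M)"
    by (simp add: g_def vec)
  also have "\<dots> = (\<integral>\<^sup>+x. g x \<partial>(\<Pi>\<^sub>M i\<in>(UNIV :: 3 set). U01))"
    unfolding D[symmetric] by (rule nn_integral_distr[symmetric]) measurable
  also have "\<dots> = (\<integral>\<^sup>+p. \<integral>\<^sup>+x. g (x(1 := p)) \<partial>(\<Pi>\<^sub>M i\<in>{2, 3 :: 3}. U01) \<partial>U01)"
    unfolding U using g_U[unfolded U] by (rule PS.product_nn_integral_insert_rev[rotated 2]) simp_all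
  also have "\<dots> = (\<integral>\<^sup>+p. \<integral>\<^sup>+q. \<integral>\<^sup>+x. g (x(2 := q, 1 := p)) \<partial>(\<Pi>\<^sub>M i\<in>{3 :: 3}. U01) \<partial>U01 \<partial>U01)"
  proof (rule nn_integral_cong)
    fix p :: real
    show "(\<integral>\<^sup>+x. g (x(1 := p)) \<partial>(\<Pi>\<^sub>M i\<in>{2, 3 :: 3}. U01)) = (\<integral>\<^sup>+q. \<integral>\<^sup>+x. g (x(2 := q, 1 := p)) \<partial>(\<Pi>\<^sub>M i\<in>{3 :: 3}. U01) \<partial>U01)"
    proof (rule PS.product_nn_integral_insert_rev[where f = "\<lambda>x. g (x(1 := p))"])
      show "(\<lambda>x. g (x(1 := p))) \<in> borel_measurable (\<Pi>\<^sub>M i\<in>insert 2 {3 :: 3}. U01)"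
        unfolding g_def by simp
    qed simp_all
  qed
  also have "\<dots> = (\<integral>\<^sup>+p. \<integral>\<^sup>+q. \<integral>\<^sup>+r. G (vector [p, q, r]) \<partial>U01 \<partial>U01 \<partial>U01)"
  proof (intro nn_integral_cong)
    fix p q :: real
    have "(\<integral>\<^sup>+x. g (x(2 := q, 1 := p)) \<partial>(\<Pi>\<^sub>M i\<in>{3 :: 3}. U01)) = (\<integral>\<^sup>+x. G (vector [p, q, x 3]) \<partial>(\<Pi>\<^sub>M i\<in>{3 :: 3}. U01))"
      by (simp add: g_def)
    also have "\<dots> = (\<integral>\<^sup>+r. G (vector [p, q, r]) \<partial>U01)"
      by (rule PS.product_nn_integral_singleton) measurable
    finally show "(\<integral>\<^sup>+x. g (x(2 := q, 1 := p)) \<partial>(\<Pi>\<^sub>M i\<in>{3 :: 3}. U01)) = (\<integral>\<^sup>+r. G (vector [p, q, r]) \<partial>U01)" .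
  qed
  finally show ?thesis .
qed

lemma nn_integral_uniform_core_data:
  assumes indep: "indep_vars (\<lambda>_. borel) (\<lambda>i \<omega>. P \<omega> $ i) UNIV"
    and unif: "\<And>i. distr M borel (\<lambda>\<omega>. P \<omega> $ i) = U01"
    and h [measurable]: "h \<in> borel_measurable borel"
  shows "(\<integral>\<^sup>+\<omega>. h (core_data (X 0 \<omega>)) \<partial>M) =
    3 * (\<integral>\<^sup>+p. \<integral>\<^sup>+q. h ((p + q) / 2, \<bar>p - q\<bar>) * (\<integral>\<^sup>+r. closest_ind p q r \<partial>U01) \<partial>U01 \<partial>U01)"
proof -
  \<comment> \<open>Measurability in \<open>z\<close> is available for the Borel kernel, so the
    discrete law is replaced by it.\<close>
  have kernel: "(\<integral>\<^sup>+y. h (core_data y) \<partial>measure_pmf (ord_pmf z)) = (\<integral>\<^sup>+y. h (core_data y) \<partial>ord_kernel z)" for z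
    by (rule nn_integral_ord_kernel[symmetric]) measurable
  have [measurable]: "(\<lambda>z. \<integral>\<^sup>+y. h (core_data y) \<partial>measure_pmf (ord_pmf z)) \<in> borel_measurable borel"
    unfolding kernel by (rule nn_integral_measurable_subprob_algebra2[where N = borel]) measurable
  have "(\<integral>\<^sup>+\<omega>. h (core_data (X 0 \<omega>)) \<partial>M) = (\<integral>\<^sup>+\<omega>. \<integral>\<^sup>+y. h (core_data y) \<partial>measure_pmf (ord_pmf (P \<omega>)) \<partial>M)"
    by (rule nn_integral_init_core_data) fact
  also have "\<dots> = (\<integral>\<^sup>+p. \<integral>\<^sup>+q. \<integral>\<^sup>+r. (\<integral>\<^sup>+y. h (core_data y) \<partial>measure_pmf (ord_pmf (vector [p, q, r]))) \<partial>U01 \<partial>U01 \<partial>U01)"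
    by (rule nn_integral_iid[OF indep unif]) measurable
  also have "\<dots> = 3 * (\<integral>\<^sup>+p. \<integral>\<^sup>+q. h ((p + q) / 2, \<bar>p - q\<bar>) * (\<integral>\<^sup>+r. closest_ind p q r \<partial>U01) \<partial>U01 \<partial>U01)"
    by (rule nn_integral_ord_pmf_iid) fact
  finally show ?thesis .
qed

text \<open>The factor 6 counts the three choices of the closest pair and the two orders of its
  points.\<close>

lemma uniform_moment:
  assumes indep: "indep_vars (\<lambda>_. borel) (\<lambda>i \<omega>. P \<omega> $ i) UNIV"
    and unif: "\<And>i. distr M borel (\<lambda>\<omega>. P \<omega> $ i) = U01"
    and k: "k \<in> {1, 2, 3, 4}"
    and I: "(\<integral>\<^sup>+q. \<integral>\<^sup>+p. ennreal (affine_moment k ((p + q) / 2) (q - p) * (2 * p - q)) * indicator {q / 2..q} p \<partial>lborel \<partial>U01) = ennreal a"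
      "(\<integral>\<^sup>+p. \<integral>\<^sup>+q. ennreal (affine_moment k ((p + q) / 2) (q - p) * (1 + p - 2 * q)) * indicator {p..(1 + p) / 2} q \<partial>lborel \<partial>U01) = ennreal b"
    and ab: "0 \<le> a" "0 \<le> b"
  shows "has_bochner_integral M (\<lambda>\<omega>. limit_point \<omega> ^ k) (6 * (a + b))"
proof (rule limit_point_moment_nn[OF measurable_affine_moment[OF k] affine_moment_nonneg[OF k]])
  let ?h = "\<lambda>z. ennreal (case_prod (affine_moment k) z)"
  note [measurable] = measurable_affine_moment[OF k, unfolded borel_prod]
  have "(\<integral>\<^sup>+\<omega>. ?h (core_data (X 0 \<omega>)) \<partial>M) =
    3 * (\<integral>\<^sup>+p. \<integral>\<^sup>+q. ?h ((p + q) / 2, \<bar>p - q\<bar>) * (\<integral>\<^sup>+r. closest_ind p q r \<partial>U01) \<partial>U01 \<partial>U01)"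
    by (rule nn_integral_uniform_core_data[OF indep unif]) measurable
  also have "\<dots> = 3 * (2 * (ennreal a + ennreal b))"
  proof -
    have "(\<integral>\<^sup>+p. \<integral>\<^sup>+q. ennreal (affine_moment k ((p + q) / 2) \<bar>p - q\<bar>) * (\<integral>\<^sup>+r. closest_ind p q r \<partial>U01) \<partial>U01 \<partial>U01) =
        2 * (ennreal a + ennreal b)"
      unfolding I[symmetric]
      by (rule nn_integral_closest_pair[OF measurable_affine_moment[OF k] affine_moment_nonneg[OF k]])
    then show ?thesis by (simp only: prod.case)
  qed
  also have "\<dots> = ennreal (6 * (a + b))"
  proof -
    have "ennreal (6 * (a + b)) = ennreal 6 * ennreal (a + b)"
      using ab by (intro ennreal_mult) auto
    then show ?thesis
      using ab by (simp only: ennreal_plus) simp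
  qed
  finally show "(\<integral>\<^sup>+\<omega>. ?h (core_data (X 0 \<omega>)) \<partial>M) = ennreal (6 * (a + b))" .
qed (use ab in auto)

lemma uniform_moments:
  assumes "indep_vars (\<lambda>_. borel) (\<lambda>i \<omega>. P \<omega> $ i) UNIV"
    and "\<And>i. distr M borel (\<lambda>\<omega>. P \<omega> $ i) = U01"
  shows "has_bochner_integral M limit_point (1 / 2)"
    "has_bochner_integral M (\<lambda>\<omega>. limit_point \<omega> ^ 2) (1 / 3)"
    "has_bochner_integral M (\<lambda>\<omega>. limit_point \<omega> ^ 3) (1 / 4)"
  using uniform_moment[OF assms _ uniform_moment_1] uniform_moment[OF assms _ uniform_moment_2]
    uniform_moment[OF assms _ uniform_moment_3]
  by simp_all

end

text \<open>The law \<open>L\<close> is chosen before the process, so one solution serves all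
  processes on the given sample type. Independence of \<open>L\<close> and \<open>(\<mu>, D)\<close>
  is expressed by the product measure in the law of \<open>\<xi>\<close>, and each moment claim
  includes integrability.\<close>

theorem proposition3p3:
  shows "\<exists>L :: real measure.
    fixed_point_law L \<and> (\<forall>L'. fixed_point_law L' \<longrightarrow> L' = L) \<and>
    distr L borel uminus = L \<and>
    (\<forall>k::nat. integrable L (\<lambda>x. \<bar>x\<bar> ^ k)) \<and>
    (\<forall>k::nat. odd k \<longrightarrow> has_bochner_integral L (\<lambda>x. x ^ k) 0) \<and>
    has_bochner_integral L (\<lambda>x. x ^ 2) (7 / 12) \<and>
    has_bochner_integral L (\<lambda>x. x ^ 4) (375 / 368) \<and>
    has_bochner_integral L (\<lambda>x. x ^ 6) (76693 / 22080) \<and>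
    (\<forall>(M :: 'a measure) F P X U. modified_process M F P X U \<longrightarrow>
      (let \<mu> = (\<lambda>\<omega>. mean_pts (core (X 0 \<omega>))); D = (\<lambda>\<omega>. diam_pts (core (X 0 \<omega>))) in
       \<exists>\<xi> \<in> borel_measurable M.
         (AE \<omega> in M. (\<lambda>t. core (X t \<omega>)) \<longlonglongrightarrow> vector [\<xi> \<omega>, \<xi> \<omega>]) \<and>
         distr M borel \<xi> =
           distr (distr M (borel \<Otimes>\<^sub>M borel) (\<lambda>\<omega>. (\<mu> \<omega>, D \<omega>)) \<Otimes>\<^sub>M L) borel
             (\<lambda>((m, d), l). m + d * l) \<and>
         has_bochner_integral M \<xi> (\<integral>\<omega>. \<mu> \<omega> \<partial>M) \<and>
         has_bochner_integral M (\<lambda>\<omega>. \<xi> \<omega> ^ 2)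
           ((\<integral>\<omega>. \<mu> \<omega> ^ 2 \<partial>M) + 7 / 12 * (\<integral>\<omega>. D \<omega> ^ 2 \<partial>M)) \<and>
         has_bochner_integral M (\<lambda>\<omega>. \<xi> \<omega> ^ 3)
           ((\<integral>\<omega>. \<mu> \<omega> ^ 3 \<partial>M) + 7 / 4 * (\<integral>\<omega>. \<mu> \<omega> * D \<omega> ^ 2 \<partial>M)) \<and>
         (prob_space.indep_vars M (\<lambda>_. borel) (\<lambda>i \<omega>. P \<omega> $ i) UNIV \<and>
          (\<forall>i. distr M borel (\<lambda>\<omega>. P \<omega> $ i) = uniform_measure lborel {0..1}) \<longrightarrow>
            has_bochner_integral M \<xi> (1 / 2) \<and>
            has_bochner_integral M (\<lambda>\<omega>. \<xi> \<omega> ^ 2) (1 / 3) \<and>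
            has_bochner_integral M (\<lambda>\<omega>. \<xi> \<omega> ^ 3) (1 / 4)) \<and>
         ((AE \<omega> in M. P \<omega> = vector [1 / 4, 1 / 2, 3 / 4]) \<longrightarrow>
            has_bochner_integral M \<xi> (1 / 2) \<and>
            has_bochner_integral M (\<lambda>\<omega>. \<xi> \<omega> ^ 2) (29 / 96) \<and>
            has_bochner_integral M (\<lambda>\<omega>. \<xi> \<omega> ^ 3) (13 / 64) \<and>
            has_bochner_integral M (\<lambda>\<omega>. \<xi> \<omega> ^ 4) (873 / 5888))))"
proof (intro exI[of _ L_law] conjI allI impI)
  show "fixed_point_law L_law" by (rule fixed_point_L_law)
  show "L' = L_law" if "fixed_point_law L'" for L'
    by (rule fixed_point_law_unique[OF that fixed_point_L_law])
  show "distr L_law borel uminus = L_law" by (rule L_law_symmetric)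
  show "integrable L_law (\<lambda>x. \<bar>x\<bar> ^ k)" for k by (rule integrable_L_law_abs_power)
  show "has_bochner_integral L_law (\<lambda>x. x ^ k) 0" if "odd k" for k
    using L_law_odd_moment[OF that] by (simp add: has_bochner_integral_iff)
  show "has_bochner_integral L_law (\<lambda>x. x ^ 2) (7 / 12)"
    by (simp add: has_bochner_integral_iff L_law_moment_2)
  show "has_bochner_integral L_law (\<lambda>x. x ^ 4) (375 / 368)"
    by (simp add: has_bochner_integral_iff L_law_moment_4)
  show "has_bochner_integral L_law (\<lambda>x. x ^ 6) (76693 / 22080)"
    by (simp add: has_bochner_integral_iff L_law_moment_6)
next
  fix M :: "'a measure" and F P X U
  assume "modified_process M F P X U"
  then interpret modified_process M F P X U .
  show "let \<mu> = (\<lambda>\<omega>. mean_pts (core (X 0 \<omega>))); D = (\<lambda>\<omega>. diam_pts (core (X 0 \<omega>))) in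
       \<exists>\<xi> \<in> borel_measurable M.
         (AE \<omega> in M. (\<lambda>t. core (X t \<omega>)) \<longlonglongrightarrow> vector [\<xi> \<omega>, \<xi> \<omega>]) \<and>
         distr M borel \<xi> =
           distr (distr M (borel \<Otimes>\<^sub>M borel) (\<lambda>\<omega>. (\<mu> \<omega>, D \<omega>)) \<Otimes>\<^sub>M L_law) borel
             (\<lambda>((m, d), l). m + d * l) \<and>
         has_bochner_integral M \<xi> (\<integral>\<omega>. \<mu> \<omega> \<partial>M) \<and>
         has_bochner_integral M (\<lambda>\<omega>. \<xi> \<omega> ^ 2)
           ((\<integral>\<omega>. \<mu> \<omega> ^ 2 \<partial>M) + 7 / 12 * (\<integral>\<omega>. D \<omega> ^ 2 \<partial>M)) \<and>
         has_bochner_integral M (\<lambda>\<omega>. \<xi> \<omega> ^ 3)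
           ((\<integral>\<omega>. \<mu> \<omega> ^ 3 \<partial>M) + 7 / 4 * (\<integral>\<omega>. \<mu> \<omega> * D \<omega> ^ 2 \<partial>M)) \<and>
         (prob_space.indep_vars M (\<lambda>_. borel) (\<lambda>i \<omega>. P \<omega> $ i) UNIV \<and>
          (\<forall>i. distr M borel (\<lambda>\<omega>. P \<omega> $ i) = uniform_measure lborel {0..1}) \<longrightarrow>
            has_bochner_integral M \<xi> (1 / 2) \<and>
            has_bochner_integral M (\<lambda>\<omega>. \<xi> \<omega> ^ 2) (1 / 3) \<and>
            has_bochner_integral M (\<lambda>\<omega>. \<xi> \<omega> ^ 3) (1 / 4)) \<and>
         ((AE \<omega> in M. P \<omega> = vector [1 / 4, 1 / 2, 3 / 4]) \<longrightarrow>
            has_bochner_integral M \<xi> (1 / 2) \<and>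
            has_bochner_integral M (\<lambda>\<omega>. \<xi> \<omega> ^ 2) (29 / 96) \<and>
            has_bochner_integral M (\<lambda>\<omega>. \<xi> \<omega> ^ 3) (13 / 64) \<and>
            has_bochner_integral M (\<lambda>\<omega>. \<xi> \<omega> ^ 4) (873 / 5888))"
    unfolding Let_def
  proof (intro bexI[OF _ measurable_limit_point] conjI impI)
    show "distr M borel limit_point =
        distr (distr M (borel \<Otimes>\<^sub>M borel) (\<lambda>\<omega>. (mid 0 \<omega>, wid 0 \<omega>)) \<Otimes>\<^sub>M L_law) borel (\<lambda>((m, d), l). m + d * l)"
      by (rule distr_limit_point[unfolded limit_law_def])
  qed (use AE_core_tendsto limit_point_moments uniform_moments tie_config_moments in \<open>simp_all only: simp_thms\<close>)
qed

end
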